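(* Let $\lambda\in\mathbf{k}$ be arbitrary. Let $A$ be an algebra with a presentation $A=\mathbf{k}\langle X\rangle/I_A$, with $X$ well-ordered, and let $S_A$ be a Gröbner-Shirshov basis of the ideal $I_A$ in $\mathbf{k}\langle X\rangle$ with respect to the deg-lex order on $M(X)$. Let $\hat S_A:=\hat i_X(S_A)$ and $\overline{S_A}:=\{\overline s\mid s\in S_A\}$. Then the set $\mathrm{DIrr}(\hat S_A)$ of differential $\hat S_A$-irreducible words is $$\mathrm{DIrr}(\hat S_A)=\left\{\mathfrak x\in M(\Delta(X))\ \big|\ \overline s^{[n]}\nmid\mathfrak x\ \text{for any } \overline s\in\overline{S_A},\ n\ge0\right\},$$ and it gives a $\mathbf{k}$-linear basis of the free differential algebra $\mathcal{D}_\lambda(A)=\mathbf{k}\langle\Delta(X)\rangle/\mathrm{DI}(\hat S_A)$ of weight $\lambda$ on $A$.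
   Context: $\mathbf{k}$ is a field of characteristic $0$; algebras are associative unital $\mathbf{k}$-algebras. **Differential algebras.** A differential algebra of weight $\lambda$ is an algebra $R$ with a linear map $d:R\to R$ such that $d(xy)=d(x)y+x\,d(y)+\lambda d(x)d(y)$ for all $x,y\in R$ and $d(1)=0$; homomorphisms are algebra homomorphisms commuting with the operators. A differential ideal is an ideal $I$ with $d(I)\subseteq I$; $\mathrm{DI}(U)$ is the smallest differential ideal containing $U$. The free differential algebra of weight $\lambda$ on an algebra $A$ is a differential algebra $(\mathcal{D}_\lambda(A),d_A)$ of weight $\lambda$ with an algebra homomorphism $i_A:A\to\mathcal{D}_\lambda(A)$ such that every algebra homomorphism $\varphi:A\to R$ to a differential algebra $(R,d)$ of weight $\lambda$ factors as $\varphi=\bar\varphi\circ i_A$ for a unique differential algebra homomorphism $\bar\varphi$. **The algebra $\mathbf{k}\langle\Delta(X)\rangle$.** $\Delta(X)=\{x^{(n)}\mid x\in X,\ n\ge0\}$ (distinct symbols). $\mathbf{k}\langle\Delta(X)\rangle$ is the noncommutative polynomial algebra, with the unique weight-$\lambda$ differential operator $d_X$ such that $d_X(x^{(n)})=x^{(n+1)}$. $M(Y)$ is the free monoid on $Y$ (words, including $1$). $\hat i_X:\mathbf{k}\langle X\rangle\to\mathbf{k}\langle\Delta(X)\rangle$ is the algebra embedding $x\mapsto x^{(0)}$. **Orders.** The well-order $<$ on $X$ is extended to $\Delta(X)$ by: $x^{(m)}\prec y^{(n)}$ iff $m<n$, or $m=n$ and $x<y$. On $M(X)$ and $M(\Delta(X))$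 use the deg-lex orders: first compare the number of letters $|u|$ (fewer letters is smaller), then compare lexicographically from the left. $\overline f$ denotes the leading monomial of $f\neq0$ (only formed for nonzero polynomials). **Gröbner-Shirshov bases in $\mathbf{k}\langle X\rangle$.** A set $S$ of monic polynomials is a Gröbner-Shirshov basis of the ideal $I$ if it generates $I$ and for all $f,g\in S$: whenever $w=\overline f u=v\overline g$ with $u,v\in M(X)$ and $|w|<|\overline f|+|\overline g|$, the element $fu-vg$ is trivial modulo $(S,w)$; and whenever $w=\overline f=u\overline g v$ with $u,v\in M(X)$, the element $f-ugv$ is trivial modulo $(S,w)$. Here trivial modulo $(S,w)$ means equal to a finite sum $\sum_r c_r a_r s_r b_r$ with $c_r\in\mathbf{k}$, $s_r\in S$, $a_r,b_r\in M(X)$ and $a_r\overline{s_r}b_r<w$ for all $r$. **Notation.** For $S\subseteq\mathbf{k}\langle\Delta(X)\rangle$ monic, $\mathrm{DIrr}(S):=M(\Delta(X))\setminus\{a\,\overline{d_X^i(s)}\,b\mid s\in S,\ a,b\in M(\Delta(X)),\ i\ge0\}$. For $\mathfrak u,\mathfrak v\in M(\Delta(X))$, $\mathfrak v\mid\mathfrak u$ means $\mathfrak u=\mathfrak a\mathfrak v\mathfrak b$ for some $\mathfrak a,\mathfrak b\in M(\Delta(X))$; $\mathfrak v\nmid\mathfrak u$ is the negation. For a word $\mathfrak x=x_1\cdots x_k$ with $k\ge1$, $x_i\in X$, and $n\ge0$, put $\mathfrak x^{[n]}:=x_1^{(n)}x_2^{(n)}\cdots x_k^{(n)}$ if $\lambda\ne0$,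 and $\mathfrak x^{[n]}:=x_1^{(n)}x_2^{(0)}\cdots x_k^{(0)}$ if $\lambda=0$; for the empty word, $1^{[n]}:=1$. A set of words "gives a basis" of a quotient if the residue classes of its (distinct) elements form a basis. *)

theory Defs
  imports
    "HOL-Library.Poly_Mapping"
    "HOL-Library.Sublist"
    "HOL-Algebra.QuotRing"
    "HOL-Algebra.Module"
    "HOL-Algebra.Algebraic_Closure_Type"
begin

section \<open>Associative algebras over a field\<close>

text \<open>
  The ground field is a type of class \<open>field\<close>, turned into a HOL-Algebra record by
  \<open>ring_of_type_algebra\<close>. All other algebras are records with explicit carriers: quotients are
  formed, and they may be the zero algebra, which the class \<open>ring_1\<close> excludes. (The locale
  \<open>algebra\<close> of HOL-Algebra is restricted to commutative algebras.)
\<close>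

locale assoc_algebra =
  ring A + module "ring_of_type_algebra :: 'k::field ring" A
  for A :: "('k::field, 'a) module" (structure) +
  assumes smult_mult_left:
      "\<lbrakk>x \<in> carrier A; y \<in> carrier A\<rbrakk> \<Longrightarrow> (c \<odot> x) \<otimes> y = c \<odot> (x \<otimes> y)"
    and smult_mult_right:
      "\<lbrakk>x \<in> carrier A; y \<in> carrier A\<rbrakk> \<Longrightarrow> x \<otimes> (c \<odot> y) = c \<odot> (x \<otimes> y)"

definition alg_hom :: "('k, 'a) module \<Rightarrow> ('k, 'b) module \<Rightarrow> ('a \<Rightarrow> 'b) set" where
  "alg_hom A B =
     {h \<in> ring_hom A B. \<forall>c. \<forall>x \<in> carrier A. h (c \<odot>\<^bsub>A\<^esub> x) = c \<odot>\<^bsub>B\<^esub> h x}"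

text \<open>
  The map on cosets induced by \<open>f\<close>; it sends \<open>J + x\<close> to \<open>J + f x\<close> whenever \<open>f\<close> is additive and
  maps \<open>J\<close> into \<open>J\<close>. The union follows the library's \<open>rcoset_mult\<close>.
\<close>

definition quot_map :: "('a, 'm) ring_scheme \<Rightarrow> 'a set \<Rightarrow> ('a \<Rightarrow> 'a) \<Rightarrow> 'a set \<Rightarrow> 'a set" where
  "quot_map R J f C = (\<Union>x\<in>C. J +>\<^bsub>R\<^esub> f x)"

definition quotient_algebra :: "('k, 'a) module \<Rightarrow> 'a set \<Rightarrow> ('k, 'a set) module" where
  "quotient_algebra A J =
     \<lparr>carrier = carrier (A Quot J), monoid.mult = (\<otimes>\<^bsub>A Quot J\<^esub>), one = \<one>\<^bsub>A Quot J\<^esub>,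
      zero = \<zero>\<^bsub>A Quot J\<^esub>, add = (\<oplus>\<^bsub>A Quot J\<^esub>),
      module.smult = (\<lambda>c. quot_map A J (\<lambda>x. c \<odot>\<^bsub>A\<^esub> x))\<rparr>"

definition linear_basis :: "('k::field, 'a) module \<Rightarrow> 'a set \<Rightarrow> bool" where
  "linear_basis A B \<longleftrightarrow>
     B \<subseteq> carrier A \<and>
     (\<forall>F c. finite F \<and> F \<subseteq> B \<and> (\<Oplus>\<^bsub>A\<^esub>b\<in>F. c b \<odot>\<^bsub>A\<^esub> b) = \<zero>\<^bsub>A\<^esub>
        \<longrightarrow> (\<forall>b\<in>F. c b = 0)) \<and>
     (\<forall>v\<in>carrier A. \<exists>F c. finite F \<and> F \<subseteq> B \<and> v = (\<Oplus>\<^bsub>A\<^esub>b\<in>F. c b \<odot>\<^bsub>A\<^esub> b))"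


section \<open>Differential algebras of weight \<open>\<lambda>\<close>\<close>

locale differential_algebra = assoc_algebra R
  for lam :: "'k::field" and R :: "('k::field, 'a) module" (structure) and d :: "'a \<Rightarrow> 'a" +
  assumes d_closed: "x \<in> carrier R \<Longrightarrow> d x \<in> carrier R"
    and d_add: "\<lbrakk>x \<in> carrier R; y \<in> carrier R\<rbrakk> \<Longrightarrow> d (x \<oplus> y) = d x \<oplus> d y"
    and d_smult: "x \<in> carrier R \<Longrightarrow> d (c \<odot> x) = c \<odot> d x"
    and d_mult: "\<lbrakk>x \<in> carrier R; y \<in> carrier R\<rbrakk> \<Longrightarrow>
      d (x \<otimes> y) = d x \<otimes> y \<oplus> x \<otimes> d y \<oplus> lam \<odot> (d x \<otimes> d y)"
    and d_one: "d \<one> = \<zero>"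

definition diff_hom ::
  "('k, 'a) module \<Rightarrow> ('a \<Rightarrow> 'a) \<Rightarrow> ('k, 'b) module \<Rightarrow> ('b \<Rightarrow> 'b) \<Rightarrow> ('a \<Rightarrow> 'b) set" where
  "diff_hom R d R' d' = {h \<in> alg_hom R R'. \<forall>x \<in> carrier R. h (d x) = d' (h x)}"

definition diff_ideal_gen :: "('k, 'a) module \<Rightarrow> ('a \<Rightarrow> 'a) \<Rightarrow> 'a set \<Rightarrow> 'a set" where
  "diff_ideal_gen R d U = \<Inter>{J. ideal J R \<and> d ` J \<subseteq> J \<and> U \<subseteq> J}"

text \<open>
  The universal property quantifies over the differential algebras whose elements live in the
  type \<open>'r\<close>; a theorem in which \<open>'r\<close> is a free type variable asserts it for all of them. Maps are
  taken to be extensional so that uniqueness concerns their values on the carrier only.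
\<close>

definition free_differential_algebra ::
  "'r itself \<Rightarrow> 'k::field \<Rightarrow> ('k, 'a) module \<Rightarrow> ('k, 'd) module \<Rightarrow> ('d \<Rightarrow> 'd) \<Rightarrow> ('a \<Rightarrow> 'd) \<Rightarrow> bool"
  where
  "free_differential_algebra _ lam A D dD i \<longleftrightarrow>
     differential_algebra lam D dD \<and> i \<in> alg_hom A D \<and>
     (\<forall>(R :: ('k, 'r) module) d \<phi>.
        differential_algebra lam R d \<and> \<phi> \<in> alg_hom A R \<longrightarrow>
        (\<exists>!\<psi>. \<psi> \<in> extensional (carrier D) \<and> \<psi> \<in> diff_hom D dD R d \<and>
              (\<forall>x \<in> carrier A. \<phi> x = \<psi> (i x))))"


section \<open>Noncommutative polynomials\<close>

text \<open>
  Lists under concatenation are the free monoid, so that \<open>'y list \<Rightarrow>\<^sub>0 'k\<close> with the convolution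
  product of \<open>Poly_Mapping\<close> is the free associative algebra on the type \<open>'y\<close>.
\<close>

instantiation list :: (type) monoid_add
begin

definition zero_list :: "'a list" where "zero_list = []"

definition plus_list :: "'a list \<Rightarrow> 'a list \<Rightarrow> 'a list" where "plus_list = (@)"

instance by standard (simp_all add: zero_list_def plus_list_def)

end

type_synonym ('y, 'k) npoly = "'y list \<Rightarrow>\<^sub>0 'k"

abbreviation word :: "'y list \<Rightarrow> ('y, 'k::field) npoly" where
  "word w \<equiv> Poly_Mapping.single w 1"

abbreviation const :: "'k::field \<Rightarrow> ('y, 'k) npoly" where
  "const c \<equiv> Poly_Mapping.single [] c"

text \<open>
  The generators form a subset \<open>Y\<close> of the type, which may be empty; \<open>lists Y\<close> is the free monoid
  \<open>M(Y)\<close>.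
\<close>

definition free_algebra :: "'y set \<Rightarrow> ('k::field, ('y, 'k) npoly) module" where
  "free_algebra Y =
     \<lparr>carrier = {p. Poly_Mapping.keys p \<subseteq> lists Y}, monoid.mult = (*), one = 1, zero = 0, add = (+),
      module.smult = (\<lambda>c p. const c * p)\<rparr>"

text \<open>The linear map with prescribed values on the words.\<close>

definition linear_ext ::
  "('y list \<Rightarrow> ('z, 'k) npoly) \<Rightarrow> ('y, 'k::field) npoly \<Rightarrow> ('z, 'k) npoly" where
  "linear_ext g p = (\<Sum>w\<in>Poly_Mapping.keys p. const (Poly_Mapping.lookup p w) * g w)"


section \<open>Leading monomials and Groebner-Shirshov bases\<close>

text \<open>
  For a strict order \<open>r\<close> on letters, the library relation \<open>lenlex r\<close> is the induced deg-lex order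
  on words. The leading monomial is meaningful for nonzero polynomials only.
\<close>

definition lead :: "'y rel \<Rightarrow> ('y, 'k::field) npoly \<Rightarrow> 'y list" where
  "lead r p = (THE w. w \<in> Poly_Mapping.keys p \<and> (\<forall>v \<in> Poly_Mapping.keys p. v \<noteq> w \<longrightarrow> (v, w) \<in> lenlex r))"

definition monic :: "'y rel \<Rightarrow> ('y, 'k::field) npoly \<Rightarrow> bool" where
  "monic r p \<longleftrightarrow> p \<noteq> 0 \<and> Poly_Mapping.lookup p (lead r p) = 1"

definition trivial_modulo ::
  "'y rel \<Rightarrow> 'y set \<Rightarrow> ('y, 'k::field) npoly set \<Rightarrow> 'y list \<Rightarrow> ('y, 'k) npoly \<Rightarrow> bool" where
  "trivial_modulo r Y S w p \<longleftrightarrow>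
     (\<exists>ts :: ('k \<times> 'y list \<times> ('y, 'k) npoly \<times> 'y list) list.
        (\<forall>(c, a, s, b) \<in> set ts.
           s \<in> S \<and> a \<in> lists Y \<and> b \<in> lists Y \<and> (a @ lead r s @ b, w) \<in> lenlex r) \<and>
        p = (\<Sum>(c, a, s, b) \<leftarrow> ts. const c * (word a * s * word b)))"

definition groebner_shirshov_basis ::
  "'y rel \<Rightarrow> 'y set \<Rightarrow> ('y, 'k::field) npoly set \<Rightarrow> ('y, 'k) npoly set \<Rightarrow> bool" where
  "groebner_shirshov_basis r Y S I \<longleftrightarrow>
     S \<subseteq> carrier (free_algebra Y) \<and>
     (\<forall>s \<in> S. monic r s) \<and>
     I = Idl\<^bsub>free_algebra Y\<^esub> S \<and>
     (\<forall>f \<in> S. \<forall>g \<in> S.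
        (\<forall>w. \<forall>u \<in> lists Y. \<forall>v \<in> lists Y.
           w = lead r f @ u \<and> w = v @ lead r g \<and> length w < length (lead r f) + length (lead r g)
           \<longrightarrow> trivial_modulo r Y S w (f * word u - word v * g)) \<and>
        (\<forall>w. \<forall>u \<in> lists Y. \<forall>v \<in> lists Y.
           w = lead r f \<and> w = u @ lead r g @ v
           \<longrightarrow> trivial_modulo r Y S w (f - word u * g * word v)))"


section \<open>Differential polynomials\<close>

text \<open>
  The alphabet is written \<open>\<X>\<close> because a plain \<open>X\<close> is syntax in HOL-Algebra. The letter \<open>x\<^sup>(\<^sup>n\<^sup>)\<close> is
  encoded as the pair \<open>(x, n)\<close>.
\<close>

definition Delta :: "'x set \<Rightarrow> ('x \<times> nat) set" where
  "Delta \<X> = \<X> \<times> UNIV"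

definition letter_less :: "('x::wellorder) rel" where
  "letter_less = {(x, y). x < y}"

definition dletter_less :: "('x::wellorder \<times> nat) rel" where
  "dletter_less = {((x, m), (y, n)). m < n \<or> (m = n \<and> x < y)}"

text \<open>
  The recursion is the Leibniz rule for \<open>x\<^sup>(\<^sup>n\<^sup>) \<cdot> w\<close>. The lemmas below show that the resulting
  \<open>dX\<close> is the unique weight \<open>\<lambda>\<close> differential operator with \<open>x\<^sup>(\<^sup>n\<^sup>) \<mapsto> x\<^sup>(\<^sup>n\<^sup>+\<^sup>1\<^sup>)\<close>.
\<close>

fun word_deriv :: "'k::field \<Rightarrow> ('x \<times> nat) list \<Rightarrow> ('x \<times> nat, 'k) npoly" where
  "word_deriv lam [] = 0"
| "word_deriv lam ((x, n) # w) =
     word [(x, Suc n)] * word w + word [(x, n)] * word_deriv lam w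
     + const lam * (word [(x, Suc n)] * word_deriv lam w)"

definition dX :: "'k::field \<Rightarrow> ('x \<times> nat, 'k) npoly \<Rightarrow> ('x \<times> nat, 'k) npoly" where
  "dX lam = linear_ext (word_deriv lam)"

definition emb :: "('x, 'k::field) npoly \<Rightarrow> ('x \<times> nat, 'k) npoly" where
  "emb = linear_ext (\<lambda>w. word (map (\<lambda>x. (x, 0)) w))"

definition DIrr ::
  "'k::field \<Rightarrow> 'x::wellorder set \<Rightarrow> ('x \<times> nat, 'k) npoly set \<Rightarrow> ('x \<times> nat) list set" where
  "DIrr lam \<X> S = lists (Delta \<X>) -
     {a @ lead dletter_less ((dX lam ^^ i) s) @ b | a b s i.
        s \<in> S \<and> a \<in> lists (Delta \<X>) \<and> b \<in> lists (Delta \<X>) \<and> (dX lam ^^ i) s \<noteq> 0}"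

definition bracket_word :: "'k::field \<Rightarrow> nat \<Rightarrow> 'x list \<Rightarrow> ('x \<times> nat) list" where
  "bracket_word lam n w =
     (case w of
        [] \<Rightarrow> []
      | x # xs \<Rightarrow>
          if lam \<noteq> 0 then map (\<lambda>y. (y, n)) w else (x, n) # map (\<lambda>y. (y, 0)) xs)"


section \<open>Well-definedness of the notions above\<close>

lemma word_mult: "word u * word v = (word (u @ v) :: ('y, 'k::field) npoly)"
  by (simp add: mult_single plus_list_def)

lemma const_single: "const c * word w = (Poly_Mapping.single w c :: ('y, 'k::field) npoly)"
  by (simp add: mult_single plus_list_def)

lemma const_one: "const 1 = (1 :: ('y, 'k::field) npoly)"
  by (metis single_one zero_list_def)

lemma const_mult: "const a * const b = (const (a * b) :: ('y, 'k::field) npoly)"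
  by (simp add: mult_single plus_list_def)

lemma lookup_const_mult: "Poly_Mapping.lookup (const c * p) w = c * Poly_Mapping.lookup (p :: ('y, 'k::field) npoly) w"
proof -
  have "const c * p = Poly_Mapping.map ((*) c) p"
    by (metis mult_map_scale_conv_mult zero_list_def)
  then show ?thesis
    by (simp add: Poly_Mapping.map.rep_eq when_def)
qed

lemma npoly_eq_sum: "p = (\<Sum>w\<in>Poly_Mapping.keys p. Poly_Mapping.single w (Poly_Mapping.lookup p w))"
proof (rule poly_mapping_eqI)
  fix v
  show "Poly_Mapping.lookup p v = Poly_Mapping.lookup (\<Sum>w\<in>Poly_Mapping.keys p. Poly_Mapping.single w (Poly_Mapping.lookup p w)) v"
    by (simp add: lookup_sum lookup_single when_def in_keys_iff)
qed

lemma npoly_induct [case_names zero single add]: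
  fixes p :: "('y, 'k::field) npoly"
  assumes "P 0" "\<And>w c. P (Poly_Mapping.single w c)" "\<And>p q. P p \<Longrightarrow> P q \<Longrightarrow> P (p + q)"
  shows "P p"
proof -
  have "P (\<Sum>w\<in>F. Poly_Mapping.single w (Poly_Mapping.lookup p w))" if "finite F" for F
    using that by (induction F) (auto intro: assms)
  then show ?thesis
    using npoly_eq_sum[of p] by (metis finite_keys)
qed

lemma const_central: "p * const c = const c * (p :: ('y, 'k::field) npoly)"
proof (induction p rule: npoly_induct)
  case (single w a)
  then show ?case
    by (simp add: mult_single plus_list_def mult.commute)
next
  case (add p q)
  then show ?case
    by (simp add: algebra_simps)
qed simp

lemma const_left_commute: "const a * (const b * p) = const b * (const a * (p :: ('y, 'k::field) npoly))"
  by (simp add: const_mult mult.commute flip: mult.assoc)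

lemma const_mult_mult:
  "(const a * p) * (const b * q) = const a * (const b * (p * (q :: ('y, 'k::field) npoly)))"
  by (metis const_central mult.assoc)

lemma keys_mult_lists:
  fixes p q :: "('y, 'k::field) npoly"
  assumes "Poly_Mapping.keys p \<subseteq> lists Y" "Poly_Mapping.keys q \<subseteq> lists Y"
  shows "Poly_Mapping.keys (p * q) \<subseteq> lists Y"
  using keys_mult[of p q] assms by (fastforce simp: plus_list_def)

lemma keys_one_lists: "Poly_Mapping.keys (1 :: ('y, 'k::field) npoly) \<subseteq> lists Y"
  by (simp flip: const_one)

lemma keys_const_mult:
  fixes p :: "('y, 'k::field) npoly"
  shows "Poly_Mapping.keys (const c * p) \<subseteq> Poly_Mapping.keys p"
  by (auto simp: in_keys_iff lookup_const_mult)

lemma free_algebra_simps: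
  "carrier (free_algebra Y) = {p. Poly_Mapping.keys p \<subseteq> lists Y}"
  "monoid.mult (free_algebra Y) = (*)"
  "\<one>\<^bsub>free_algebra Y\<^esub> = 1"
  "\<zero>\<^bsub>free_algebra Y\<^esub> = 0"
  "ring.add (free_algebra Y) = (+)"
  "module.smult (free_algebra Y) = (\<lambda>c p. const c * p)"
  by (simp_all add: free_algebra_def)

lemma assoc_algebra_free_algebra: "assoc_algebra (free_algebra Y :: ('k::field, ('y, 'k) npoly) module)"
proof -
  have group: "abelian_group (free_algebra Y :: ('k, ('y, 'k) npoly) module)"
  proof (rule abelian_groupI; simp add: free_algebra_simps)
    fix p q :: "('y, 'k) npoly"
    assume "Poly_Mapping.keys p \<subseteq> lists Y" "Poly_Mapping.keys q \<subseteq> lists Y"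
    then show "Poly_Mapping.keys (p + q) \<subseteq> lists Y"
      using Poly_Mapping.keys_add[of p q] by blast
  next
    fix p :: "('y, 'k) npoly"
    assume "Poly_Mapping.keys p \<subseteq> lists Y"
    then show "\<exists>q. Poly_Mapping.keys q \<subseteq> lists Y \<and> q + p = 0"
      by (intro exI[of _ "- p"]) simp
  qed
  have ring: "ring (free_algebra Y :: ('k, ('y, 'k) npoly) module)"
  proof (rule ringI[OF group])
    show "monoid (free_algebra Y :: ('k, ('y, 'k) npoly) module)"
      by (rule monoidI)
        (simp_all add: free_algebra_simps mult.assoc keys_mult_lists keys_one_lists zero_list_def)
  qed (auto simp: free_algebra_simps algebra_simps)
  have "module (ring_of_type_algebra :: 'k ring) (free_algebra Y :: ('k, ('y, 'k) npoly) module)"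
    by (intro moduleI group)
      (simp_all add: free_algebra_simps cring_from_type_algebra,
        simp_all add: ring_of_type_algebra_def const_one distrib_left distrib_right single_add
          mult.assoc order.trans[OF keys_const_mult] flip: const_mult)
  then show ?thesis
    using ring
    by (intro assoc_algebra.intro assoc_algebra_axioms.intro)
      (simp_all add: free_algebra_simps mult.assoc,
        metis const_central mult.assoc)
qed

lemma linear_ext_superset:
  assumes "finite F" "Poly_Mapping.keys p \<subseteq> F"
  shows "linear_ext g p = (\<Sum>w\<in>F. const (Poly_Mapping.lookup p w) * g w)"
  unfolding linear_ext_def using assms
  by (intro sum.mono_neutral_left) (auto simp: in_keys_iff)

lemma linear_ext_add: "linear_ext g (p + q) = linear_ext g p + linear_ext g q"
proof -
  have "Poly_Mapping.keys (p + q) \<subseteq> Poly_Mapping.keys p \<union> Poly_Mapping.keys q"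
    by (rule Poly_Mapping.keys_add)
  then show ?thesis
    by (simp add: linear_ext_superset[of "Poly_Mapping.keys p \<union> Poly_Mapping.keys q"] lookup_add single_add
        distrib_right sum.distrib)
qed

lemma linear_ext_const_mult: "linear_ext g (const c * p) = const c * linear_ext g p"
  by (simp add: linear_ext_superset[OF finite_keys keys_const_mult, of _ c p] linear_ext_def[of g p]
      sum_distrib_left lookup_const_mult mult.assoc flip: const_mult)

lemma linear_ext_single: "linear_ext g (Poly_Mapping.single w c) = const c * g w"
  by (cases "c = 0") (simp_all add: linear_ext_def)

lemma linear_ext_0: "linear_ext g 0 = 0"
  by (simp add: linear_ext_def)

lemma word_deriv_append:
  fixes lam :: "'k::field" and u v :: "('x \<times> nat) list"
  shows "word_deriv lam (u @ v) = word_deriv lam u * word v + word u * word_deriv lam v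
     + const lam * (word_deriv lam u * word_deriv lam v)"
proof (induction u)
  case Nil
  have "word [] = (1 :: ('x \<times> nat, 'k) npoly)" by (rule const_one)
  then show ?case by simp
next
  case (Cons l u)
  obtain x n where l: "l = (x, n)" by (cases l)
  define a where "a = (word [(x, Suc n)] :: ('x \<times> nat, 'k) npoly)"
  define b where "b = (word [(x, n)] :: ('x \<times> nat, 'k) npoly)"
  have uv: "word (u @ v) = (word u * word v :: ('x \<times> nat, 'k) npoly)"
    by (simp add: word_mult)
  have lu: "word ((x, n) # u) = (b * word u :: ('x \<times> nat, 'k) npoly)"
    by (simp add: b_def word_mult)
  have c: "p * (const lam * q) = const lam * (p * q)" for p q :: "('x \<times> nat, 'k) npoly"
    by (metis const_central mult.assoc)
  show ?case
    by (simp add: l uv lu Cons.IH flip: a_def b_def)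
      (simp add: algebra_simps c[of a] c[of b])
qed

lemma dX_letter: "dX lam (word [(x, n)]) = word [(x, Suc n)]"
  by (simp add: dX_def linear_ext_single const_one)

lemma dX_mult:
  fixes lam :: "'k::field" and p q :: "('x \<times> nat, 'k) npoly"
  shows "dX lam (p * q) = dX lam p * q + p * dX lam q + const lam * (dX lam p * dX lam q)"
proof (induction p rule: npoly_induct)
  case (single u a)
  show ?case
  proof (induction q rule: npoly_induct)
    case (single v b)
    define U where "U = (word u :: ('x \<times> nat, 'k) npoly)"
    define V where "V = (word v :: ('x \<times> nat, 'k) npoly)"
    have su: "Poly_Mapping.single u a = const a * U" and sv: "Poly_Mapping.single v b = const b * V"
      by (simp_all only: U_def V_def const_single)
    have du: "dX lam (const a * U) = const a * word_deriv lam u"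
      and dv: "dX lam (const b * V) = const b * word_deriv lam v"
      by (simp_all only: dX_def linear_ext_single su[symmetric] sv[symmetric])
    have "dX lam ((const a * U) * (const b * V)) = const a * (const b * word_deriv lam (u @ v))"
      by (simp add: U_def V_def const_mult_mult word_mult)
        (simp add: dX_def linear_ext_const_mult linear_ext_single const_one)
    then show ?case
      unfolding su sv du dv word_deriv_append U_def[symmetric] V_def[symmetric] const_mult_mult
      by (simp only: distrib_left const_left_commute[of lam])
  next
    case (add p q)
    then show ?case
      by (simp add: dX_def linear_ext_add algebra_simps)
  qed (simp add: dX_def linear_ext_0)
next
  case (add p q)
  then show ?case
    by (simp add: dX_def linear_ext_add algebra_simps)
qed (simp add: dX_def linear_ext_0)

lemma keys_word_deriv:
  fixes lam :: "'k::field"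
  shows "w \<in> lists (Delta \<X>) \<Longrightarrow> Poly_Mapping.keys (word_deriv lam w) \<subseteq> lists (Delta \<X>)"
proof (induction lam w rule: word_deriv.induct)
  case (2 lam x n w)
  have l: "Poly_Mapping.keys (word [(x, m)] :: (_, 'k) npoly) \<subseteq> lists (Delta \<X>)" for m
    using 2 by (auto simp: Delta_def)
  have w: "Poly_Mapping.keys (word w :: (_, 'k) npoly) \<subseteq> lists (Delta \<X>)"
    using 2 by auto
  have IH: "Poly_Mapping.keys (word_deriv lam w) \<subseteq> lists (Delta \<X>)"
    using 2 by auto
  show ?case
    unfolding word_deriv.simps
    by (intro order.trans[OF Poly_Mapping.keys_add] Un_least keys_mult_lists l w IH)
      simp
qed simp

lemma keys_dX:
  assumes "Poly_Mapping.keys p \<subseteq> lists (Delta \<X>)"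
  shows "Poly_Mapping.keys (dX lam p) \<subseteq> lists (Delta \<X>)"
proof -
  have "Poly_Mapping.keys (dX lam p) \<subseteq> (\<Union>w\<in>Poly_Mapping.keys p. Poly_Mapping.keys (const (Poly_Mapping.lookup p w) * word_deriv lam w))"
    unfolding dX_def linear_ext_def by (rule keys_sum)
  also have "\<dots> \<subseteq> lists (Delta \<X>)"
    using assms keys_const_mult keys_word_deriv by blast
  finally show ?thesis .
qed

theorem differential_algebra_dX: "differential_algebra lam (free_algebra (Delta \<X>)) (dX lam)"
proof -
  have "dX lam 1 = 0"
    by (simp add: dX_def linear_ext_single flip: const_one)
  then show ?thesis
    by (intro differential_algebra.intro assoc_algebra_free_algebra
        differential_algebra_axioms.intro)
      (simp_all add: free_algebra_simps keys_dX dX_mult,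
        simp_all add: dX_def linear_ext_add linear_ext_const_mult linear_ext_single)
qed

theorem dX_unique:
  fixes lam :: "'k::field" and d :: "('x \<times> nat, 'k) npoly \<Rightarrow> ('x \<times> nat, 'k) npoly"
  assumes "differential_algebra lam (free_algebra (Delta \<X>)) d"
    and letter: "\<And>x n. x \<in> \<X> \<Longrightarrow> d (word [(x, n)]) = word [(x, Suc n)]"
    and "p \<in> carrier (free_algebra (Delta \<X>))"
  shows "d p = dX lam p"
proof -
  interpret differential_algebra lam "free_algebra (Delta \<X>)" d by fact
  note [simp] = free_algebra_simps
  have word_eq: "d (word w) = word_deriv lam w" if "w \<in> lists (Delta \<X>)" for w
    using that
  proof (induction w)
    case Nil
    show ?case using d_one by (simp add: const_one)
  next
    case (Cons l w)
    obtain x n where l: "l = (x, n)" "x \<in> \<X>"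
      using Cons.hyps by (auto simp: Delta_def)
    have "d (word [l] * word w) =
        d (word [l]) * word w + word [l] * d (word w) + const lam * (d (word [l]) * d (word w))"
      using Cons.hyps d_mult[of "word [l]" "word w"] by simp
    then show ?case
      using Cons.IH l letter by (simp add: word_mult)
  qed
  have "d (\<Sum>w\<in>F. const (Poly_Mapping.lookup p w) * word w) = (\<Sum>w\<in>F. const (Poly_Mapping.lookup p w) * word_deriv lam w)"
    if "finite F" "F \<subseteq> lists (Delta \<X>)" for F
    using that
  proof (induction F)
    case empty
    have "d 0 = const 0 * d 0" using d_smult[of 0 0] by simp
    then show ?case by simp
  next
    case (insert w F)
    have w: "Poly_Mapping.keys (const (Poly_Mapping.lookup p w) * word w :: ('x \<times> nat, 'k) npoly) \<subseteq> lists (Delta \<X>)"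
      using insert.prems by (auto simp: const_single)
    have F: "Poly_Mapping.keys (\<Sum>w\<in>F. const (Poly_Mapping.lookup p w) * word w :: ('x \<times> nat, 'k) npoly) \<subseteq> lists (Delta \<X>)"
      using insert.prems by (intro order.trans[OF keys_sum]) (auto simp: const_single split: if_splits)
    show ?case
      using insert w F d_add[of "const (Poly_Mapping.lookup p w) * word w" "\<Sum>w\<in>F. const (Poly_Mapping.lookup p w) * word w"]
        d_smult[of "word w" "Poly_Mapping.lookup p w"] word_eq[of w]
      by simp
  qed
  from this[of "Poly_Mapping.keys p"] have
    "d (\<Sum>w\<in>Poly_Mapping.keys p. const (Poly_Mapping.lookup p w) * word w) = dX lam p"
    using assms(3) by (simp add: dX_def linear_ext_def)
  then show ?thesis
    by (simp only: const_single npoly_eq_sum[symmetric])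
qed

lemma letter_less_order: "trans letter_less" "total letter_less" "irrefl letter_less"
  by (auto simp: letter_less_def trans_def total_on_def irrefl_def)

lemma dletter_less_order: "trans dletter_less" "total dletter_less" "irrefl dletter_less"
  by (auto simp: dletter_less_def trans_def total_on_def irrefl_def)

lemma lead_greatest:
  assumes r: "trans r" "total r" "irrefl r" and p: "p \<noteq> 0"
  shows "lead r p \<in> Poly_Mapping.keys p" "v \<in> Poly_Mapping.keys p \<Longrightarrow> v \<noteq> lead r p \<Longrightarrow> (v, lead r p) \<in> lenlex r"
proof -
  have tr: "trans (lenlex r)" and tot: "total (lenlex r)" and irr: "irrefl (lenlex r)"
    using r lenlex_irreflexive[of r] by (auto intro: total_lenlex lenlex_transI simp: irrefl_def)
  have "\<exists>w\<in>F. \<forall>v\<in>F. v \<noteq> w \<longrightarrow> (v, w) \<in> lenlex r" if "finite F" "F \<noteq> {}" for F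
    using that
  proof (induction F rule: finite_ne_induct)
    case (insert u F)
    then obtain w where w: "w \<in> F" "\<forall>v\<in>F. v \<noteq> w \<longrightarrow> (v, w) \<in> lenlex r" by blast
    consider "(u, w) \<in> lenlex r" | "(w, u) \<in> lenlex r"
      using tot w(1) insert.hyps by (metis UNIV_I total_on_def)
    then show ?case
    proof cases
      case 1
      then show ?thesis using w by blast
    next
      case 2
      then have "\<forall>v\<in>F. (v, u) \<in> lenlex r" using w tr by (metis transD)
      then show ?thesis by blast
    qed
  qed simp
  then obtain w where w: "w \<in> Poly_Mapping.keys p" "\<forall>v\<in>Poly_Mapping.keys p. v \<noteq> w \<longrightarrow> (v, w) \<in> lenlex r"
    using p by (metis finite_keys keys_eq_empty)
  then have "lead r p = w"
    unfolding lead_def using tr irr by (intro the_equality) (auto dest: transD simp: irrefl_def)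
  then show "lead r p \<in> Poly_Mapping.keys p" "v \<in> Poly_Mapping.keys p \<Longrightarrow> v \<noteq> lead r p \<Longrightarrow> (v, lead r p) \<in> lenlex r"
    using w by auto
qed

end

theory Submission
  imports Defs
begin

text \<open>
  The leading word \<open>w'\<close> of the derivative of a word \<open>w\<close> depends strictly monotonically on \<open>w\<close>, so the
  leading word of \<open>d\<^sup>n s\<close> is the bracket word \<open>u\<^sup>[\<^sup>n\<^sup>]\<close> of the leading word \<open>u\<close> of \<open>s\<close>; this describes
  the irreducible words. They span the quotient because a reducible word is congruent to a
  combination of smaller ones.

  If \<open>1\<close> is a leading word, no word is irreducible. Otherwise, for independence, let \<open>E\<^sub>w\<close> be the set
  of all \<open>a \<cdot> t \<cdot> b\<close> with leading word \<open>w\<close>, where \<open>a\<close>, \<open>b\<close> are words and \<open>t\<close> is a normalised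
  derivative of an element of the basis. Call \<open>w\<close> confluent if any two
  elements of \<open>E\<^sub>w\<close> are congruent modulo the span of the \<open>E\<^sub>v\<close> with \<open>v < w\<close>. Up to the nonzero
  coefficient of the top term of \<open>d w\<close>, the operator \<open>d\<close> carries \<open>E\<^sub>w\<close> onto \<open>E\<^sub>w\<^sub>'\<close> modulo smaller elements.
  Hence \<open>w'\<close> is confluent if \<open>w\<close> is. Words of level \<open>0\<close> are
  confluent because the original system is a Groebner-Shirshov basis, so all bracket words are
  confluent; and any word in which two bracket words overlap is itself a bracket word. Thus all words
  are confluent, and the leading word of each nonzero element of the differential ideal is reducible.
\<close>

section \<open>Leading terms for the deg-lex order\<close>

text \<open>The obstacle is that \<open>d\<close> is not multiplicative: applying it to the relation
  that resolves an overlap of \<open>f\<close> and \<open>g\<close> does not directly give the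
  relation for their derivatives. For \<lambda> = 0, moreover, the top term of \<open>d\<close>
  touches only the first letter of a word: in an overlap \<open>f u = v g\<close> with
  \<open>v\<close> nonempty it raises the order of \<open>f\<close> and leaves \<open>g\<close>
  alone. Confluence is therefore attached to a word and ranges over all multiples with that leading
  word, a form that survives any shift of the orders. It passes from \<open>w\<close> to
  \<open>w'\<close> because the coefficient of the top term of \<open>d w\<close> depends only on
  the length of \<open>w\<close>, so both multiples acquire the same scalar, which can be cancelled.
  Overlapping bracket words share a letter, whose order links the two: for \<lambda> \<noteq> 0 a
  bracket word has constant order; for \<lambda> = 0 all letters after the first have order 0, so a
  bracket word that starts inside another one, past its first letter, has order 0. The empty leading
  word is split off because \<open>d 1 = 0\<close>, which breaks the rule for leading words of
  derivatives.\<close>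

lemma mult_const_left: "p * (const c * q) = const c * (p * (q :: ('y, 'k::field) npoly))"
  using const_mult_mult[of 1 p c q] by (simp add: const_one)

text \<open>The same theory serves the letters \<open>x\<close> and the letters
  \<open>(x, n)\<close>; it is interpreted below as \<open>X\<close> and \<open>D\<close>.\<close>

locale word_order =
  fixes r :: "'y rel"
  assumes wf_letters: "wf r" and trans_letters: "trans r" and total_letters: "total r"
begin

definition less_word :: "'y list \<Rightarrow> 'y list \<Rightarrow> bool" (infix "\<prec>" 50)
  where "u \<prec> v \<longleftrightarrow> (u, v) \<in> lenlex r"

lemma irrefl_letters: "irrefl r"
  using wf_letters by (auto simp: irrefl_def)

lemma less_word_irrefl [simp]: "\<not> u \<prec> u"
  using wf_lenlex[OF wf_letters] by (auto simp: less_word_def)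

lemma less_word_trans: "u \<prec> v \<Longrightarrow> v \<prec> w \<Longrightarrow> u \<prec> w"
  using lenlex_transI[OF trans_letters] by (auto simp: less_word_def dest: transD)

lemma less_word_linear: "u \<prec> v \<or> u = v \<or> v \<prec> u"
  using total_lenlex[OF total_letters] by (auto simp: less_word_def total_on_def)

lemma wf_less_word: "wfp (\<prec>)"
  using wf_lenlex[OF wf_letters] by (simp add: wfp_def less_word_def)

lemma less_word_length: "u \<prec> v \<Longrightarrow> length u \<le> length v"
  by (auto simp: less_word_def dest: lenlex_length)

lemma less_word_shorter: "length u < length v \<Longrightarrow> u \<prec> v"
  by (simp add: less_word_def lenlex_conv)

lemma less_word_Cons:
  "x # u \<prec> y # v \<longleftrightarrow> length u < length v \<or> length u = length v \<and> (x, y) \<in> r \<or> x = y \<and> u \<prec> v"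
  by (auto simp: less_word_def Cons_lenlex_iff)

lemma less_word_append_left [simp]: "a @ u \<prec> a @ v \<longleftrightarrow> u \<prec> v"
  by (simp add: less_word_def irrefl_letters)

lemma less_word_append_right:
  assumes "u \<prec> v" shows "u @ b \<prec> v @ b"
  using assms by (auto simp: less_word_def intro: lenlex_append1)

lemma less_word_append: "u \<prec> v \<Longrightarrow> u' \<prec> v' \<or> u' = v' \<Longrightarrow> u @ u' \<prec> v @ v'"
  by (metis less_word_append_left less_word_append_right less_word_trans)

lemma less_word_append_cong: "u \<prec> v \<Longrightarrow> a @ u @ b \<prec> a @ v @ b"
  by (simp add: less_word_append_right)

section \<open>Calculus of leading terms\<close>

definition below :: "'y list \<Rightarrow> ('y, 'k::field) npoly \<Rightarrow> bool" where
  "below w p \<longleftrightarrow> (\<forall>v \<in> Poly_Mapping.keys p. v \<prec> w)"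

text \<open>The coefficient \<open>c\<close> may be 0, in which case this is
  \<open>below w p\<close>. Sums and scalar multiples thus need no case split on cancellation at the
  top, and the actual leading monomial is only recovered in \<open>leads_lead\<close>, for
  \<open>c \<noteq> 0\<close>.\<close>

definition leads :: "'y list \<Rightarrow> 'k::field \<Rightarrow> ('y, 'k) npoly \<Rightarrow> bool" where
  "leads w c p \<longleftrightarrow> below w (p - Poly_Mapping.single w c)"

lemma below_0 [simp]: "below w 0"
  by (simp add: below_def)

lemma below_add: "below w p \<Longrightarrow> below w q \<Longrightarrow> below w (p + q)"
  using Poly_Mapping.keys_add[of p q] by (auto simp: below_def)

lemma below_uminus: "below w p \<Longrightarrow> below w (- p)"
  by (auto simp: below_def)

lemma below_sum: "(\<And>i. i \<in> F \<Longrightarrow> below w (f i)) \<Longrightarrow> below w (sum f F)"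
  by (induction F rule: infinite_finite_induct) (auto intro: below_add)

lemma below_const_mult: "below w p \<Longrightarrow> below w (const c * p)"
  using keys_const_mult[of c p] by (auto simp: below_def)

lemma below_single: "v \<prec> w \<Longrightarrow> below w (Poly_Mapping.single v c)"
  by (auto simp: below_def)

lemma below_less: "below v p \<Longrightarrow> v \<prec> w \<Longrightarrow> below w p"
  by (auto simp: below_def intro: less_word_trans)

lemma below_mult: "below u p \<Longrightarrow> below v q \<Longrightarrow> below (u @ v) (p * q)"
  using keys_mult[of p q] by (fastforce simp: below_def plus_list_def intro: less_word_append)

lemma below_mult_single: "below u p \<Longrightarrow> below (u @ v) (p * Poly_Mapping.single v c)"
  using keys_mult[of p "Poly_Mapping.single v c"]
  by (fastforce simp: below_def plus_list_def intro: less_word_append_right split: if_splits)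

lemma below_single_mult: "below v q \<Longrightarrow> below (u @ v) (Poly_Mapping.single u c * q)"
  using keys_mult[of "Poly_Mapping.single u c" q]
  by (fastforce simp: below_def plus_list_def split: if_splits)

lemma leads_0_iff: "leads w 0 p \<longleftrightarrow> below w p"
  by (simp add: leads_def)

lemma leads_single [simp]: "leads w c (Poly_Mapping.single w c)"
  by (simp add: leads_def)

lemma leads_split: "leads w c p \<longleftrightarrow> (\<exists>p'. below w p' \<and> p = Poly_Mapping.single w c + p')"
  by (auto simp: leads_def intro!: exI[of _ "p - Poly_Mapping.single w c"])

lemma leads_below: "leads w c p \<Longrightarrow> w \<prec> v \<Longrightarrow> below v p"
  by (auto simp: leads_split intro!: below_add below_single elim: below_less)

lemma leads_add: "leads w c p \<Longrightarrow> leads w e q \<Longrightarrow> leads w (c + e) (p + q)"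
  unfolding leads_def using below_add by (fastforce simp: single_add algebra_simps)

lemma leads_add_below: "leads w c p \<Longrightarrow> below w q \<Longrightarrow> leads w c (p + q)"
  using leads_add[of w c p 0 q] by (simp add: leads_0_iff)

lemma below_add_leads: "below w p \<Longrightarrow> leads w c q \<Longrightarrow> leads w c (p + q)"
  using leads_add_below[of w c q p] by (simp add: add.commute)

lemma leads_const_mult: "leads w c p \<Longrightarrow> leads w (e * c) (const e * p)"
  unfolding leads_split
  by (auto simp: distrib_left mult_single plus_list_def intro!: below_const_mult)

text \<open>Splitting both factors into top term and rest gives four products; the three that
  involve a rest are lower because deg-lex is compatible with concatenation on both sides.\<close>

lemma leads_mult:
  assumes "leads u c p" "leads v e q"
  shows "leads (u @ v) (c * e) (p * q)"
proof -
  obtain p' q' where p: "below u p'" "p = Poly_Mapping.single u c + p'"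
    and q: "below v q'" "q = Poly_Mapping.single v e + q'"
    using assms by (auto simp: leads_split)
  have "p * q = Poly_Mapping.single (u @ v) (c * e)
      + (Poly_Mapping.single u c * q' + (p' * Poly_Mapping.single v e + p' * q'))"
    by (simp add: p q algebra_simps mult_single plus_list_def)
  then show ?thesis
    unfolding leads_split
    by (metis p(1) q(1) below_add below_mult below_mult_single below_single_mult)
qed

lemma leads_keys: "leads w c p \<Longrightarrow> v \<in> Poly_Mapping.keys p \<Longrightarrow> v \<prec> w \<or> v = w"
  using Poly_Mapping.keys_add[of "Poly_Mapping.single w c"]
  by (fastforce simp: leads_split below_def split: if_splits)

lemma leads_lookup: "leads w c p \<Longrightarrow> Poly_Mapping.lookup p w = c"
  by (auto simp: leads_split below_def lookup_add) (metis in_keys_iff less_word_irrefl)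

lemma leads_nonzero: "leads w c p \<Longrightarrow> c \<noteq> 0 \<Longrightarrow> p \<noteq> 0"
  using leads_lookup by fastforce

lemma leads_lead: assumes "leads w c p" "c \<noteq> 0" shows "lead r p = w"
proof -
  have "w \<in> Poly_Mapping.keys p"
    using leads_lookup[OF assms(1)] assms(2) by (simp add: in_keys_iff)
  then show ?thesis
    using lead_greatest[OF trans_letters total_letters irrefl_letters leads_nonzero[OF assms]]
      leads_keys[OF assms(1)] unfolding less_word_def[symmetric]
    by (metis less_word_irrefl less_word_trans)
qed

lemma leads_if_nonzero:
  assumes "p \<noteq> 0" shows "leads (lead r p) (Poly_Mapping.lookup p (lead r p)) p"
  using lead_greatest(2)[OF trans_letters total_letters irrefl_letters assms]
  by (auto simp: leads_def below_def in_keys_iff lookup_minus lookup_single less_word_def when_def split: if_splits)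

lemma lookup_lead_nonzero: "p \<noteq> 0 \<Longrightarrow> Poly_Mapping.lookup p (lead r p) \<noteq> 0"
  using lead_greatest(1)[OF trans_letters total_letters irrefl_letters] by (simp add: in_keys_iff)

end

section \<open>Confluent systems of monic polynomials\<close>

locale monic_system = word_order r for r :: "'y rel" +
  fixes Y :: "'y set" and S :: "('y, 'k::field) npoly set"
  assumes keys_S: "s \<in> S \<Longrightarrow> Poly_Mapping.keys s \<subseteq> lists Y"
    and leads_S: "s \<in> S \<Longrightarrow> leads (lead r s) 1 s"
begin

text \<open>The inductive form of being trivial modulo \<open>(S, w)\<close>: rule induction
  replaces manipulation of lists of summands.\<close>

inductive_set lower_span :: "'y list \<Rightarrow> ('y, 'k) npoly set" for w where
  zero: "0 \<in> lower_span w"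
| step: "p \<in> lower_span w \<Longrightarrow> s \<in> S \<Longrightarrow> a \<in> lists Y \<Longrightarrow> b \<in> lists Y \<Longrightarrow> a @ lead r s @ b \<prec> w \<Longrightarrow>
    p + const c * (word a * s * word b) \<in> lower_span w"

definition multiples :: "'y list \<Rightarrow> ('y, 'k) npoly set" where
  "multiples w = {word a * s * word b | a s b. s \<in> S \<and> a \<in> lists Y \<and> b \<in> lists Y \<and> w = a @ lead r s @ b}"

definition confluent :: "'y list \<Rightarrow> bool" where
  "confluent w \<longleftrightarrow> (\<forall>e \<in> multiples w. \<forall>e' \<in> multiples w. e - e' \<in> lower_span w)"

lemma lower_span_add: "q \<in> lower_span w \<Longrightarrow> p \<in> lower_span w \<Longrightarrow> p + q \<in> lower_span w"
  by (induction rule: lower_span.induct)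
    (auto simp: add.assoc[symmetric] intro: lower_span.intros)

lemma lower_span_const_mult: "p \<in> lower_span w \<Longrightarrow> const c * p \<in> lower_span w"
proof (induction rule: lower_span.induct)
  case (step p s a b e)
  then show ?case
    using lower_span.step[of "const c * p" w s a b "c * e"]
    by (simp add: distrib_left flip: const_mult mult.assoc)
qed (simp add: lower_span.zero)

lemma lower_span_uminus: "p \<in> lower_span w \<Longrightarrow> - p \<in> lower_span w"
  using lower_span_const_mult[of p w "-1"] by (simp add: single_uminus const_one)

lemma lower_span_diff: "p \<in> lower_span w \<Longrightarrow> q \<in> lower_span w \<Longrightarrow> p - q \<in> lower_span w"
  using lower_span_add[of "- q" w p] by (simp add: lower_span_uminus)

lemma lower_span_sum: "(\<And>i. i \<in> F \<Longrightarrow> f i \<in> lower_span w) \<Longrightarrow> sum f F \<in> lower_span w"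
  by (induction F rule: infinite_finite_induct) (auto intro: lower_span.zero lower_span_add)

lemma lower_span_less: "p \<in> lower_span v \<Longrightarrow> v \<prec> w \<Longrightarrow> p \<in> lower_span w"
  by (induction rule: lower_span.induct) (auto intro: lower_span.intros less_word_trans)

lemma multiple_in_lower_span: "e \<in> multiples v \<Longrightarrow> v \<prec> w \<Longrightarrow> e \<in> lower_span w"
  using lower_span.step[OF lower_span.zero, where c = 1]
  by (auto simp: multiples_def const_one)

lemma lower_span_mult:
  assumes "p \<in> lower_span w" "a \<in> lists Y" "b \<in> lists Y"
  shows "word a * p * word b \<in> lower_span (a @ w @ b)"
  using assms(1)
proof (induction rule: lower_span.induct)
  case (step p s a' b' c)
  have "word a * (const c * (word a' * s * word b')) * word b =
      const c * (word (a @ a') * s * word (b' @ b))"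
    by (simp only: mult_const_left mult.assoc flip: word_mult)
  moreover have "(a @ a') @ lead r s @ b' @ b \<prec> a @ w @ b"
    using less_word_append_cong[OF step(5), of a b] by simp
  ultimately show ?case
    using step assms(2,3) lower_span.step[of "word a * p * word b" "a @ w @ b" s "a @ a'" "b' @ b" c]
    by (simp add: distrib_left distrib_right)
qed (simp add: lower_span.zero)

lemma const_scale:
  fixes s p q :: "('y, 'k) npoly"
  shows "const c * p * s * (const e * q) = const (c * e) * (p * s * q)"
  by (simp only: mult.assoc[of "const c"] const_mult_mult flip: const_mult)

text \<open>Replaces the words around \<open>s\<close> by polynomials, as they arise when a basis
  element is multiplied by the lower part of another one.\<close>

lemma sandwich_in_lower_span:
  assumes "s \<in> S" "Poly_Mapping.keys p \<subseteq> lists Y" "Poly_Mapping.keys q \<subseteq> lists Y"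
    and "\<And>a b. a \<in> Poly_Mapping.keys p \<Longrightarrow> b \<in> Poly_Mapping.keys q \<Longrightarrow> a @ lead r s @ b \<prec> w"
  shows "p * s * q \<in> lower_span w"
proof -
  let ?c = "Poly_Mapping.lookup p" and ?e = "Poly_Mapping.lookup q"
  have "p * s * q = (\<Sum>a\<in>Poly_Mapping.keys p. const (?c a) * word a) * s *
     (\<Sum>b\<in>Poly_Mapping.keys q. const (?e b) * word b)"
    by (simp only: const_single npoly_eq_sum[symmetric])
  also have "\<dots> = (\<Sum>b\<in>Poly_Mapping.keys q. \<Sum>a\<in>Poly_Mapping.keys p.
     const (?c a) * word a * s * (const (?e b) * word b))"
    by (simp only: sum_distrib_left sum_distrib_right)
  also have "\<dots> = (\<Sum>b\<in>Poly_Mapping.keys q. \<Sum>a\<in>Poly_Mapping.keys p.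
     0 + const (?c a * ?e b) * (word a * s * word b))"
    by (simp only: const_scale add_0_left)
  also have "\<dots> \<in> lower_span w"
    using assms by (intro lower_span_sum lower_span.step lower_span.zero) auto
  finally show ?thesis .
qed

lemma leads_multiple: "e \<in> multiples w \<Longrightarrow> leads w 1 e"
  unfolding multiples_def
  using leads_mult[OF leads_mult[OF leads_single[of _ 1] leads_S] leads_single[of _ 1]] by auto

lemma lower_span_below: "p \<in> lower_span w \<Longrightarrow> below w p"
proof (induction rule: lower_span.induct)
  case (step p s a b c)
  then have "word a * s * word b \<in> multiples (a @ lead r s @ b)"
    by (auto simp: multiples_def)
  then show ?case
    using step by (meson below_add below_const_mult leads_below leads_multiple)
qed simp

text \<open>If any two multiples with the same leading word are congruent modulo smaller ones, then
  cancellations at the top of a sum can be resolved by passing to a smaller top word.\<close>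

lemma lower_span_cases:
  assumes "\<And>w. confluent w" and "p \<in> lower_span w"
  shows "p = 0 \<or> (\<exists>v c e t. v \<prec> w \<and> e \<in> multiples v \<and> t \<in> lower_span v \<and> p = const c * e + t)"
  using assms(2)
proof (induction rule: lower_span.induct)
  case (step p s a b c)
  define v' e' where "v' = a @ lead r s @ b" and "e' = word a * s * word b"
  have e': "e' \<in> multiples v'" "v' \<prec> w"
    using step by (auto simp: multiples_def v'_def e'_def)
  have e'_low: "const c * e' \<in> lower_span u" if "v' \<prec> u" for u
    using e' that by (blast intro: lower_span_const_mult multiple_in_lower_span)
  consider "p = 0" | v d e t where "v \<prec> w" "e \<in> multiples v" "t \<in> lower_span v" "p = const d * e + t"
    using step.IH by blast
  then show ?case unfolding e'_def[symmetric]
  proof cases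
    case 1
    then have "p + const c * e' = const c * e' + 0" by simp
    then show "p + const c * e' = 0 \<or> (\<exists>v d e t. v \<prec> w \<and> e \<in> multiples v \<and> t \<in> lower_span v \<and>
       p + const c * e' = const d * e + t)"
      using e' lower_span.zero by blast
  next
    case 2
    consider "v' \<prec> v" | "v = v'" | "v \<prec> v'" using less_word_linear by blast
    then show "p + const c * e' = 0 \<or> (\<exists>v d e t. v \<prec> w \<and> e \<in> multiples v \<and> t \<in> lower_span v \<and>
       p + const c * e' = const d * e + t)"
    proof cases
      case 1
      have "p + const c * e' = const d * e + (t + const c * e')"
        using 2 by simp
      then show ?thesis using 2 e'_low[OF 1] lower_span_add by blast
    next
      case eq: 2
      have "t + const c * (e' - e) \<in> lower_span v"
        using 2 assms(1)[of v] e' eq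
        by (intro lower_span_add lower_span_const_mult) (auto simp: confluent_def)
      moreover have "p + const c * e' = const (d + c) * e + (t + const c * (e' - e))"
        using 2 by (simp add: single_add algebra_simps)
      ultimately show ?thesis using 2 by blast
    next
      case 3
      have "p \<in> lower_span v'"
        unfolding 2 using 2 3
        by (blast intro: lower_span_add lower_span_const_mult multiple_in_lower_span lower_span_less)
      then show ?thesis using e' by (metis add.commute)
    qed
  qed
qed simp

text \<open>Well-founded induction on the bound \<open>w\<close>: in the form
  \<open>c e + t\<close>, either \<open>c = 0\<close> and the bound drops to \<open>v\<close>, or
  \<open>v\<close> is the leading word and \<open>e\<close> is a multiple with that leading
  word.\<close>

lemma lead_lower_span:
  assumes "\<And>w. confluent w" and "p \<in> lower_span w" "p \<noteq> 0"
  shows "multiples (lead r p) \<noteq> {}"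
  using assms(2)
proof (induction w rule: wfp_induct_rule[OF wf_less_word])
  case (1 w)
  then obtain v c e t where *: "v \<prec> w" "e \<in> multiples v" "t \<in> lower_span v" "p = const c * e + t"
    using lower_span_cases[OF assms(1), of p w] assms(3) by blast
  show ?case
  proof (cases "c = 0")
    case True
    then show ?thesis using * 1 by simp
  next
    case False
    have "leads v (c * 1) p"
      unfolding * using * by (intro leads_add_below leads_const_mult leads_multiple lower_span_below)
    then show ?thesis using False * leads_lead by auto
  qed
qed

text \<open>Disjoint occurrences are resolved without any hypothesis on the system. With
  \<open>s'\<close>, \<open>t'\<close> the lower parts of \<open>s\<close>, \<open>t\<close>, the
  difference equals \<open>s' m t - s m t'\<close>, and in each product one factor lies strictly
  below its leading word.\<close>

lemma multiples_diff_disjoint: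
  assumes "s \<in> S" "t \<in> S" "m \<in> lists Y" and lists: "lead r s \<in> lists Y" "lead r t \<in> lists Y"
  shows "s * word m * word (lead r t) - word (lead r s) * word m * t \<in> lower_span (lead r s @ m @ lead r t)"
proof -
  define s' t' where "s' = s - word (lead r s)" and "t' = t - word (lead r t)"
  have b: "below (lead r s) s'" "below (lead r t) t'"
    using assms leads_S by (auto simp: s'_def t'_def leads_def)
  have k: "Poly_Mapping.keys s' \<subseteq> lists Y" "Poly_Mapping.keys t' \<subseteq> lists Y"
    unfolding s'_def t'_def using assms keys_S[OF assms(1)] keys_S[OF assms(2)]
    by (intro order.trans[OF keys_diff] Un_least; simp)+
  \<comment> \<open>The factors 1 only bring the products into the form that
    \<open>sandwich_in_lower_span\<close> expects.\<close>
  have "s' * word m * t * 1 \<in> lower_span (lead r s @ m @ lead r t)"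
  proof (rule sandwich_in_lower_span[OF assms(2)])
    show "Poly_Mapping.keys (s' * word m) \<subseteq> lists Y"
      using assms k by (intro keys_mult_lists) auto
    fix a b assume ab: "a \<in> Poly_Mapping.keys (s' * word m)" "b \<in> Poly_Mapping.keys (1 :: ('y,'k) npoly)"
    have "below (lead r s @ m) (s' * word m)" by (intro below_mult_single b)
    with ab show "a @ lead r t @ b \<prec> lead r s @ m @ lead r t"
      using less_word_append_right[of a "lead r s @ m" "lead r t"]
      by (auto simp: below_def simp flip: const_one)
  qed (rule keys_one_lists)
  moreover have "1 * s * (word m * t') \<in> lower_span (lead r s @ m @ lead r t)"
  proof (rule sandwich_in_lower_span[OF assms(1)])
    show "Poly_Mapping.keys (word m * t') \<subseteq> lists Y"
      using assms k by (intro keys_mult_lists) auto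
    fix a b assume ab: "b \<in> Poly_Mapping.keys (word m * t')" "a \<in> Poly_Mapping.keys (1 :: ('y,'k) npoly)"
    have "below (m @ lead r t) (word m * t')" by (intro below_single_mult b)
    with ab show "a @ lead r s @ b \<prec> lead r s @ m @ lead r t"
      by (auto simp: below_def simp flip: const_one)
  qed (rule keys_one_lists)
  ultimately have "s' * word m * t * 1 - 1 * s * (word m * t') \<in> lower_span (lead r s @ m @ lead r t)"
    by (rule lower_span_diff)
  then show ?thesis by (simp add: s'_def t'_def algebra_simps mult.assoc)
qed

lemma lead_in_lists: "s \<in> S \<Longrightarrow> lead r s \<in> lists Y"
  using keys_S[of s] leads_lookup[OF leads_S, of s] by (metis in_keys_iff subsetD zero_neq_one)

text \<open>The composition criterion (Buchberger, diamond lemma). By the sign symmetry of the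
  difference the occurrence of \<open>lead r s\<close> may be assumed to start first; common letters
  to the left and right are then stripped off, which leaves a disjoint pair, an overlap or an
  inclusion.\<close>

lemma confluentI:
  assumes overlap: "\<And>f g u v. \<lbrakk>f \<in> S; g \<in> S; u \<in> lists Y; v \<in> lists Y; lead r f @ u = v @ lead r g;
        length v < length (lead r f)\<rbrakk> \<Longrightarrow> f * word u - word v * g \<in> lower_span (lead r f @ u)"
    and inclusion: "\<And>f g u v. \<lbrakk>f \<in> S; g \<in> S; u \<in> lists Y; v \<in> lists Y; lead r f = u @ lead r g @ v\<rbrakk>
        \<Longrightarrow> f - word u * g * word v \<in> lower_span (lead r f)"
  shows "confluent w"
proof -
  have *: "word a * s * word b - word a' * t * word b' \<in> lower_span w"
    if st: "s \<in> S" "t \<in> S" and l: "a \<in> lists Y" "b \<in> lists Y" "a' \<in> lists Y" "b' \<in> lists Y"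
      and w: "w = a @ lead r s @ b" "w = a' @ lead r t @ b'" and len: "length a \<le> length a'"
    for a b a' b' s t
  proof -
    obtain v where v: "a' = a @ v" "lead r s @ b = v @ lead r t @ b'"
      using len w by (metis append_eq_append_conv_if append_take_drop_id append.assoc same_append_eq)
    have vl: "v \<in> lists Y" using v l by simp
    note A = lower_span_mult[of _ _ a b'] lower_span_mult[of _ _ a b]
    \<comment> \<open>The relative positions of the two occurrences: \<open>lead r t\<close> starts
      after the end of \<open>lead r s\<close>, overlaps its end, or lies inside it.\<close>
    consider m where "v = lead r s @ m" "b = m @ lead r t @ b'"
      | u where "lead r s @ u = v @ lead r t" "length v < length (lead r s)" "b = u @ b'"
      | u where "lead r s = v @ lead r t @ u" "b' = u @ b"
    proof -
      obtain m where "lead r s @ m = v \<and> b = m @ lead r t @ b' \<or> lead r s = v @ m \<and> m @ b = lead r t @ b'"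
        using v(2) by (auto simp: append_eq_append_conv2)
      then show ?thesis
      proof
        assume asm: "lead r s = v @ m \<and> m @ b = lead r t @ b'"
        show ?thesis
        \<comment> \<open>Here \<open>m\<close> is the part of \<open>lead r s\<close> from the
          start of \<open>lead r t\<close> on. If it is empty the occurrences are adjacent, which is
          the disjoint case with an empty gap.\<close>
        proof (cases "m = []")
          case True
          then show ?thesis using asm that(1)[of "[]"] by simp
        next
          case False
          obtain k where "m @ k = lead r t \<and> b = k @ b' \<or> m = lead r t @ k \<and> k @ b = b'"
            using asm by (auto simp: append_eq_append_conv2)
          then show ?thesis using asm False that(2)[of k] that(3)[of k] by auto
        qed
      qed (use that(1) in blast)
    qed
    then show ?thesis
    proof cases
      case 1
      have ml: "m \<in> lists Y" using 1 l by simp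
      have "word a * s * word b - word a' * t * word b' =
          word a * (s * word m * word (lead r t) - word (lead r s) * word m * t) * word b'"
        by (simp add: v 1 algebra_simps mult.assoc flip: word_mult)
      then show ?thesis
        using A(1)[OF multiples_diff_disjoint[OF st ml lead_in_lists[OF st(1)] lead_in_lists[OF st(2)]] l(1,4)] w(1) 1
        by simp
    next
      case 2
      have ul: "u \<in> lists Y" using 2 l by simp
      have "word a * s * word b - word a' * t * word b' =
          word a * (s * word u - word v * t) * word b'"
        by (simp add: v 2 algebra_simps mult.assoc flip: word_mult)
      moreover have "a @ (lead r s @ u) @ b' = w" using w(1) 2(3) by simp
      ultimately show ?thesis
        using A(1)[OF overlap[OF st ul vl 2(1,2)] l(1,4)] by metis
    next
      case 3
      have ul: "u \<in> lists Y" using 3 l by simp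
      have "word a * s * word b - word a' * t * word b' =
          word a * (s - word v * t * word u) * word b"
        by (simp add: v 3 algebra_simps mult.assoc flip: word_mult)
      then show ?thesis
        using A(2)[OF inclusion[OF st vl ul 3(1)] l(1,2)] w(1) 3 by simp
    qed
  qed
  show ?thesis
    unfolding confluent_def
  proof (intro ballI)
    fix e e' assume "e \<in> multiples w" "e' \<in> multiples w"
    from \<open>e \<in> multiples w\<close> obtain a s b where 1: "s \<in> S" "a \<in> lists Y" "b \<in> lists Y" "w = a @ lead r s @ b" "e = word a * s * word b"
      unfolding multiples_def by blast
    obtain a' t b' where 2: "t \<in> S" "a' \<in> lists Y" "b' \<in> lists Y" "w = a' @ lead r t @ b'" "e' = word a' * t * word b'"
      using \<open>e' \<in> multiples w\<close> unfolding multiples_def by blast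
    note st = 1(1) 2(1) and l = 1(2,3) 2(2,3) and w = 1(4) 2(4) and e = 1(5) 2(5)
    show "e - e' \<in> lower_span w"
    proof (cases "length a \<le> length a'")
      case True
      then show ?thesis using *[OF st l w] e by simp
    next
      case False
      then have "- (e' - e) \<in> lower_span w"
        using *[OF st(2,1) l(3,4,1,2) w(2,1)] e by (intro lower_span_uminus) simp
      then show ?thesis by simp
    qed
  qed
qed

end

section \<open>Leading words of derivatives\<close>

lemma word_order_letter_less: "word_order (letter_less :: 'x::wellorder rel)"
  using letter_less_order wf by unfold_locales (simp_all add: letter_less_def)

lemma word_order_dletter_less: "word_order (dletter_less :: ('x::wellorder \<times> nat) rel)"
proof
  have "dletter_less = inv_image (less_than <*lex*> {(x, y :: 'x). x < y}) (\<lambda>(x, n). (n, x))"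
    by (auto simp: dletter_less_def inv_image_def lex_prod_def)
  then show "wf (dletter_less :: ('x \<times> nat) rel)"
    by (metis wf wf_inv_image wf_less_than wf_lex_prod)
qed (fact dletter_less_order)+

interpretation X: word_order "letter_less :: 'x::wellorder rel"
  by (rule word_order_letter_less)

interpretation D: word_order "dletter_less :: ('x::wellorder \<times> nat) rel"
  by (rule word_order_dletter_less)

lemma letter_less_iff: "(x, y) \<in> letter_less \<longleftrightarrow> x < y"
  by (simp add: letter_less_def)

lemma dletter_less_iff: "((x, m), (y, n)) \<in> dletter_less \<longleftrightarrow> m < n \<or> m = n \<and> x < y"
  by (simp add: dletter_less_def)

abbreviation level0 :: "'x list \<Rightarrow> ('x \<times> nat) list" where
  "level0 \<equiv> map (\<lambda>x. (x, 0))"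

abbreviation raise_letter :: "'x \<times> nat \<Rightarrow> 'x \<times> nat" where
  "raise_letter \<equiv> \<lambda>(x, n). (x, Suc n)"

text \<open>The top term of the derivative of a word \<open>w\<close>: for \<open>\<lambda> \<noteq> 0\<close> it differentiates every letter at once, with
  coefficient \<open>\<lambda>\<^bsup>|w| - 1\<^esup>\<close>, and for \<open>\<lambda> = 0\<close> it differentiates the first letter only.\<close>

definition raise :: "'k::field \<Rightarrow> ('x \<times> nat) list \<Rightarrow> ('x \<times> nat) list" where
  "raise lam w =
     (if lam \<noteq> 0 then map raise_letter w else case w of [] \<Rightarrow> [] | l # v \<Rightarrow> raise_letter l # v)"

text \<open>For \<lambda> \<noteq> 0, differentiating all \<open>k\<close> letters uses the
  \<lambda>-term of the Leibniz rule once per product, hence \<open>k - 1\<close> times. At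
  \<open>k = 0\<close> the truncated subtraction gives 1, so that the value is always invertible
  although \<open>d 1 = 0\<close>.\<close>

definition deriv_coeff :: "'k::field \<Rightarrow> nat \<Rightarrow> 'k" where
  "deriv_coeff lam k = (if lam = 0 then 1 else lam ^ (k - 1))"

lemma deriv_coeff_nonzero [simp]: "deriv_coeff lam k \<noteq> 0"
  by (simp add: deriv_coeff_def)

lemma deriv_coeff_zero: "lam = 0 \<Longrightarrow> deriv_coeff lam k = 1"
  by (simp add: deriv_coeff_def)

lemma raise_Nil_iff [simp]: "raise lam w = [] \<longleftrightarrow> w = []" "[] = raise lam w \<longleftrightarrow> w = []"
  by (auto simp: raise_def split: list.splits)

lemma raise_Nil [simp]: "raise lam [] = []"
  by simp

lemma length_raise [simp]: "length (raise lam w) = length w"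
  by (auto simp: raise_def split: list.splits)

lemma raise_in_lists [simp]: "raise lam w \<in> lists (Delta \<X>) \<longleftrightarrow> w \<in> lists (Delta \<X>)"
  by (auto simp: raise_def Delta_def split: list.splits)

lemma raise_nonzero: "lam \<noteq> 0 \<Longrightarrow> raise lam w = map raise_letter w"
  by (simp add: raise_def)

lemma raise_zero_Cons: "lam = 0 \<Longrightarrow> raise lam (l # w) = raise_letter l # w"
  by (simp add: raise_def)

lemma inj_raise_letter: "inj raise_letter"
  by (auto simp: inj_def)

lemma raise_eq_iff [simp]: "raise lam u = raise lam v \<longleftrightarrow> u = v"
  by (auto simp: raise_def inj_map_eq_map[OF inj_raise_letter] split: list.splits)

lemma less_raise: "w \<noteq> [] \<Longrightarrow> D.less_word w (raise lam w)"
proof (induction w)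
  case (Cons l w)
  obtain x n where "l = (x, n)" by (cases l)
  then show ?case
    by (auto simp: raise_def D.less_word_Cons dletter_less_iff)
qed simp

text \<open>Raising preserves length and acts on both words at the same positions by an injective
  monotone map of letters, so the first difference keeps its place and direction.\<close>

lemma raise_less:
  assumes "D.less_word u v" shows "D.less_word (raise lam u) (raise lam v)"
proof (cases "lam = 0")
  case True
  show ?thesis
  proof (cases u)
    case Nil
    then show ?thesis using assms D.less_word_irrefl by (intro D.less_word_shorter) auto
  next
    case (Cons l u')
    then obtain m v' where v: "v = m # v'"
      using assms D.less_word_length by (cases v) fastforce+
    show ?thesis
      using assms by (cases l; cases m) (auto simp: True Cons v raise_zero_Cons D.less_word_Cons dletter_less_iff)
  qed
next
  case False
  have "D.less_word u v \<Longrightarrow> D.less_word (map raise_letter u) (map raise_letter v)" for u v :: "('a \<times> nat) list"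
  proof (induction u arbitrary: v)
    case Nil
    then show ?case using D.less_word_irrefl by (intro D.less_word_shorter) auto
  next
    case (Cons l u)
    then obtain m v' where v: "v = m # v'"
      using D.less_word_length by (cases v) fastforce+
    show ?case
      using Cons by (cases l; cases m) (auto simp: v D.less_word_Cons dletter_less_iff)
  qed
  with False assms show ?thesis by (simp add: raise_nonzero)
qed

text \<open>Induction along the Leibniz rule for \<open>l # w\<close>. A single letter leaves only
  the first summand, since the derivative of the empty word is 0.\<close>

lemma leads_word_deriv:
  fixes lam :: "'k::field"
  assumes "w \<noteq> []"
  shows "D.leads (raise lam w) (deriv_coeff lam (length w)) (word_deriv lam w)"
  using assms
proof (induction w)
  case (Cons l w)
  obtain x n where l: "l = (x, n)" by (cases l)
  define a b where "a = (word [(x, Suc n)] :: ('a \<times> nat, 'k) npoly)"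
    and "b = (word [(x, n)] :: ('a \<times> nat, 'k) npoly)"
  have a: "D.leads [(x, Suc n)] 1 a" and b: "D.leads [(x, n)] 1 b"
    by (simp_all add: a_def b_def)
  have deriv: "word_deriv lam (l # w) = a * word w + b * word_deriv lam w + const lam * (a * word_deriv lam w)"
    by (simp add: l a_def b_def)
  have aw: "D.leads ((x, Suc n) # w) 1 (a * word w)"
    using D.leads_mult[OF a, of w 1 "word w"] by simp
  show ?case
  proof (cases "w = []")
    case True
    then show ?thesis using aw by (simp add: deriv l a_def raise_def deriv_coeff_def)
  next
    case False
    have ad: "D.leads ((x, Suc n) # raise lam w) (deriv_coeff lam (length w)) (a * word_deriv lam w)"
      and bd: "D.leads ((x, n) # raise lam w) (deriv_coeff lam (length w)) (b * word_deriv lam w)"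
      using D.leads_mult[OF a Cons.IH[OF False]] D.leads_mult[OF b Cons.IH[OF False]] by simp_all
    show ?thesis
    proof (cases "lam = 0")
      case True
      \<comment> \<open>For \<lambda> = 0 the third summand vanishes, and the second begins with the
        smaller letter \<open>(x, n)\<close>.\<close>
      have "D.below ((x, Suc n) # w) (b * word_deriv lam w)"
        by (rule D.leads_below[OF bd]) (simp add: D.less_word_Cons dletter_less_iff)
      then have "D.leads ((x, Suc n) # w) 1 (a * word w + b * word_deriv lam w)"
        using aw by (rule D.leads_add_below[rotated])
      then show ?thesis by (simp add: deriv True l a_def b_def raise_zero_Cons deriv_coeff_def)
    next
      case nz: False
      \<comment> \<open>For \<lambda> \<noteq> 0 the third summand dominates: the first has the same
        head but the smaller tail \<open>w\<close>, the second the smaller head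
        \<open>(x, n)\<close>.\<close>
      have "D.below ((x, Suc n) # raise lam w) (a * word w)"
        by (rule D.leads_below[OF aw]) (simp add: D.less_word_Cons less_raise False)
      moreover have "D.below ((x, Suc n) # raise lam w) (b * word_deriv lam w)"
        by (rule D.leads_below[OF bd]) (simp add: D.less_word_Cons dletter_less_iff)
      ultimately have "D.leads ((x, Suc n) # raise lam w) (lam * deriv_coeff lam (length w))
         (word_deriv lam (l # w))"
        unfolding deriv by (intro D.below_add_leads D.leads_const_mult ad D.below_add)
      moreover have "lam * deriv_coeff lam (length w) = deriv_coeff lam (length (l # w))"
        using False nz by (cases w) (simp_all add: deriv_coeff_def)
      ultimately show ?thesis using nz by (simp add: raise_nonzero l)
    qed
  qed
qed simp

section \<open>Leading words of iterated derivatives\<close>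

lemma dX_add: "dX lam (p + q) = dX lam p + dX lam q"
  by (simp add: dX_def linear_ext_add)

lemma dX_const_mult: "dX lam (const c * p) = const c * dX lam p"
  by (simp add: dX_def linear_ext_const_mult)

lemma dX_diff: "dX lam (p - q) = dX lam p - dX lam q"
  by (metis add_diff_cancel diff_add_cancel dX_add)

lemma dX_0 [simp]: "dX lam 0 = 0"
  by (simp add: dX_def linear_ext_0)

text \<open>Monotonicity of \<open>raise\<close> bounds each derivative termwise; the empty word is
  harmless because its derivative is 0.\<close>

lemma below_dX:
  assumes "D.below w p" shows "D.below (raise lam w) (dX lam p)"
  unfolding dX_def linear_ext_def
proof (intro D.below_sum D.below_const_mult)
  fix v assume "v \<in> Poly_Mapping.keys p"
  then have "D.less_word (raise lam v) (raise lam w)"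
    using assms by (auto simp: D.below_def intro: raise_less)
  then show "D.below (raise lam w) (word_deriv lam v)"
    by (cases "v = []") (auto intro: D.leads_below leads_word_deriv)
qed

lemma leads_dX:
  assumes "D.leads w c p" "w \<noteq> []"
  shows "D.leads (raise lam w) (deriv_coeff lam (length w) * c) (dX lam p)"
proof -
  obtain p' where p': "D.below w p'" "p = Poly_Mapping.single w c + p'"
    using assms by (auto simp: D.leads_split)
  have "dX lam p = const c * word_deriv lam w + dX lam p'"
    by (simp add: p' dX_add) (simp add: dX_def linear_ext_single)
  moreover have "D.leads (raise lam w) (c * deriv_coeff lam (length w)) (const c * word_deriv lam w)"
    by (intro D.leads_const_mult leads_word_deriv assms)
  ultimately show ?thesis
    using D.leads_add_below below_dX[OF p'(1)] by (metis mult.commute)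
qed

lemma leads_dX_iterate:
  assumes "D.leads w c p" "w \<noteq> []"
  shows "D.leads ((raise lam ^^ n) w) (deriv_coeff lam (length w) ^ n * c) ((dX lam ^^ n) p)
    \<and> (raise lam ^^ n) w \<noteq> [] \<and> length ((raise lam ^^ n) w) = length w"
proof (induction n)
  case (Suc n)
  then show ?case
    using leads_dX[of "(raise lam ^^ n) w" _ "(dX lam ^^ n) p" lam] by (simp add: mult.assoc)
qed (use assms in auto)

lemma bracket_word_Suc: "bracket_word lam (Suc n) w = raise lam (bracket_word lam n w)"
  by (cases w) (auto simp: bracket_word_def raise_def)

lemma bracket_word_0: "bracket_word lam 0 w = level0 w"
  by (cases w) (auto simp: bracket_word_def)

text \<open>This identifies the bracket words with the leading words of iterated derivatives, for
  both shapes of the definition at once.\<close>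

lemma bracket_word_raise: "bracket_word lam n w = (raise lam ^^ n) (level0 w)"
  by (induction n) (simp_all add: bracket_word_0 bracket_word_Suc)

lemma bracket_word_Nil_iff [simp]: "bracket_word lam n w = [] \<longleftrightarrow> w = []"
  by (auto simp: bracket_word_def split: list.splits)

lemma length_bracket_word [simp]: "length (bracket_word lam n w) = length w"
  by (auto simp: bracket_word_def split: list.splits)

section \<open>The embedding at order zero\<close>

lemma emb_add: "emb (p + q) = emb p + emb q"
  by (simp add: emb_def linear_ext_add)

lemma emb_0 [simp]: "emb 0 = 0"
  by (simp add: emb_def linear_ext_0)

lemma emb_const_mult: "emb (const c * p) = const c * emb p"
  by (simp add: emb_def linear_ext_const_mult)

lemma emb_diff: "emb (p - q) = emb p - emb q"
  by (metis add_diff_cancel diff_add_cancel emb_add)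

lemma emb_single: "emb (Poly_Mapping.single w c) = Poly_Mapping.single (level0 w) c"
  by (simp add: emb_def linear_ext_single const_single)

lemma emb_one [simp]: "emb 1 = 1"
  using emb_single[of "[]" 1] by (simp add: const_one)

lemma emb_mult: "emb (p * q) = emb p * emb q"
proof (induction p rule: npoly_induct)
  case (single u a)
  show ?case
    by (induction q rule: npoly_induct)
      (simp_all add: distrib_left emb_add emb_single mult_single plus_list_def)
qed (simp_all add: distrib_right emb_add)

lemma keys_emb:
  assumes "Poly_Mapping.keys p \<subseteq> lists \<X>"
  shows "Poly_Mapping.keys (emb p) \<subseteq> lists (Delta \<X>)"
proof -
  have "Poly_Mapping.keys (emb p) \<subseteq>
      (\<Union>w\<in>Poly_Mapping.keys p. Poly_Mapping.keys (const (Poly_Mapping.lookup p w) * word (level0 w)))"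
    unfolding emb_def linear_ext_def by (rule keys_sum)
  then show ?thesis
    using assms by (fastforce simp: const_single Delta_def split: if_splits)
qed

lemma less_level0:
  "X.less_word u v \<Longrightarrow> D.less_word (level0 u) (level0 v)"
proof (induction u arbitrary: v)
  case Nil
  then show ?case using X.less_word_irrefl by (intro D.less_word_shorter) auto
next
  case (Cons l u)
  then obtain m v' where v: "v = m # v'"
    using X.less_word_length by (cases v) fastforce+
  show ?case
    using Cons by (auto simp: v D.less_word_Cons X.less_word_Cons dletter_less_iff letter_less_iff)
qed

lemma leads_emb:
  assumes "X.leads w c p" shows "D.leads (level0 w) c (emb p)"
proof -
  obtain p' where p': "X.below w p'" "p = Poly_Mapping.single w c + p'"
    using assms by (auto simp: X.leads_split)
  have "D.below (level0 w) (emb p')"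
    unfolding emb_def linear_ext_def using p'(1)
    by (intro D.below_sum D.below_const_mult D.below_single) (auto simp: X.below_def intro: less_level0)
  then show ?thesis
    by (auto simp: p'(2) emb_add emb_single D.leads_split)
qed

lemma leads_monic: "monic letter_less s \<Longrightarrow> X.leads (lead letter_less s) 1 s"
  using X.leads_if_nonzero by (metis monic_def)

lemma leads_dX_emb:
  assumes "monic letter_less s" "lead letter_less s \<noteq> []"
  shows "D.leads (bracket_word lam n (lead letter_less s))
    (deriv_coeff lam (length (lead letter_less s)) ^ n) ((dX lam ^^ n) (emb s))"
  using leads_dX_iterate[OF leads_emb[OF leads_monic[OF assms(1)]], where lam = lam and n = n] assms(2)
  by (simp add: bracket_word_raise)

text \<open>If some leading word is empty, both sides are empty. Otherwise all derivatives are
  nonzero and their leading words are exactly the bracket words.\<close>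

theorem DIrr_eq:
  fixes S :: "('x::wellorder, 'k::field) npoly set"
  assumes monic: "\<And>s. s \<in> S \<Longrightarrow> monic letter_less s"
  shows "DIrr lam \<X> (emb ` S) =
       {w \<in> lists (Delta \<X>). \<forall>u \<in> lead letter_less ` S. \<forall>n. \<not> sublist (bracket_word lam n u) w}"
proof (cases "\<exists>s\<in>S. lead letter_less s = []")
  case True
  then obtain s where s: "s \<in> S" "lead letter_less s = []" by blast
  have "D.leads [] 1 (emb s)"
    using leads_emb[OF leads_monic[OF monic[OF s(1)]]] s(2) by simp
  then have l: "lead dletter_less (emb s) = []" "emb s \<noteq> 0"
    using D.leads_lead D.leads_nonzero by fastforce+
  have "w \<notin> DIrr lam \<X> (emb ` S)" for w
  proof
    assume w: "w \<in> DIrr lam \<X> (emb ` S)"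
    then have "w \<in> lists (Delta \<X>)" by (simp add: DIrr_def)
    then have "\<exists>a b t i. w = a @ lead dletter_less ((dX lam ^^ i) t) @ b \<and> t \<in> emb ` S \<and>
        a \<in> lists (Delta \<X>) \<and> b \<in> lists (Delta \<X>) \<and> (dX lam ^^ i) t \<noteq> 0"
      by (intro exI[of _ w] exI[of _ "[]"] exI[of _ "emb s"] exI[of _ 0]) (use s l in simp)
    with w show False unfolding DIrr_def by blast
  qed
  \<comment> \<open>The bracket of the empty word is empty and divides every word.\<close>
  moreover have "sublist (bracket_word lam 0 (lead letter_less s)) w" for w
    using s by (simp add: bracket_word_def)
  ultimately show ?thesis using s(1) by blast
next
  case False
  have lead: "lead dletter_less ((dX lam ^^ i) (emb s)) = bracket_word lam i (lead letter_less s)"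
    and nz: "(dX lam ^^ i) (emb s) \<noteq> 0" if "s \<in> S" for s i
    using leads_dX_emb[OF monic[OF that], of lam i] False that D.leads_lead D.leads_nonzero by fastforce+
  show ?thesis
  proof (intro Set.set_eqI iffI)
    fix w assume w: "w \<in> DIrr lam \<X> (emb ` S)"
    have "\<not> sublist (bracket_word lam n (lead letter_less s)) w" if s: "s \<in> S" for s n
    proof
      assume "sublist (bracket_word lam n (lead letter_less s)) w"
      then obtain a b where "w = a @ lead dletter_less ((dX lam ^^ n) (emb s)) @ b"
        by (auto simp: sublist_def lead s)
      moreover from this have "a \<in> lists (Delta \<X>)" "b \<in> lists (Delta \<X>)"
        using w by (auto simp: DIrr_def)
      ultimately show False
        using w nz[OF s, of n] s unfolding DIrr_def by blast
    qed
    then show "w \<in> {w \<in> lists (Delta \<X>). \<forall>u \<in> lead letter_less ` S. \<forall>n. \<not> sublist (bracket_word lam n u) w}"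
      using w by (auto simp: DIrr_def)
  next
    fix w assume w: "w \<in> {w \<in> lists (Delta \<X>). \<forall>u \<in> lead letter_less ` S. \<forall>n. \<not> sublist (bracket_word lam n u) w}"
    show "w \<in> DIrr lam \<X> (emb ` S)"
    proof (rule ccontr)
      assume "w \<notin> DIrr lam \<X> (emb ` S)"
      then obtain a b s i where "w = a @ lead dletter_less ((dX lam ^^ i) (emb s)) @ b" "s \<in> S"
        using w unfolding DIrr_def by blast
      then have "sublist (bracket_word lam i (lead letter_less s)) w" "s \<in> S"
        by (auto simp: lead)
      then show False using w by blast
    qed
  qed
qed

context monic_system
begin

lemma multiples_Cons: "e \<in> multiples v \<Longrightarrow> l \<in> Y \<Longrightarrow> word [l] * e \<in> multiples (l # v)"
  unfolding multiples_def
  by clarify (rule exI[of _ "l # _"], auto simp: mult.assoc[symmetric] word_mult)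

lemma multiples_snoc: "e \<in> multiples v \<Longrightarrow> l \<in> Y \<Longrightarrow> e * word [l] \<in> multiples (v @ [l])"
  unfolding multiples_def
  by clarify (rule exI, rule exI, rule exI[of _ "_ @ [l]"], auto simp: mult.assoc word_mult)

lemma lower_span_Cons: "p \<in> lower_span v \<Longrightarrow> l \<in> Y \<Longrightarrow> word [l] * p \<in> lower_span (l # v)"
  using lower_span_mult[of p v "[l]" "[]"] by (simp add: const_one)

lemma lower_span_snoc: "p \<in> lower_span v \<Longrightarrow> l \<in> Y \<Longrightarrow> p * word [l] \<in> lower_span (v @ [l])"
  using lower_span_mult[of p v "[]" "[l]"] by (simp add: const_one)

lemma multiplesI: "s \<in> S \<Longrightarrow> a \<in> lists Y \<Longrightarrow> b \<in> lists Y \<Longrightarrow> w = a @ lead r s @ b \<Longrightarrow>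
    word a * s * word b \<in> multiples w"
  by (auto simp: multiples_def)

text \<open>The bridge from the Groebner-Shirshov hypotheses to the inductive spans; the lists of
  \<open>trivial_modulo\<close> are unpacked only here.\<close>

lemma trivial_modulo_lower_span:
  assumes "trivial_modulo r Y S w p" shows "p \<in> lower_span w"
proof -
  obtain ts :: "('k \<times> 'y list \<times> ('y, 'k) npoly \<times> 'y list) list" where
    ts: "\<forall>(c, a, s, b) \<in> set ts. s \<in> S \<and> a \<in> lists Y \<and> b \<in> lists Y \<and> (a @ lead r s @ b, w) \<in> lenlex r"
    and p: "p = (\<Sum>(c, a, s, b) \<leftarrow> ts. const c * (word a * s * word b))"
    using assms by (auto simp: trivial_modulo_def)
  show ?thesis unfolding p using ts
  proof (induction ts)
    case (Cons t ts)
    obtain c a s b where "t = (c, a, s, b)" by (cases t)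
    then show ?case
      using Cons lower_span.step[of "\<Sum>(c, a, s, b) \<leftarrow> ts. const c * (word a * s * word b)" w s a b c]
      by (simp add: less_word_def add.commute)
  qed (simp add: lower_span.zero)
qed

lemma keys_lower_span: "p \<in> lower_span w \<Longrightarrow> Poly_Mapping.keys p \<subseteq> lists Y"
proof (induction rule: lower_span.induct)
  case (step p s a b c)
  have "Poly_Mapping.keys (word a * s * word b) \<subseteq> lists Y"
    using step keys_S[of s] by (intro keys_mult_lists) auto
  then show ?case
    using step.IH Poly_Mapping.keys_add[of p "const c * (word a * s * word b)"]
      keys_const_mult[of c "word a * s * word b"] by blast
qed simp

end

section \<open>Confluence of the derivatives\<close>

text \<open>The case of nonempty leading words. The length condition on overlaps is stated through
  \<open>v\<close>, as in \<open>confluentI\<close>; it says that the two leading words share a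
  letter.\<close>

locale differential_gs_system =
  fixes lam :: "'k::field" and \<X> :: "'x::wellorder set" and S :: "('x, 'k) npoly set"
  assumes carrier: "s \<in> S \<Longrightarrow> Poly_Mapping.keys s \<subseteq> lists \<X>"
    and monic: "s \<in> S \<Longrightarrow> monic letter_less s"
    and lead_nonempty: "s \<in> S \<Longrightarrow> lead letter_less s \<noteq> []"
    and overlap: "\<lbrakk>f \<in> S; g \<in> S; u \<in> lists \<X>; v \<in> lists \<X>;
        lead letter_less f @ u = v @ lead letter_less g; length v < length (lead letter_less f)\<rbrakk>
      \<Longrightarrow> trivial_modulo letter_less \<X> S (lead letter_less f @ u) (f * word u - word v * g)"
    and inclusion: "\<lbrakk>f \<in> S; g \<in> S; u \<in> lists \<X>; v \<in> lists \<X>;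
        lead letter_less f = u @ lead letter_less g @ v\<rbrakk>
      \<Longrightarrow> trivial_modulo letter_less \<X> S (lead letter_less f) (f - word u * g * word v)"
begin

text \<open>Since \<open>raise\<close> preserves length, every derivation multiplies the leading
  coefficient by the same \<open>deriv_coeff\<close>, so its \<open>n\<close>-th power is what has
  to be divided out.\<close>

definition monic_deriv :: "nat \<Rightarrow> ('x, 'k) npoly \<Rightarrow> ('x \<times> nat, 'k) npoly" where
  "monic_deriv n s =
     const (inverse (deriv_coeff lam (length (lead letter_less s)) ^ n)) * (dX lam ^^ n) (emb s)"

definition derivs :: "('x \<times> nat, 'k) npoly set" where
  "derivs = {monic_deriv n s | n s. s \<in> S}"

lemma monic_deriv_0: "monic_deriv 0 s = emb s"
  by (simp add: monic_deriv_def const_one)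

lemma dX_monic_deriv:
  "dX lam (monic_deriv n s) =
     const (deriv_coeff lam (length (lead letter_less s))) * monic_deriv (Suc n) s"
  by (simp add: monic_deriv_def dX_const_mult field_simps const_mult flip: mult.assoc)

lemma leads_monic_deriv:
  assumes "s \<in> S" shows "D.leads (bracket_word lam n (lead letter_less s)) 1 (monic_deriv n s)"
  using D.leads_const_mult[OF leads_dX_emb[OF monic[OF assms] lead_nonempty[OF assms]],
      where lam1 = lam and n1 = n and e = "inverse (deriv_coeff lam (length (lead letter_less s)) ^ n)"]
  by (simp add: monic_deriv_def)

lemma lead_monic_deriv:
  "s \<in> S \<Longrightarrow> lead dletter_less (monic_deriv n s) = bracket_word lam n (lead letter_less s)"
  using leads_monic_deriv D.leads_lead zero_neq_one by metis

lemma keys_monic_deriv: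
  assumes "s \<in> S" shows "Poly_Mapping.keys (monic_deriv n s) \<subseteq> lists (Delta \<X>)"
proof -
  have "Poly_Mapping.keys ((dX lam ^^ n) (emb s)) \<subseteq> lists (Delta \<X>)"
    by (induction n) (simp_all add: keys_emb[OF carrier[OF assms]] keys_dX)
  then show ?thesis
    unfolding monic_deriv_def using keys_const_mult by blast
qed

sublocale L: monic_system letter_less \<X> S
  by (intro monic_system.intro word_order_letter_less monic_system_axioms.intro carrier leads_monic monic)

text \<open>Two systems run in parallel: \<open>L\<close> is the given one on \<open>\<X>\<close>,
  \<open>M\<close> consists of all normalised derivatives on \<open>Delta \<X>\<close>.\<close>

sublocale M: monic_system dletter_less "Delta \<X>" derivs
proof (intro monic_system.intro word_order_dletter_less monic_system_axioms.intro)
  fix q assume "q \<in> derivs"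
  then obtain n s where "q = monic_deriv n s" "s \<in> S" by (auto simp: derivs_def)
  then show "Poly_Mapping.keys q \<subseteq> lists (Delta \<X>)" "D.leads (lead dletter_less q) 1 q"
    by (simp_all only: keys_monic_deriv lead_monic_deriv leads_monic_deriv)
qed

lemma multiples_cases:
  assumes "e \<in> M.multiples w"
  obtains a n s b where "s \<in> S" "a \<in> lists (Delta \<X>)" "b \<in> lists (Delta \<X>)"
    "w = a @ bracket_word lam n (lead letter_less s) @ b" "e = word a * monic_deriv n s * word b"
proof -
  obtain a q b where q: "q \<in> derivs" "a \<in> lists (Delta \<X>)" "b \<in> lists (Delta \<X>)"
    "w = a @ lead dletter_less q @ b" "e = word a * q * word b"
    using assms unfolding M.multiples_def by blast
  then obtain n s where "q = monic_deriv n s" "s \<in> S" by (auto simp: derivs_def)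
  with q show thesis by (intro that) (auto simp: lead_monic_deriv)
qed

lemma multiplesI:
  "s \<in> S \<Longrightarrow> a \<in> lists (Delta \<X>) \<Longrightarrow> b \<in> lists (Delta \<X>) \<Longrightarrow>
    w = a @ bracket_word lam n (lead letter_less s) @ b \<Longrightarrow>
    word a * monic_deriv n s * word b \<in> M.multiples w"
  by (rule M.multiplesI) (auto simp: derivs_def lead_monic_deriv)

lemma multiples_nonempty: "e \<in> M.multiples w \<Longrightarrow> w \<noteq> []"
  by (auto elim!: multiples_cases simp: lead_nonempty)

lemma multiple_lower: "e \<in> M.multiples v \<Longrightarrow> D.less_word v w \<Longrightarrow> const c * e \<in> M.lower_span w"
  by (intro M.lower_span_const_mult M.multiple_in_lower_span)

section \<open>The correspondence of multiples under the derivation\<close>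

text \<open>The multiples \<open>e\<close> and \<open>e'\<close> correspond to each other in that \<open>d e\<close> and \<open>e'\<close> agree at the top,
  up to the coefficient that the leading word alone determines.\<close>

definition lift :: "('x \<times> nat) list \<Rightarrow> ('x \<times> nat, 'k) npoly \<Rightarrow> ('x \<times> nat, 'k) npoly \<Rightarrow> bool" where
  "lift v e e' \<longleftrightarrow> e \<in> M.multiples v \<and> e' \<in> M.multiples (raise lam v) \<and>
     dX lam e - const (deriv_coeff lam (length v)) * e' \<in> M.lower_span (raise lam v)"

lemma lift_monic_deriv:
  assumes "s \<in> S"
  shows "lift (bracket_word lam n (lead letter_less s)) (monic_deriv n s) (monic_deriv (Suc n) s)"
  using multiplesI[OF assms, of "[]" "[]" _ n] multiplesI[OF assms, of "[]" "[]" _ "Suc n"]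
  by (simp add: lift_def dX_monic_deriv M.lower_span.zero const_one flip: bracket_word_Suc)

lemma lift_obtain:
  assumes "lift v e e'"
  obtains t where "dX lam e = const (deriv_coeff lam (length v)) * e' + t" "t \<in> M.lower_span (raise lam v)"
    "e \<in> M.multiples v" "e' \<in> M.multiples (raise lam v)"
  using assms that[of "dX lam e - const (deriv_coeff lam (length v)) * e'"] by (simp add: lift_def)

lemma deriv_coeff_Suc: "lam \<noteq> 0 \<Longrightarrow> n > 0 \<Longrightarrow> deriv_coeff lam (Suc n) = lam * deriv_coeff lam n"
  by (cases n) (simp_all add: deriv_coeff_def)

text \<open>For \<lambda> \<noteq> 0 the top of \<open>d(l e)\<close> differentiates both factors.
  For \<lambda> = 0 it differentiates \<open>l\<close> only, so the partner contains
  \<open>e\<close> itself and the old partner \<open>e'\<close> survives only in a lower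
  term.\<close>

lemma lift_Cons:
  assumes "lift v e e'" and l: "l \<in> Delta \<X>"
  shows "lift (l # v) (word [l] * e) (word [raise_letter l] * (if lam \<noteq> 0 then e' else e))"
proof -
  define k where "k = deriv_coeff lam (length v)"
  obtain t where t: "dX lam e = const k * e' + t" "t \<in> M.lower_span (raise lam v)"
    and e: "e \<in> M.multiples v" "e' \<in> M.multiples (raise lam v)"
    using lift_obtain[OF assms(1)] unfolding k_def by blast
  obtain x n where ln: "l = (x, n)" by (cases l)
  define l' where "l' = (x, Suc n)"
  have l': "l' \<in> Delta \<X>" using l by (auto simp: ln l'_def Delta_def)
  have dl: "dX lam (word [l]) = word [l']" by (simp add: ln l'_def dX_letter)
  have d: "dX lam (word [l] * e) = word [l'] * e + (const k * (word [l] * e') + word [l] * t)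
      + const lam * (word [l'] * (const k * e' + t))"
    unfolding dX_mult dl t(1) by (simp add: distrib_left mult_const_left[of "word [l]"])
  have v: "v \<noteq> []" by (rule multiples_nonempty[OF e(1)])
  have ll': "(l, l') \<in> dletter_less" by (simp add: ln l'_def dletter_less_iff)
  then have less: "D.less_word (l # u) (l' # u')" if "length u = length u'" for u u'
    using that by (simp add: D.less_word_Cons)
  show ?thesis
  proof (cases "lam = 0")
    case True
    have zero: "const lam = (0 :: ('x \<times> nat, 'k) npoly)" by (simp add: True)
    \<comment> \<open>All these terms have leading words no longer than \<open>l' # v\<close> and
      start with the smaller letter \<open>l\<close>.\<close>
    have "const k * (word [l] * e') + word [l] * t \<in> M.lower_span (l' # v)"
      using less by (intro M.lower_span_add multiple_lower[OF M.multiples_Cons[OF e(2) l]]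
          M.lower_span_less[OF M.lower_span_Cons[OF t(2) l]]) auto
    then show ?thesis
      using d M.multiples_Cons[OF e(1) l] M.multiples_Cons[OF e(1) l']
      by (simp add: lift_def True[THEN Eq_TrueI] raise_zero_Cons deriv_coeff_zero const_one zero)
        (simp add: ln l'_def)
  next
    case False
    \<comment> \<open>The factor 1 becomes \<open>const 1\<close>, so that
      \<open>multiple_lower\<close> applies. The term \<open>l' e\<close> is lower because its tail
      is \<open>v\<close> instead of \<open>raise lam v\<close>.\<close>
    have "1 * (word [l'] * e) + (const k * (word [l] * e') + word [l] * t) + const lam * (word [l'] * t)
        \<in> M.lower_span (l' # raise lam v)"
      unfolding const_one[symmetric]
      using less v ll' by (intro M.lower_span_add M.lower_span_const_mult[OF M.lower_span_Cons[OF t(2) l']]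
          multiple_lower[OF M.multiples_Cons[OF e(2) l]] multiple_lower[OF M.multiples_Cons[OF e(1) l']]
          M.lower_span_less[OF M.lower_span_Cons[OF t(2) l]]) (auto simp: D.less_word_Cons less_raise)
    moreover have "dX lam (word [l] * e) - const (deriv_coeff lam (length (l # v))) * (word [l'] * e') =
        1 * (word [l'] * e) + (const k * (word [l] * e') + word [l] * t) + const lam * (word [l'] * t)"
      using v False unfolding d
      by (simp add: deriv_coeff_Suc k_def[symmetric] distrib_left mult_const_left[of "word [l']"]
          const_mult[symmetric] mult.assoc)
    ultimately show ?thesis
      using False M.multiples_Cons[OF e(1) l] M.multiples_Cons[OF e(2) l']
      by (simp add: lift_def raise_nonzero) (simp add: ln l'_def)
  qed
qed

text \<open>Unlike on the left, \<open>e\<close> always passes to \<open>e'\<close>: since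
  \<open>v\<close> is nonempty, the first letter lies in \<open>v\<close>, and for \<lambda> = 0 the
  new last letter stays as it is.\<close>

lemma lift_snoc:
  assumes "lift v e e'" and l: "l \<in> Delta \<X>"
  shows "lift (v @ [l]) (e * word [l]) (e' * word [if lam \<noteq> 0 then raise_letter l else l])"
proof -
  define k where "k = deriv_coeff lam (length v)"
  obtain t where t: "dX lam e = const k * e' + t" "t \<in> M.lower_span (raise lam v)"
    and e: "e \<in> M.multiples v" "e' \<in> M.multiples (raise lam v)"
    using lift_obtain[OF assms(1)] unfolding k_def by blast
  obtain x n where ln: "l = (x, n)" by (cases l)
  define l' where "l' = (x, Suc n)"
  have l': "l' \<in> Delta \<X>" using l by (auto simp: ln l'_def Delta_def)
  have dl: "dX lam (word [l]) = word [l']" by (simp add: ln l'_def dX_letter)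
  have d: "dX lam (e * word [l]) = const k * (e' * word [l]) + t * word [l] + e * word [l']
      + const lam * ((const k * e' + t) * word [l'])"
    unfolding dX_mult dl t(1) by (simp add: distrib_right mult.assoc)
  have v: "v \<noteq> []" by (rule multiples_nonempty[OF e(1)])
  have less: "D.less_word (v @ [l']) (raise lam v @ [m])" for m
    using less_raise[OF v] unfolding D.less_word_def by (rule lenlex_append1) simp
  show ?thesis
  proof (cases "lam = 0")
    case True
    have zero: "const lam = (0 :: ('x \<times> nat, 'k) npoly)" by (simp add: True)
    have "t * word [l] + 1 * (e * word [l']) \<in> M.lower_span (raise lam v @ [l])"
      unfolding const_one[symmetric] using less
      by (intro M.lower_span_add multiple_lower[OF M.multiples_snoc[OF e(1) l']]
          M.lower_span_snoc[OF t(2) l]) auto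
    moreover have "raise lam (v @ [l]) = raise lam v @ [l]"
      using v by (auto simp: raise_def True split: list.splits)
    ultimately show ?thesis
      using d M.multiples_snoc[OF e(1) l] M.multiples_snoc[OF e(2) l]
      by (simp add: lift_def True[THEN Eq_TrueI] k_def deriv_coeff_zero const_one zero)
  next
    case False
    have ll: "D.less_word (raise lam v @ [l]) (raise lam v @ [l'])"
      by (simp add: D.less_word_Cons ln l'_def dletter_less_iff)
    have "const k * (e' * word [l]) + t * word [l] + 1 * (e * word [l']) + const lam * (t * word [l'])
        \<in> M.lower_span (raise lam v @ [l'])"
      unfolding const_one[symmetric]
      using less ll by (intro M.lower_span_add M.lower_span_const_mult[OF M.lower_span_snoc[OF t(2) l']]
          multiple_lower[OF M.multiples_snoc[OF e(2) l]] multiple_lower[OF M.multiples_snoc[OF e(1) l']]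
          M.lower_span_less[OF M.lower_span_snoc[OF t(2) l]])
    moreover have "dX lam (e * word [l]) - const (deriv_coeff lam (length (v @ [l]))) * (e' * word [l']) =
        const k * (e' * word [l]) + t * word [l] + 1 * (e * word [l']) + const lam * (t * word [l'])"
      using v False unfolding d
      by (simp add: deriv_coeff_Suc k_def[symmetric] distrib_left distrib_right const_mult[symmetric] mult.assoc)
    moreover have "raise lam (v @ [l]) = raise lam v @ [l']"
      using False by (simp add: raise_nonzero ln l'_def)
    ultimately show ?thesis
      using False M.multiples_snoc[OF e(1) l] M.multiples_snoc[OF e(2) l']
      by (simp add: lift_def) (simp add: ln l'_def)
  qed
qed

lemma lift_append_right:
  assumes "lift v e e'" "b \<in> lists (Delta \<X>)"
  shows "lift (v @ b) (e * word b) (e' * word (if lam \<noteq> 0 then map raise_letter b else b))"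
  using assms(2)
proof (induction b rule: rev_induct)
  case Nil
  then show ?case using assms(1) by (simp add: const_one cong: if_cong)
next
  case (snoc l b)
  then have IH: "lift (v @ b) (e * word b) (e' * word (if lam \<noteq> 0 then map raise_letter b else b))"
    and "l \<in> Delta \<X>" by simp_all
  from lift_snoc[OF this] show ?case
    by (simp add: mult.assoc word_mult split: if_splits)
qed

text \<open>Nonemptiness of \<open>a\<close> matters for \<lambda> = 0: then the derivative falls on
  the head of \<open>a\<close>, and the partner keeps \<open>e\<close>, whereas for empty
  \<open>a\<close> it would be \<open>e'\<close>.\<close>

lemma lift_append_left:
  assumes "lift v e e'" "a \<in> lists (Delta \<X>)" "a \<noteq> []"
  shows "lift (a @ v) (word a * e) (word (raise lam a) * (if lam \<noteq> 0 then e' else e))"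
  using assms(2,3)
proof (induction a)
  case (Cons l a)
  have l: "l \<in> Delta \<X>" using Cons by auto
  show ?case
  proof (cases "a = []")
    case True
    then show ?thesis using lift_Cons[OF assms(1) l] by (simp add: raise_def split: if_splits)
  next
    case False
    with Cons have "lift (a @ v) (word a * e) (word (raise lam a) * (if lam \<noteq> 0 then e' else e))"
      by simp
    from lift_Cons[OF this l] show ?thesis
      by (simp add: raise_def mult.assoc[symmetric] word_mult split: if_splits)
  qed
qed simp

lemma lift_ex:
  assumes "e \<in> M.multiples v" shows "\<exists>e'. lift v e e'"
proof -
  obtain a n s b where s: "s \<in> S" "a \<in> lists (Delta \<X>)" "b \<in> lists (Delta \<X>)"
    "v = a @ bracket_word lam n (lead letter_less s) @ b" "e = word a * monic_deriv n s * word b"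
    using multiples_cases[OF assms] .
  note lift_append_right[OF lift_monic_deriv[OF s(1)] s(3), of n]
  then show ?thesis
    using lift_append_left[OF _ s(2)] s(4,5) by (cases "a = []") (auto simp: mult.assoc const_one)
qed

lemma bracket_word_head: "bracket_word lam n w = l # u \<Longrightarrow> snd l = n"
  by (auto simp: bracket_word_def split: list.splits if_splits)

lemma bracket_word_nonzero: "lam \<noteq> 0 \<Longrightarrow> bracket_word lam n w = map (\<lambda>y. (y, n)) w"
  by (cases w) (simp_all add: bracket_word_def)

text \<open>Confluence of \<open>raise lam v\<close> concerns all its multiples, so each of them
  must come from one of \<open>v\<close>. The given occurrence of a bracket word is pulled back
  along \<open>raise\<close>, and its order \<open>n\<close> decreases exactly if the occurrence
  itself was raised.\<close>

lemma lift_onto: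
  assumes "e' \<in> M.multiples (raise lam v)" shows "\<exists>e. lift v e e'"
proof -
  obtain a' n s b' where s: "s \<in> S" "a' \<in> lists (Delta \<X>)" "b' \<in> lists (Delta \<X>)"
    "raise lam v = a' @ bracket_word lam n (lead letter_less s) @ b'" "e' = word a' * monic_deriv n s * word b'"
    using multiples_cases[OF assms] .
  define w where "w = lead letter_less s"
  have w: "w \<noteq> []" using lead_nonempty s(1) by (simp add: w_def)
  show ?thesis
  proof (cases "lam = 0")
    case False
    then obtain a m b where v: "v = a @ m @ b" "a' = raise lam a" "bracket_word lam n w = raise lam m" "b' = raise lam b"
    proof -
      obtain a r where r: "v = a @ r" "a' = raise lam a" "bracket_word lam n w @ b' = map raise_letter r"
        using s(4) False unfolding w_def raise_nonzero[OF False] map_eq_append_conv by (metis (no_types))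
      obtain m b where "r = m @ b" "bracket_word lam n w = raise lam m" "b' = raise lam b"
        using r(3)[symmetric] unfolding raise_nonzero[OF False] map_eq_append_conv by (metis (no_types))
      with r that show thesis by blast
    qed
    \<comment> \<open>A raised word with \<lambda> \<noteq> 0 has no letter of order 0, so a
      nonempty bracket word inside it has positive order.\<close>
    obtain n' where n: "n = Suc n'"
    proof (cases n)
      case 0
      then show ?thesis using v(3) w False
        by (cases w; cases m) (auto simp: raise_nonzero bracket_word_0)
    qed (use that in blast)
    have m: "m = bracket_word lam n' w" using v(3) by (simp add: n bracket_word_Suc)
    have ab: "a \<in> lists (Delta \<X>)" "b \<in> lists (Delta \<X>)" using s(2,3) v by auto
    have "lift (m @ b) (monic_deriv n' s * word b) (monic_deriv n s * word b')"
      using lift_append_right[OF lift_monic_deriv[OF s(1)] ab(2), of n'] False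
      by (simp add: v(4) m w_def n raise_nonzero)
    then show ?thesis
      using lift_append_left[OF _ ab(1)] False v(1,2) s(5)
      by (cases "a = []") (auto simp: mult.assoc const_one)
  next
    case True
    have "v \<noteq> []" using s(4) w by (auto simp: w_def)
    then obtain l v' where l: "v = l # v'" by (cases v) auto
    have s4: "raise_letter l # v' = a' @ bracket_word lam n w @ b'"
      using s(4) by (simp add: l True[THEN Eq_TrueI] raise_zero_Cons w_def)
    show ?thesis
    \<comment> \<open>For \<lambda> = 0 only the head of the word is raised. An occurrence at the
      head has positive order, read off its first letter; any other lies in the unchanged tail and
      keeps \<open>n\<close>.\<close>
    proof (cases a')
      case Nil
      then obtain c where c: "bracket_word lam n w = raise_letter l # c" "v' = c @ b'"
        using s4 w by (cases "bracket_word lam n w") auto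
      obtain n' where n: "n = Suc n'"
        using bracket_word_head[OF c(1)] by (cases l) auto
      have "raise lam (bracket_word lam n' w) = raise lam (l # c)"
        using c(1) by (simp add: n bracket_word_Suc True[THEN Eq_TrueI] raise_zero_Cons)
      then have "bracket_word lam n' w = l # c" by simp
      then show ?thesis
        using lift_append_right[OF lift_monic_deriv[OF s(1)] s(3), of n']
        by (auto simp: True[THEN Eq_TrueI] l c(2) s(5) Nil w_def n const_one)
    next
      case (Cons l' a'')
      then have v: "v' = a'' @ bracket_word lam n w @ b'" "a' = raise lam (l # a'')"
        using s4 by (auto simp: True[THEN Eq_TrueI] raise_zero_Cons)
      have "l # a'' \<in> lists (Delta \<X>)"
        using s(2) unfolding v(2) raise_in_lists .
      from lift_append_left[OF lift_append_right[OF lift_monic_deriv[OF s(1)] s(3), of n] this]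
      show ?thesis
        by (auto simp: True[THEN Eq_TrueI] l v(1) s(5) v(2) w_def mult.assoc)
    qed
  qed
qed

section \<open>Transfer of confluence along the derivation\<close>

lemma dX_lower_span: "p \<in> M.lower_span w \<Longrightarrow> dX lam p \<in> M.lower_span (raise lam w)"
proof (induction rule: M.lower_span.induct)
  case (step p q a b c)
  define v where "v = a @ lead dletter_less q @ b"
  have "word a * q * word b \<in> M.multiples v"
    using step by (auto simp: v_def intro: M.multiplesI)
  then obtain e' where "lift v (word a * q * word b) e'" using lift_ex by blast
  from lift_obtain[OF this] obtain t where
    t: "dX lam (word a * q * word b) = const (deriv_coeff lam (length v)) * e' + t"
      "t \<in> M.lower_span (raise lam v)" "e' \<in> M.multiples (raise lam v)" by metis
  have "D.less_word (raise lam v) (raise lam w)"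
    using step(5) by (simp add: v_def raise_less)
  then show ?case
    unfolding dX_add dX_const_mult t(1) using step.IH t
    by (intro M.lower_span_add M.lower_span_const_mult) (auto intro: M.multiple_in_lower_span M.lower_span_less)
qed (simp add: M.lower_span.zero)

lemma confluent_raise:
  assumes "M.confluent v" shows "M.confluent (raise lam v)"
  unfolding M.confluent_def
proof (intro ballI)
  fix e1' e2' assume "e1' \<in> M.multiples (raise lam v)" "e2' \<in> M.multiples (raise lam v)"
  then obtain e1 e2 where lifts: "lift v e1 e1'" "lift v e2 e2'" using lift_onto by meson
  define k where "k = deriv_coeff lam (length v)"
  have "k \<noteq> 0" by (simp add: k_def)
  have "e1 - e2 \<in> M.lower_span v"
    using lifts assms by (auto simp: lift_def M.confluent_def)
  then have "dX lam (e1 - e2) \<in> M.lower_span (raise lam v)"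
    by (rule dX_lower_span)
  moreover have "dX lam e1 - const k * e1' \<in> M.lower_span (raise lam v)"
    and "dX lam e2 - const k * e2' \<in> M.lower_span (raise lam v)"
    using lifts by (auto simp: lift_def k_def)
  \<comment> \<open>This combination equals \<open>k (e1' - e2')\<close>: the terms
    \<open>d e1\<close> and \<open>d e2\<close> cancel, and \<open>k\<close> is common since it
    depends on \<open>length v\<close> alone.\<close>
  ultimately have "dX lam (e1 - e2) - (dX lam e1 - const k * e1') + (dX lam e2 - const k * e2')
      \<in> M.lower_span (raise lam v)"
    by (metis M.lower_span_add M.lower_span_diff)
  then have "const (inverse k) * (const k * (e1' - e2')) \<in> M.lower_span (raise lam v)"
    by (intro M.lower_span_const_mult[where c = "inverse k"]) (simp add: dX_diff algebra_simps)
  moreover have "const (inverse k) * (const k * (e1' - e2')) = e1' - e2'"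
    using \<open>k \<noteq> 0\<close> by (simp only: mult.assoc[symmetric] const_mult) (simp add: const_one)
  ultimately show "e1' - e2' \<in> M.lower_span (raise lam v)" by (simp only:)
qed

lemma level0_in_lists: "w \<in> lists \<X> \<longleftrightarrow> level0 w \<in> lists (Delta \<X>)"
  by (auto simp: Delta_def)

text \<open>The elements \<open>emb s\<close> are the derivatives of order 0 in
  \<open>derivs\<close>, and \<open>level0\<close> preserves the order of words.\<close>

lemma emb_lower_span: "p \<in> L.lower_span w \<Longrightarrow> emb p \<in> M.lower_span (level0 w)"
proof (induction rule: L.lower_span.induct)
  case (step p s a b c)
  have "word (level0 a) * monic_deriv 0 s * word (level0 b) \<in>
      M.multiples (level0 (a @ lead letter_less s @ b))"
    using step level0_in_lists[of a] level0_in_lists[of b] by (intro multiplesI) (simp_all add: bracket_word_0)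
  from multiple_lower[OF this less_level0[OF step(5)]] show ?case
    using step.IH by (simp add: emb_add emb_const_mult emb_mult emb_single monic_deriv_0 M.lower_span_add)
qed (simp add: M.lower_span.zero)

lemma confluent_L: "L.confluent w"
  by (intro L.confluentI L.trivial_modulo_lower_span overlap inclusion)

text \<open>No derivative of positive order can contribute to a word of order 0, so on such words
  the system \<open>M\<close> sees nothing but the original basis.\<close>

lemma multiples_level0:
  assumes "e \<in> M.multiples (level0 w)" shows "\<exists>e0 \<in> L.multiples w. e = emb e0"
proof -
  obtain a n s b where s: "s \<in> S" "a \<in> lists (Delta \<X>)" "b \<in> lists (Delta \<X>)"
    "level0 w = a @ bracket_word lam n (lead letter_less s) @ b" "e = word a * monic_deriv n s * word b"
    using multiples_cases[OF assms] .
  obtain l u where lu: "bracket_word lam n (lead letter_less s) = l # u"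
    using lead_nonempty[OF s(1)] by (cases "bracket_word lam n (lead letter_less s)") auto
  \<comment> \<open>The first letter of a bracket word carries its order, and here this letter has
    order 0.\<close>
  have "l \<in> set (level0 w)" unfolding s(4) lu by simp
  then have n: "n = 0" using bracket_word_head[OF lu] by auto
  obtain a0 m b0 where w: "w = a0 @ m @ b0" "a = level0 a0" "b = level0 b0" "level0 (lead letter_less s) = level0 m"
  proof -
    obtain a0 r where r: "w = a0 @ r" "a = level0 a0" "level0 (lead letter_less s) @ b = level0 r"
      using s(4) unfolding n bracket_word_0 map_eq_append_conv by blast
    obtain m b0 where "r = m @ b0" "level0 (lead letter_less s) = level0 m" "b = level0 b0"
      using r(3)[symmetric] unfolding map_eq_append_conv by blast
    with r that show thesis by blast
  qed
  have m: "m = lead letter_less s" using w(4) by (auto simp: inj_map_eq_map inj_def)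
  have "word a0 * s * word b0 \<in> L.multiples w"
    using s(1,2,3) w(1) m level0_in_lists[of a0] level0_in_lists[of b0] unfolding w(2,3)
    by (intro L.multiplesI) simp_all
  moreover have "e = emb (word a0 * s * word b0)"
    by (simp add: s(5) n monic_deriv_0 w emb_mult emb_single)
  ultimately show ?thesis by blast
qed

text \<open>The word \<open>w\<close> is arbitrary, not just a leading word, because overlaps of
  bracket words lead to brackets of longer words.\<close>

lemma confluent_bracket_word: "M.confluent (bracket_word lam n w)"
proof (induction n)
  case 0
  have "e1 - e2 \<in> M.lower_span (level0 w)"
    if e: "e1 \<in> M.multiples (level0 w)" "e2 \<in> M.multiples (level0 w)" for e1 e2
  proof -
    obtain f1 f2 where "f1 \<in> L.multiples w" "f2 \<in> L.multiples w" "e1 = emb f1" "e2 = emb f2"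
      using multiples_level0[OF e(1)] multiples_level0[OF e(2)] by blast
    moreover from this have "f1 - f2 \<in> L.lower_span w"
      using confluent_L by (auto simp: L.confluent_def)
    ultimately show ?thesis
      using emb_lower_span[of "f1 - f2" w] by (simp add: emb_diff)
  qed
  then show ?case by (simp add: bracket_word_0 M.confluent_def)
next
  case (Suc n)
  then show ?case by (simp add: bracket_word_Suc confluent_raise)
qed

text \<open>The first letter \<open>h\<close> of the second bracket word also lies in the first one.
  Comparing its order in the two bracket words shows that the orders in the whole word follow the
  pattern of a single bracket word.\<close>

lemma overlap_bracket_word:
  assumes eq: "bracket_word lam n w @ u = v @ bracket_word lam m w'"
    and len: "length v < length w" and w': "w' \<noteq> []"
  shows "\<exists>k z. bracket_word lam n w @ u = bracket_word lam k z"
proof -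
  define F G where "F = bracket_word lam n w" and "G = bracket_word lam m w'"
  note eq = eq[folded F_def G_def]
  have len: "length v < length F" using len by (simp add: F_def)
  obtain h G' where G: "G = h # G'" using w' by (cases G) (auto simp: G_def)
  have h: "snd h = m" using bracket_word_head G by (simp add: G_def)
  obtain F' where F: "F = v @ F'" "F' \<noteq> []"
    using eq len by (auto simp: append_eq_append_conv2)
  then obtain F'' where F'': "F' = h # F''" using eq G by (cases F') auto
  show ?thesis
  proof (cases "lam = 0")
    case False
    have Fn: "snd l = n" if "l \<in> set F" for l
      using that False by (auto simp: F_def bracket_word_def split: list.splits)
    have Gm: "snd l = m" if "l \<in> set G" for l
      using that False by (auto simp: G_def bracket_word_def split: list.splits)
    have "m = n" using Fn[of h] h by (simp add: F F'')
    have all: "snd l = n" if "l \<in> set (v @ G)" for l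
      using that Fn[of l] Gm[of l] \<open>m = n\<close> F(1) by auto
    have "map (\<lambda>y. (y, n)) (map fst (v @ G)) = v @ G"
      unfolding map_map by (rule map_idI) (simp add: prod_eq_iff all)
    moreover have "bracket_word lam n (map fst (v @ G)) = map (\<lambda>y. (y, n)) (map fst (v @ G))"
      using False by (rule bracket_word_nonzero)
    ultimately have "v @ G = bracket_word lam n (map fst (v @ G))" by metis
    then show ?thesis using eq F_def by metis
  next
    case True
    show ?thesis
    proof (cases v)
      case Nil
      \<comment> \<open>With \<open>v\<close> empty the whole word is the second bracket word
        itself.\<close>
      then show ?thesis using eq F_def G_def by auto
    next
      case (Cons l v')
      have F0: "snd k = 0" if "k \<in> set (v' @ F')" for k
      proof -
        have "level0 (tl w) = v' @ F'"
          using F(1) Cons True by (auto simp: F_def bracket_word_def split: list.splits)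
        then have "k \<in> set (level0 (tl w))" using that by simp
        then show ?thesis by auto
      qed
      \<comment> \<open>Since \<open>v\<close> is nonempty, \<open>h\<close> is not the first letter
        of the first bracket word and has order 0. Only \<open>l\<close> can have positive order,
        whence the witness \<open>snd l\<close>.\<close>
      have "m = 0" using F0[of h] h by (simp add: F'')
      then have G0: "snd k = 0" if "k \<in> set G" for k
        using that by (auto simp: G_def bracket_word_0)
      have all: "snd k = 0" if "k \<in> set (v' @ G)" for k
        using that F0[of k] G0[of k] by auto
      have "map (\<lambda>y. (y, 0)) (map fst (v' @ G)) = v' @ G"
        unfolding map_map by (rule map_idI) (simp add: prod_eq_iff all)
      moreover have "bracket_word lam (snd l) (map fst (v @ G)) = l # map (\<lambda>y. (y, 0)) (map fst (v' @ G))"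
        using True Cons by (simp add: bracket_word_def)
      ultimately have "v @ G = bracket_word lam (snd l) (map fst (v @ G))"
        by (metis Cons append_Cons)
      then show ?thesis using eq F_def by metis
    qed
  qed
qed

text \<open>Overlaps form bracket words, and in an inclusion the larger leading word is one already;
  both are confluent, which supplies the two premises of \<open>confluentI\<close>.\<close>

lemma confluent: "M.confluent w"
proof (rule M.confluentI)
  fix f g u v
  assume fg: "f \<in> derivs" "g \<in> derivs" and uv: "u \<in> lists (Delta \<X>)" "v \<in> lists (Delta \<X>)"
    and eq: "lead dletter_less f @ u = v @ lead dletter_less g"
    and len: "length v < length (lead dletter_less f)"
  obtain n s m t where "f = monic_deriv n s" "g = monic_deriv m t" "s \<in> S" "t \<in> S"
    using fg by (auto simp: derivs_def)
  then obtain k z where "lead dletter_less f @ u = bracket_word lam k z"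
    using overlap_bracket_word eq len lead_nonempty
    by (metis lead_monic_deriv length_bracket_word)
  then have "M.confluent (lead dletter_less f @ u)" by (simp add: confluent_bracket_word)
  moreover have "word [] * f * word u \<in> M.multiples (lead dletter_less f @ u)"
    using fg uv by (intro M.multiplesI) auto
  moreover have "word v * g * word [] \<in> M.multiples (lead dletter_less f @ u)"
    using fg uv eq by (intro M.multiplesI) auto
  ultimately show "f * word u - word v * g \<in> M.lower_span (lead dletter_less f @ u)"
    by (auto simp: M.confluent_def const_one)
next
  fix f g u v
  assume fg: "f \<in> derivs" "g \<in> derivs" and uv: "u \<in> lists (Delta \<X>)" "v \<in> lists (Delta \<X>)"
    and eq: "lead dletter_less f = u @ lead dletter_less g @ v"
  have "M.confluent (lead dletter_less f)"
  proof -
    obtain n s where "f = monic_deriv n s" "s \<in> S" using fg(1) by (auto simp: derivs_def)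
    then show ?thesis by (simp add: lead_monic_deriv confluent_bracket_word)
  qed
  moreover have "word [] * f * word [] \<in> M.multiples (lead dletter_less f)"
    using fg uv by (intro M.multiplesI) auto
  moreover have "word u * g * word v \<in> M.multiples (lead dletter_less f)"
    using fg uv eq by (intro M.multiplesI) auto
  ultimately show "f - word u * g * word v \<in> M.lower_span (lead dletter_less f)"
    by (auto simp: M.confluent_def const_one)
qed

end

section \<open>Differential ideals and irreducible words\<close>

lemma ring_free_algebra: "ring (free_algebra Y :: ('k::field, ('y, 'k) npoly) module)"
  using assoc_algebra_free_algebra by (rule assoc_algebra.axioms)

lemma a_inv_free_algebra:
  assumes "p \<in> carrier (free_algebra Y)"
  shows "\<ominus>\<^bsub>free_algebra Y\<^esub> p = - (p :: ('y, 'k::field) npoly)"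
proof -
  interpret ring "free_algebra Y :: ('k, ('y, 'k) npoly) module"
    by (rule ring_free_algebra)
  show ?thesis
    using assms by (intro minus_equality) (simp_all add: free_algebra_simps)
qed

text \<open>Additive inverses come from multiplication by \<open>- 1\<close>.\<close>

lemma ideal_free_algebraI:
  fixes J :: "('y, 'k::field) npoly set"
  assumes "J \<subseteq> carrier (free_algebra Y)" "0 \<in> J"
    and add: "\<And>p q. p \<in> J \<Longrightarrow> q \<in> J \<Longrightarrow> p + q \<in> J"
    and mult: "\<And>p q. p \<in> J \<Longrightarrow> Poly_Mapping.keys q \<subseteq> lists Y \<Longrightarrow> q * p \<in> J"
      "\<And>p q. p \<in> J \<Longrightarrow> Poly_Mapping.keys q \<subseteq> lists Y \<Longrightarrow> p * q \<in> J"
  shows "ideal J (free_algebra Y)"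
proof -
  interpret ring "free_algebra Y :: ('k, ('y, 'k) npoly) module"
    by (rule ring_free_algebra)
  have "- p \<in> J" if "p \<in> J" for p
    using mult(1)[OF that, of "- 1"] keys_one_lists[of Y] by (simp only: keys_minus mult_minus1)
  then have "\<ominus>\<^bsub>free_algebra Y\<^esub> p \<in> J" if "p \<in> J" for p
    using that assms(1) by (simp add: a_inv_free_algebra subsetD)
  then have "subgroup J (add_monoid (free_algebra Y))"
    using assms by (intro subgroup.intro) (simp_all add: free_algebra_simps a_inv_def)
  then show ?thesis
    using mult by (intro idealI ring_axioms) (auto simp: free_algebra_simps)
qed

lemma
  fixes J :: "('y, 'k::field) npoly set"
  assumes "ideal J (free_algebra Y)"
  shows ideal_keys: "p \<in> J \<Longrightarrow> Poly_Mapping.keys p \<subseteq> lists Y"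
    and ideal_zero: "0 \<in> J"
    and ideal_add: "p \<in> J \<Longrightarrow> q \<in> J \<Longrightarrow> p + q \<in> J"
    and ideal_mult_left: "p \<in> J \<Longrightarrow> Poly_Mapping.keys q \<subseteq> lists Y \<Longrightarrow> q * p \<in> J"
    and ideal_mult_right: "p \<in> J \<Longrightarrow> Poly_Mapping.keys q \<subseteq> lists Y \<Longrightarrow> p * q \<in> J"
    and ideal_const_mult: "p \<in> J \<Longrightarrow> const c * p \<in> J"
    and ideal_diff: "p \<in> J \<Longrightarrow> q \<in> J \<Longrightarrow> p - q \<in> J"
proof -
  interpret ideal J "free_algebra Y" by fact
  show "p \<in> J \<Longrightarrow> Poly_Mapping.keys p \<subseteq> lists Y"
    using a_Hcarr[of p] by (simp add: free_algebra_simps)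
  show "0 \<in> J"
    using additive_subgroup.zero_closed[OF additive_subgroup_axioms] by (simp add: free_algebra_simps)
  show add: "p \<in> J \<Longrightarrow> q \<in> J \<Longrightarrow> p + q \<in> J" for p q
    using additive_subgroup.a_closed[OF additive_subgroup_axioms, of p q] by (simp add: free_algebra_simps)
  show left: "p \<in> J \<Longrightarrow> Poly_Mapping.keys q \<subseteq> lists Y \<Longrightarrow> q * p \<in> J" for p q
    using I_l_closed[of p q] by (simp add: free_algebra_simps)
  show "p \<in> J \<Longrightarrow> Poly_Mapping.keys q \<subseteq> lists Y \<Longrightarrow> p * q \<in> J"
    using I_r_closed[of p q] by (simp add: free_algebra_simps)
  show const: "p \<in> J \<Longrightarrow> const c * p \<in> J" for p c
    using left by simp
  show "p \<in> J \<Longrightarrow> q \<in> J \<Longrightarrow> p - q \<in> J"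
    using add[of p "- q"] const[of q "- 1"] by (simp add: single_uminus const_one)
qed

lemma ideal_sum:
  fixes J :: "('y, 'k::field) npoly set"
  assumes "ideal J (free_algebra Y)" "\<And>i. i \<in> F \<Longrightarrow> f i \<in> J"
  shows "sum f F \<in> J"
  using assms(2)
  by (induction F rule: infinite_finite_induct) (auto intro: ideal_zero[OF assms(1)] ideal_add[OF assms(1)])

lemma
  assumes "differential_algebra lam R d" and "U \<subseteq> carrier R"
  shows ideal_diff_ideal_gen: "ideal (diff_ideal_gen R d U) R"
    and diff_ideal_gen_closed: "x \<in> diff_ideal_gen R d U \<Longrightarrow> d x \<in> diff_ideal_gen R d U"
    and diff_ideal_gen_superset: "U \<subseteq> diff_ideal_gen R d U"
proof -
  interpret Rg: ring R by (intro assoc_algebra.axioms(1) differential_algebra.axioms(1)[OF assms(1)])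
  \<comment> \<open>The whole algebra belongs to the family, so the intersection is over a nonempty
    family of ideals.\<close>
  have "carrier R \<in> {J. ideal J R \<and> d ` J \<subseteq> J \<and> U \<subseteq> J}"
    using assms(2) Rg.oneideal differential_algebra.d_closed[OF assms(1)] by auto
  then show "ideal (diff_ideal_gen R d U) R"
    unfolding diff_ideal_gen_def by (intro Rg.i_Intersect) auto
qed (auto simp: diff_ideal_gen_def)

lemma diff_ideal_gen_minimal:
  "ideal J R \<Longrightarrow> d ` J \<subseteq> J \<Longrightarrow> U \<subseteq> J \<Longrightarrow> diff_ideal_gen R d U \<subseteq> J"
  by (auto simp: diff_ideal_gen_def)

context differential_gs_system
begin

section \<open>The differential ideal as the union of the lower spans\<close>

lemma emb_in_lower_span: "s \<in> S \<Longrightarrow> \<exists>w. emb s \<in> M.lower_span w"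
proof -
  assume s: "s \<in> S"
  let ?w = "level0 (lead letter_less s)"
  have "word [] * monic_deriv 0 s * word [] \<in> M.multiples ?w"
    using s by (intro multiplesI) (auto simp: bracket_word_0)
  then have "emb s \<in> M.multiples ?w" by (simp add: const_one monic_deriv_0)
  \<comment> \<open>The bound of a lower span is strict, so some larger word is needed; raising a
    nonempty word provides one.\<close>
  moreover have "D.less_word ?w (raise lam ?w)"
    using lead_nonempty[OF s] by (intro less_raise) simp
  ultimately show ?thesis using M.multiple_in_lower_span by blast
qed

lemma word_mult_lower_span:
  assumes "p \<in> M.lower_span w" "a \<in> lists (Delta \<X>)"
  shows "word a * p \<in> M.lower_span (a @ w)" "p * word a \<in> M.lower_span (w @ a)"
  using M.lower_span_mult[OF assms, of "[]"] M.lower_span_mult[OF assms(1) _ assms(2), of "[]"]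
  by (simp_all add: const_one)

text \<open>The order on words is linear, so the lower spans form a chain and finitely many elements
  share a bound.\<close>

lemma lower_span_directed:
  assumes "finite F" "\<And>i. i \<in> F \<Longrightarrow> \<exists>w. f i \<in> M.lower_span w"
  shows "\<exists>w. sum f F \<in> M.lower_span w"
  using assms
proof (induction F)
  case empty
  show ?case by (auto intro: M.lower_span.zero)
next
  case (insert i F)
  then obtain u v where uv: "f i \<in> M.lower_span u" "sum f F \<in> M.lower_span v" by force
  have "f i \<in> M.lower_span v \<or> sum f F \<in> M.lower_span u \<or> u = v"
    using D.less_word_linear[of u v] uv by (auto intro: M.lower_span_less)
  then show ?case using insert.hyps uv by (auto intro: M.lower_span_add)
qed

lemma ideal_lower_span: "ideal {p. \<exists>w. p \<in> M.lower_span w} (free_algebra (Delta \<X>))"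
proof (rule ideal_free_algebraI)
  show "{p. \<exists>w. p \<in> M.lower_span w} \<subseteq> carrier (free_algebra (Delta \<X>))"
    using M.keys_lower_span by (auto simp: free_algebra_simps)
  show "0 \<in> {p. \<exists>w. p \<in> M.lower_span w}" by (auto intro: M.lower_span.zero)
next
  fix p q assume "p \<in> {p. \<exists>w. p \<in> M.lower_span w}" "q \<in> {p. \<exists>w. p \<in> M.lower_span w}"
  \<comment> \<open>The binary sum is written over a two-element index set in order to apply
    \<open>lower_span_directed\<close>.\<close>
  then have "\<exists>w. (\<Sum>b\<in>{True, False}. if b then p else q) \<in> M.lower_span w"
    by (intro lower_span_directed) auto
  then show "p + q \<in> {p. \<exists>w. p \<in> M.lower_span w}" by simp
next
  fix p q :: "('x \<times> nat, 'k) npoly"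
  assume "p \<in> {p. \<exists>w. p \<in> M.lower_span w}" and q: "Poly_Mapping.keys q \<subseteq> lists (Delta \<X>)"
  then obtain w where p: "p \<in> M.lower_span w" by blast
  let ?q = "\<Sum>a\<in>Poly_Mapping.keys q. const (Poly_Mapping.lookup q a) * word a"
  have qq: "?q = q" by (simp only: const_single npoly_eq_sum[symmetric])
  have "\<exists>w. (\<Sum>a\<in>Poly_Mapping.keys q. const (Poly_Mapping.lookup q a) * (word a * p)) \<in> M.lower_span w"
    using q word_mult_lower_span(1)[OF p]
    by (intro lower_span_directed finite_keys) (blast intro: M.lower_span_const_mult)
  then have "\<exists>w. ?q * p \<in> M.lower_span w" by (simp only: sum_distrib_right mult.assoc)
  then show "q * p \<in> {p. \<exists>w. p \<in> M.lower_span w}" unfolding qq by simp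
  have "\<exists>w. (\<Sum>a\<in>Poly_Mapping.keys q. const (Poly_Mapping.lookup q a) * (p * word a)) \<in> M.lower_span w"
    using q word_mult_lower_span(2)[OF p]
    by (intro lower_span_directed finite_keys) (blast intro: M.lower_span_const_mult)
  then have "\<exists>w. p * ?q \<in> M.lower_span w" by (simp only: sum_distrib_left mult_const_left)
  then show "p * q \<in> {p. \<exists>w. p \<in> M.lower_span w}" unfolding qq by simp
qed

lemma diff_ideal_gen_lower_span:
  "diff_ideal_gen (free_algebra (Delta \<X>)) (dX lam) (emb ` S) \<subseteq> {p. \<exists>w. p \<in> M.lower_span w}"
  using emb_in_lower_span dX_lower_span by (intro diff_ideal_gen_minimal ideal_lower_span) blast+

text \<open>Linear independence: the leading word of a nonzero element of the ideal contains a
  bracket word, yet it is one of the words occurring in the element.\<close>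

theorem diff_ideal_irreducible_zero:
  assumes "p \<in> diff_ideal_gen (free_algebra (Delta \<X>)) (dX lam) (emb ` S)"
    and "Poly_Mapping.keys p \<subseteq> DIrr lam \<X> (emb ` S)"
  shows "p = 0"
proof (rule ccontr)
  assume p: "p \<noteq> 0"
  obtain w where "p \<in> M.lower_span w"
    using assms(1) diff_ideal_gen_lower_span by blast
  from M.lead_lower_span[OF confluent this p] obtain e where "e \<in> M.multiples (lead dletter_less p)"
    by blast
  then obtain n s where "s \<in> S" "sublist (bracket_word lam n (lead letter_less s)) (lead dletter_less p)"
    by (elim multiples_cases) (metis sublist_appendI)
  then have "lead dletter_less p \<notin> DIrr lam \<X> (emb ` S)"
    using DIrr_eq[of S lam \<X>] monic by blast
  moreover have "lead dletter_less p \<in> Poly_Mapping.keys p"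
    using D.lookup_lead_nonzero[OF p] by (simp add: in_keys_iff)
  ultimately show False using assms(2) by blast
qed

end

text \<open>Division with remainder, by well-founded induction on words; \<open>sum\<close> extends
  the claim from words to polynomials and is also used inside the induction.\<close>

theorem irreducible_spanning:
  fixes S :: "('x::wellorder \<times> nat, 'k::field) npoly set"
  assumes J: "ideal J (free_algebra (Delta \<X>))" and S: "\<And>i s. s \<in> S \<Longrightarrow> (dX lam ^^ i) s \<in> J"
    and p: "Poly_Mapping.keys p \<subseteq> lists (Delta \<X>)"
  shows "\<exists>q. Poly_Mapping.keys q \<subseteq> DIrr lam \<X> S \<and> p - q \<in> J"
proof -
  have sum: "\<exists>q. Poly_Mapping.keys q \<subseteq> DIrr lam \<X> S \<and> p - q \<in> J"
    if ex: "\<And>v. v \<in> Poly_Mapping.keys p \<Longrightarrow> \<exists>q. Poly_Mapping.keys q \<subseteq> DIrr lam \<X> S \<and> word v - q \<in> J"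
    for p :: "('x \<times> nat, 'k) npoly"
  proof -
    obtain Q where Q: "\<And>v. v \<in> Poly_Mapping.keys p \<Longrightarrow> Poly_Mapping.keys (Q v) \<subseteq> DIrr lam \<X> S \<and> word v - Q v \<in> J"
      using ex by metis
    let ?c = "Poly_Mapping.lookup p"
    have "(\<Sum>v\<in>Poly_Mapping.keys p. const (?c v) * (word v - Q v)) \<in> J"
      using Q by (intro ideal_sum[OF J] ideal_const_mult[OF J]) blast
    moreover have "(\<Sum>v\<in>Poly_Mapping.keys p. const (?c v) * (word v - Q v)) =
        p - (\<Sum>v\<in>Poly_Mapping.keys p. const (?c v) * Q v)"
      by (simp only: right_diff_distrib sum_subtractf const_single npoly_eq_sum[symmetric])
    moreover have "Poly_Mapping.keys (\<Sum>v\<in>Poly_Mapping.keys p. const (?c v) * Q v) \<subseteq> DIrr lam \<X> S"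
      using Q by (intro order.trans[OF keys_sum] UN_least order.trans[OF keys_const_mult]) blast
    ultimately show ?thesis
      by (intro exI[of _ "\<Sum>v\<in>Poly_Mapping.keys p. const (?c v) * Q v"]) simp
  qed
  have "w \<in> lists (Delta \<X>) \<Longrightarrow> \<exists>q. Poly_Mapping.keys q \<subseteq> DIrr lam \<X> S \<and> word w - q \<in> J" for w
  proof (induction w rule: wfp_induct_rule[OF D.wf_less_word])
    case (1 w)
    show ?case
    proof (cases "w \<in> DIrr lam \<X> S")
      case True
      then show ?thesis by (intro exI[of _ "word w"]) (simp add: ideal_zero[OF J])
    next
      case False
      then obtain a b s i where w: "w = a @ lead dletter_less ((dX lam ^^ i) s) @ b"
        and s: "s \<in> S" "(dX lam ^^ i) s \<noteq> 0" and ab: "a \<in> lists (Delta \<X>)" "b \<in> lists (Delta \<X>)"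
        using 1(2) unfolding DIrr_def by blast
      define t where "t = (dX lam ^^ i) s"
      \<comment> \<open>The derivatives in \<open>DIrr\<close> are not normalised, so the leading
        coefficient of \<open>t\<close> is divided out. Subtracting \<open>e\<close> then cancels
        \<open>w\<close> and leaves smaller words only.\<close>
      define c where "c = Poly_Mapping.lookup t (lead dletter_less t)"
      define e where "e = const (inverse c) * (word a * t * word b)"
      have c: "c \<noteq> 0" using s by (simp add: c_def t_def D.lookup_lead_nonzero)
      have "D.leads w (1 * c * 1) (word a * t * word b)"
        unfolding w t_def[symmetric] append_assoc[symmetric]
        using s by (intro D.leads_mult D.leads_single) (auto simp: c_def t_def intro: D.leads_if_nonzero)
      then have "D.leads w (inverse c * (1 * c * 1)) e"
        unfolding e_def by (rule D.leads_const_mult)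
      then have "D.below w (e - word w)" using c by (simp add: D.leads_def)
      then have below: "D.below w (word w - e)" using D.below_uminus by fastforce
      have e: "e \<in> J"
        unfolding e_def using S[OF s(1)] ab
        by (intro ideal_const_mult[OF J] ideal_mult_left[OF J] ideal_mult_right[OF J]) (auto simp: t_def)
      have "Poly_Mapping.keys (word w - e) \<subseteq> lists (Delta \<X>)"
        using 1(2) ideal_keys[OF J e] by (intro order.trans[OF keys_diff]) auto
      then have "\<exists>q. Poly_Mapping.keys q \<subseteq> DIrr lam \<X> S \<and> (word w - e) - q \<in> J"
        using below by (intro sum[of "word w - e"] 1(1)) (auto simp: D.below_def)
      then obtain q where q: "Poly_Mapping.keys q \<subseteq> DIrr lam \<X> S" "(word w - e) - q \<in> J" by blast
      have "(word w - e) - q + e \<in> J" by (rule ideal_add[OF J q(2) e])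
      then show ?thesis using q(1) by (auto simp: algebra_simps)
    qed
  qed
  then show ?thesis using p by (intro sum[of p]) blast
qed

section \<open>Quotients of differential algebras\<close>

lemma
  fixes A :: "('k::field, 'a) module" (structure)
  assumes "assoc_algebra A"
  shows ring_assoc_algebra: "ring A"
    and scale_closed: "x \<in> carrier A \<Longrightarrow> c \<odot> x \<in> carrier A"
    and scale_add_left: "x \<in> carrier A \<Longrightarrow> (a + b) \<odot> x = a \<odot> x \<oplus> b \<odot> x"
    and scale_add_right: "x \<in> carrier A \<Longrightarrow> y \<in> carrier A \<Longrightarrow> c \<odot> (x \<oplus> y) = c \<odot> x \<oplus> c \<odot> y"
    and scale_scale: "x \<in> carrier A \<Longrightarrow> (a * b) \<odot> x = a \<odot> (b \<odot> x)"
    and scale_one: "x \<in> carrier A \<Longrightarrow> 1 \<odot> x = x"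
    and scale_zero_left: "x \<in> carrier A \<Longrightarrow> 0 \<odot> x = \<zero>"
    and scale_zero_right: "c \<odot> \<zero> = \<zero>"
    and scale_mult_left: "x \<in> carrier A \<Longrightarrow> y \<in> carrier A \<Longrightarrow> (c \<odot> x) \<otimes> y = c \<odot> (x \<otimes> y)"
    and scale_mult_right: "x \<in> carrier A \<Longrightarrow> y \<in> carrier A \<Longrightarrow> x \<otimes> (c \<odot> y) = c \<odot> (x \<otimes> y)"
proof -
  interpret module "ring_of_type_algebra :: 'k ring" A
    using assms by (rule assoc_algebra.axioms)
  show "ring A" using assms by (rule assoc_algebra.axioms)
  show "x \<in> carrier A \<Longrightarrow> c \<odot> x \<in> carrier A"
    using smult_closed[of c x] by (simp add: ring_of_type_algebra_def)
  show "x \<in> carrier A \<Longrightarrow> (a + b) \<odot> x = a \<odot> x \<oplus> b \<odot> x"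
    using smult_l_distr[of a b x] by (simp add: ring_of_type_algebra_def)
  show "x \<in> carrier A \<Longrightarrow> y \<in> carrier A \<Longrightarrow> c \<odot> (x \<oplus> y) = c \<odot> x \<oplus> c \<odot> y"
    using smult_r_distr[of c x y] by (simp add: ring_of_type_algebra_def)
  show "x \<in> carrier A \<Longrightarrow> (a * b) \<odot> x = a \<odot> (b \<odot> x)"
    using smult_assoc1[of a b x] by (simp add: ring_of_type_algebra_def)
  show "x \<in> carrier A \<Longrightarrow> 1 \<odot> x = x"
    using smult_one[of x] by (simp add: ring_of_type_algebra_def)
  show "x \<in> carrier A \<Longrightarrow> 0 \<odot> x = \<zero>"
    using smult_l_null[of x] by (simp add: ring_of_type_algebra_def)
  show "c \<odot> \<zero> = \<zero>"
    using smult_r_null[of c] by (simp add: ring_of_type_algebra_def)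
qed (fact assoc_algebra.smult_mult_left[OF assms] assoc_algebra.smult_mult_right[OF assms])+

lemma assoc_algebraI:
  fixes A :: "('k::field, 'a) module" (structure)
  assumes "ring A"
    and "\<And>c x. x \<in> carrier A \<Longrightarrow> c \<odot> x \<in> carrier A"
    and "\<And>a b x. x \<in> carrier A \<Longrightarrow> (a + b) \<odot> x = a \<odot> x \<oplus> b \<odot> x"
    and "\<And>c x y. x \<in> carrier A \<Longrightarrow> y \<in> carrier A \<Longrightarrow> c \<odot> (x \<oplus> y) = c \<odot> x \<oplus> c \<odot> y"
    and "\<And>a b x. x \<in> carrier A \<Longrightarrow> (a * b) \<odot> x = a \<odot> (b \<odot> x)"
    and "\<And>x. x \<in> carrier A \<Longrightarrow> 1 \<odot> x = x"
    and "\<And>c x y. x \<in> carrier A \<Longrightarrow> y \<in> carrier A \<Longrightarrow> (c \<odot> x) \<otimes> y = c \<odot> (x \<otimes> y)"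
    and "\<And>c x y. x \<in> carrier A \<Longrightarrow> y \<in> carrier A \<Longrightarrow> x \<otimes> (c \<odot> y) = c \<odot> (x \<otimes> y)"
  shows "assoc_algebra A"
proof -
  have "abelian_group A" using assms(1) by (rule ring.is_abelian_group)
  then have "module (ring_of_type_algebra :: 'k ring) A"
    using assms(2-6) by (intro moduleI cring_from_type_algebra) (simp_all add: ring_of_type_algebra_def)
  then show ?thesis
    using assms by (intro assoc_algebra.intro assoc_algebra_axioms.intro)
qed

lemma
  assumes "h \<in> alg_hom A B"
  shows alg_hom_closed: "x \<in> carrier A \<Longrightarrow> h x \<in> carrier B"
    and alg_hom_mult: "x \<in> carrier A \<Longrightarrow> y \<in> carrier A \<Longrightarrow> h (x \<otimes>\<^bsub>A\<^esub> y) = h x \<otimes>\<^bsub>B\<^esub> h y"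
    and alg_hom_add: "x \<in> carrier A \<Longrightarrow> y \<in> carrier A \<Longrightarrow> h (x \<oplus>\<^bsub>A\<^esub> y) = h x \<oplus>\<^bsub>B\<^esub> h y"
    and alg_hom_one: "h \<one>\<^bsub>A\<^esub> = \<one>\<^bsub>B\<^esub>"
    and alg_hom_scale: "x \<in> carrier A \<Longrightarrow> h (c \<odot>\<^bsub>A\<^esub> x) = c \<odot>\<^bsub>B\<^esub> h x"
  using assms by (auto simp: alg_hom_def ring_hom_def)

lemma alg_homI:
  assumes "\<And>x. x \<in> carrier A \<Longrightarrow> h x \<in> carrier B"
    and "\<And>x y. x \<in> carrier A \<Longrightarrow> y \<in> carrier A \<Longrightarrow> h (x \<otimes>\<^bsub>A\<^esub> y) = h x \<otimes>\<^bsub>B\<^esub> h y"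
    and "\<And>x y. x \<in> carrier A \<Longrightarrow> y \<in> carrier A \<Longrightarrow> h (x \<oplus>\<^bsub>A\<^esub> y) = h x \<oplus>\<^bsub>B\<^esub> h y"
    and "h \<one>\<^bsub>A\<^esub> = \<one>\<^bsub>B\<^esub>"
    and "\<And>c x. x \<in> carrier A \<Longrightarrow> h (c \<odot>\<^bsub>A\<^esub> x) = c \<odot>\<^bsub>B\<^esub> h x"
  shows "h \<in> alg_hom A B"
  using assms by (auto simp: alg_hom_def intro: ring_hom_memI)

lemma alg_hom_zero:
  assumes "h \<in> alg_hom A B" "assoc_algebra A" "assoc_algebra B"
  shows "h \<zero>\<^bsub>A\<^esub> = \<zero>\<^bsub>B\<^esub>"
proof -
  have "\<zero>\<^bsub>A\<^esub> \<in> carrier A"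
    using ring_assoc_algebra[OF assms(2)] by (simp add: ring.ring_simprules)
  then show ?thesis
    using alg_hom_scale[OF assms(1), of "\<zero>\<^bsub>A\<^esub>" 0] alg_hom_closed[OF assms(1)]
    by (simp add: scale_zero_left assms)
qed

lemma alg_hom_compose:
  "h \<in> alg_hom A B \<Longrightarrow> h' \<in> alg_hom B C \<Longrightarrow> h' \<circ> h \<in> alg_hom A C"
  by (intro alg_homI) (simp_all add: alg_hom_closed alg_hom_mult alg_hom_add alg_hom_one alg_hom_scale)

lemma ideal_scale_closed:
  assumes "assoc_algebra A" "ideal J A" "x \<in> J"
  shows "c \<odot>\<^bsub>A\<^esub> x \<in> J"
proof -
  interpret A: ring A using assms(1) by (rule ring_assoc_algebra)
  interpret ideal J A by fact
  have x: "x \<in> carrier A" using assms(3) by (rule Icarr)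
  have "(c \<odot>\<^bsub>A\<^esub> \<one>\<^bsub>A\<^esub>) \<otimes>\<^bsub>A\<^esub> x \<in> J"
    using assms by (intro I_l_closed) (simp_all add: scale_closed)
  then show ?thesis using x by (simp add: scale_mult_left[OF assms(1)])
qed

text \<open>All elements of the coset yield the same image coset, so the union in
  \<open>quot_map\<close> has only one distinct member.\<close>

lemma quot_map_coset:
  assumes "ideal J A" and f: "\<And>x. x \<in> carrier A \<Longrightarrow> f x \<in> carrier A"
    "\<And>x y. x \<in> carrier A \<Longrightarrow> y \<in> carrier A \<Longrightarrow> f (x \<oplus>\<^bsub>A\<^esub> y) = f x \<oplus>\<^bsub>A\<^esub> f y" "f ` J \<subseteq> J"
    and x: "x \<in> carrier A"
  shows "quot_map A J f (J +>\<^bsub>A\<^esub> x) = J +>\<^bsub>A\<^esub> f x"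
proof -
  interpret ideal J A by fact
  have "J +>\<^bsub>A\<^esub> f y = J +>\<^bsub>A\<^esub> f x" if y: "y \<in> J +>\<^bsub>A\<^esub> x" for y
  proof -
    obtain j where j: "j \<in> J" "y = j \<oplus>\<^bsub>A\<^esub> x"
      using y by (auto simp: a_r_coset_def')
    then have "f y = f j \<oplus>\<^bsub>A\<^esub> f x" using f(2) x Icarr by simp
    then have "f y \<in> J +>\<^bsub>A\<^esub> f x"
      using f(3) j(1) by (auto simp: a_r_coset_def')
    then show ?thesis using a_repr_independence[OF _ f(1)[OF x] a_subgroup] by blast
  qed
  moreover have "x \<in> J +>\<^bsub>A\<^esub> x" using x by (rule a_rcos_self)
  ultimately show ?thesis unfolding quot_map_def by blast
qed

lemma
  assumes "assoc_algebra A" "ideal J A"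
  shows carrier_quotient_algebra: "carrier (quotient_algebra A J) = (\<lambda>x. J +>\<^bsub>A\<^esub> x) ` carrier A"
    and coset_hom: "(\<lambda>x. J +>\<^bsub>A\<^esub> x) \<in> alg_hom A (quotient_algebra A J)"
    and assoc_algebra_quotient: "assoc_algebra (quotient_algebra A J)"
    and zero_quotient_algebra: "\<zero>\<^bsub>quotient_algebra A J\<^esub> = J +>\<^bsub>A\<^esub> \<zero>\<^bsub>A\<^esub>"
proof -
  interpret A: ring A using assms(1) by (rule ring_assoc_algebra)
  interpret ideal J A by fact
  interpret Q: ring "A Quot J" by (rule quotient_is_ring)
  let ?D = "quotient_algebra A J"
  note sel = quotient_algebra_def FactRing_def
  show carr: "carrier ?D = (\<lambda>x. J +>\<^bsub>A\<^esub> x) ` carrier A"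
    by (auto simp: quotient_algebra_def FactRing_simps)
  \<comment> \<open>\<open>quotient_algebra\<close> copies the ring operations of
    \<open>A Quot J\<close>; the ring laws are transferred field by field.\<close>
  have same: "carrier ?D = carrier (A Quot J)" "monoid.mult ?D = monoid.mult (A Quot J)"
    "\<one>\<^bsub>?D\<^esub> = \<one>\<^bsub>A Quot J\<^esub>" "\<zero>\<^bsub>?D\<^esub> = \<zero>\<^bsub>A Quot J\<^esub>" "ring.add ?D = ring.add (A Quot J)"
    by (simp_all add: quotient_algebra_def)
  have ring: "ring ?D"
  proof (intro ringI abelian_groupI monoidI; unfold same)
    fix x assume "x \<in> carrier (A Quot J)"
    then show "\<exists>y\<in>carrier (A Quot J). y \<oplus>\<^bsub>A Quot J\<^esub> x = \<zero>\<^bsub>A Quot J\<^esub>"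
      using Q.add.l_inv_ex by simp
  qed (simp_all add: Q.ring_simprules Q.m_assoc)
  have scale: "c \<odot>\<^bsub>?D\<^esub> (J +>\<^bsub>A\<^esub> x) = J +>\<^bsub>A\<^esub> (c \<odot>\<^bsub>A\<^esub> x)" if "x \<in> carrier A" for c x
    using that ideal_scale_closed[OF assms] quot_map_coset[OF assms(2), of "\<lambda>x. c \<odot>\<^bsub>A\<^esub> x" x]
    by (simp add: quotient_algebra_def image_subset_iff scale_closed[OF assms(1)] scale_add_right[OF assms(1)])
  show zero: "\<zero>\<^bsub>?D\<^esub> = J +>\<^bsub>A\<^esub> \<zero>\<^bsub>A\<^esub>"
    using A.a_coset_add_zero a_subset by (simp add: sel)
  note rh = ring_hom_memE[OF rcos_ring_hom]
  show hom: "(\<lambda>x. J +>\<^bsub>A\<^esub> x) \<in> alg_hom A ?D"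
    using rh by (intro alg_homI) (simp_all add: same scale)
  note hs = alg_hom_add[OF hom, symmetric] alg_hom_mult[OF hom, symmetric]
  note [simp] = scale hs scale_closed[OF assms(1)]
  show "assoc_algebra ?D"
    using ring by (intro assoc_algebraI)
      (auto simp: carr scale_add_left[OF assms(1)] scale_add_right[OF assms(1)] scale_scale[OF assms(1)]
        scale_one[OF assms(1)] scale_mult_left[OF assms(1)] scale_mult_right[OF assms(1)])
qed

lemma
  assumes "differential_algebra lam R d" "ideal J R" "d ` J \<subseteq> J"
  shows quot_map_differential: "x \<in> carrier R \<Longrightarrow> quot_map R J d (J +>\<^bsub>R\<^esub> x) = J +>\<^bsub>R\<^esub> d x"
    and differential_algebra_quotient:
      "differential_algebra lam (quotient_algebra R J) (quot_map R J d)"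
proof -
  have R: "assoc_algebra R" using assms(1) by (rule differential_algebra.axioms)
  interpret R: ring R using R by (rule ring_assoc_algebra)
  note d = differential_algebra.d_closed[OF assms(1)] differential_algebra.d_add[OF assms(1)]
    differential_algebra.d_smult[OF assms(1)] differential_algebra.d_mult[OF assms(1)]
    differential_algebra.d_one[OF assms(1)]
  let ?D = "quotient_algebra R J"
  show q: "quot_map R J d (J +>\<^bsub>R\<^esub> x) = J +>\<^bsub>R\<^esub> d x" if "x \<in> carrier R" for x
    using assms that d by (intro quot_map_coset) auto
  note hom = coset_hom[OF R assms(2)] and carr = carrier_quotient_algebra[OF R assms(2)]
  note hs = alg_hom_add[OF hom, symmetric] alg_hom_mult[OF hom, symmetric] alg_hom_scale[OF hom, symmetric]
    alg_hom_one[OF hom, symmetric]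
  show "differential_algebra lam ?D (quot_map R J d)"
    by (intro differential_algebra.intro assoc_algebra_quotient R assms(2) differential_algebra_axioms.intro)
      (auto simp: carr hs q d zero_quotient_algebra[OF R assms(2)] scale_closed[OF R])
qed

lemma coset_eq_iff:
  fixes J :: "('y, 'k::field) npoly set"
  assumes "ideal J (free_algebra Y)"
  shows "J +>\<^bsub>free_algebra Y\<^esub> p = J +>\<^bsub>free_algebra Y\<^esub> q \<longleftrightarrow> p - q \<in> J"
proof
  assume "J +>\<^bsub>free_algebra Y\<^esub> p = J +>\<^bsub>free_algebra Y\<^esub> q"
  moreover have "0 + p \<in> J +>\<^bsub>free_algebra Y\<^esub> p"
    using ideal_zero[OF assms] by (force simp: a_r_coset_def' free_algebra_simps)
  ultimately show "p - q \<in> J" by (auto simp: a_r_coset_def' free_algebra_simps)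
next
  assume pq: "p - q \<in> J"
  have "j + p \<in> J +>\<^bsub>free_algebra Y\<^esub> q" if "j \<in> J" for j
    using ideal_add[OF assms that pq]
    by (auto simp: a_r_coset_def' free_algebra_simps intro!: bexI[of _ "j + (p - q)"])
  moreover have "j + q \<in> J +>\<^bsub>free_algebra Y\<^esub> p" if "j \<in> J" for j
    using ideal_diff[OF assms that pq]
    by (auto simp: a_r_coset_def' free_algebra_simps intro!: bexI[of _ "j - (p - q)"])
  ultimately show "J +>\<^bsub>free_algebra Y\<^esub> p = J +>\<^bsub>free_algebra Y\<^esub> q"
    by (auto simp: a_r_coset_def' free_algebra_simps)
qed

text \<open>Injectivity comes first: \<open>linear_basis\<close> indexes coefficients by cosets, and
  only for distinct cosets do these coefficients correspond to coefficients of words.\<close>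

theorem linear_basis_quotient:
  fixes J :: "('y, 'k::field) npoly set"
  assumes J: "ideal J (free_algebra Y)" and B: "B \<subseteq> lists Y"
    and indep: "\<And>p. p \<in> J \<Longrightarrow> Poly_Mapping.keys p \<subseteq> B \<Longrightarrow> p = 0"
    and span: "\<And>p. Poly_Mapping.keys p \<subseteq> lists Y \<Longrightarrow> \<exists>q. Poly_Mapping.keys q \<subseteq> B \<and> p - q \<in> J"
  shows "inj_on (\<lambda>w. J +>\<^bsub>free_algebra Y\<^esub> word w) B"
    and "linear_basis (quotient_algebra (free_algebra Y) J) ((\<lambda>w. J +>\<^bsub>free_algebra Y\<^esub> word w) ` B)"
proof -
  let ?P = "free_algebra Y :: ('k, ('y, 'k) npoly) module"
  let ?D = "quotient_algebra ?P J"
  let ?pr = "\<lambda>p. J +>\<^bsub>?P\<^esub> p"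
  note P = assoc_algebra_free_algebra[of Y]
  note hom = coset_hom[OF P J] and carr = carrier_quotient_algebra[OF P J]
  interpret D: ring ?D by (rule ring_assoc_algebra[OF assoc_algebra_quotient[OF P J]])
  show inj: "inj_on (\<lambda>w. ?pr (word w)) B"
  proof (rule inj_onI, rule ccontr)
    fix u v assume uv: "u \<in> B" "v \<in> B" "?pr (word u) = ?pr (word v)" "u \<noteq> v"
    then have "word u - word v \<in> J" by (simp add: coset_eq_iff[OF J])
    moreover have "Poly_Mapping.keys (word u - word v :: ('y, 'k) npoly) \<subseteq> B"
      using uv by (intro order.trans[OF keys_diff]) simp
    ultimately have "word u - word v = (0 :: ('y, 'k) npoly)" by (rule indep)
    then have "Poly_Mapping.lookup (word u :: ('y, 'k) npoly) u = Poly_Mapping.lookup (word v :: ('y, 'k) npoly) u"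
      by simp
    with uv(4) show False by (simp add: lookup_single when_def split: if_splits)
  qed
  have word_carr: "word w \<in> carrier ?P" if "w \<in> B" for w
    using that B by (auto simp: free_algebra_simps)
  have pr_closed: "?pr p \<in> carrier ?D" if "p \<in> carrier ?P" for p
    using that by (simp add: carr)
  have comb: "(\<Oplus>\<^bsub>?D\<^esub>w\<in>F. c w \<odot>\<^bsub>?D\<^esub> ?pr (word w)) = ?pr (\<Sum>w\<in>F. const (c w) * word w)"
    and comb_keys: "Poly_Mapping.keys (\<Sum>w\<in>F. const (c w) * word w) \<subseteq> B"
    if "finite F" "F \<subseteq> B" for F and c :: "'y list \<Rightarrow> 'k"
  proof -
    have keys: "Poly_Mapping.keys (\<Sum>w\<in>F. const (c w) * word w) \<subseteq> B" if "F \<subseteq> B" for F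
      using that by (intro order.trans[OF keys_sum]) (auto simp: const_single)
    then show "Poly_Mapping.keys (\<Sum>w\<in>F. const (c w) * word w) \<subseteq> B" using that by blast
    have tm: "c w \<odot>\<^bsub>?D\<^esub> ?pr (word w) = ?pr (const (c w) * word w)"
      "const (c w) * word w \<in> carrier ?P" if "w \<in> B" for w
      using alg_hom_scale[OF hom word_carr[OF that], of "c w"] B that
      by (auto simp: free_algebra_simps const_single)
    show "(\<Oplus>\<^bsub>?D\<^esub>w\<in>F. c w \<odot>\<^bsub>?D\<^esub> ?pr (word w)) = ?pr (\<Sum>w\<in>F. const (c w) * word w)"
      using that
    proof (induction F)
      case empty
      then show ?case using zero_quotient_algebra[OF P J] by (simp add: free_algebra_simps)
    next
      case (insert w F)
      have "(\<Sum>w\<in>F. const (c w) * word w) \<in> carrier ?P"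
        using keys[of F] B insert.prems by (simp add: free_algebra_simps)
      with insert tm show ?case
        using alg_hom_add[OF hom, of "const (c w) * word w" "\<Sum>w\<in>F. const (c w) * word w"]
        by (subst D.finsum_insert) (auto simp: pr_closed subset_iff free_algebra_simps(5))
    qed
  qed
  have comb_image: "(\<Oplus>\<^bsub>?D\<^esub>b\<in>(\<lambda>w. ?pr (word w)) ` F. c b \<odot>\<^bsub>?D\<^esub> b) =
      ?pr (\<Sum>w\<in>F. const (c (?pr (word w))) * word w)" if F: "finite F" "F \<subseteq> B" for F c
  proof -
    have "(\<Oplus>\<^bsub>?D\<^esub>b\<in>(\<lambda>w. ?pr (word w)) ` F. c b \<odot>\<^bsub>?D\<^esub> b) =
        (\<Oplus>\<^bsub>?D\<^esub>w\<in>F. c (?pr (word w)) \<odot>\<^bsub>?D\<^esub> ?pr (word w))"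
      using F inj_on_subset[OF inj F(2)]
      by (intro D.finsum_reindex)
        (auto intro!: scale_closed[OF assoc_algebra_quotient[OF P J]] pr_closed word_carr)
    then show ?thesis using comb[OF F, of "\<lambda>w. c (?pr (word w))"] by simp
  qed
  show "linear_basis ?D ((\<lambda>w. ?pr (word w)) ` B)"
    unfolding linear_basis_def
  proof (intro conjI allI impI ballI)
    show "(\<lambda>w. ?pr (word w)) ` B \<subseteq> carrier ?D" using pr_closed word_carr by blast
  next
    fix F c b
    assume F: "finite F \<and> F \<subseteq> (\<lambda>w. ?pr (word w)) ` B \<and> (\<Oplus>\<^bsub>?D\<^esub>b\<in>F. c b \<odot>\<^bsub>?D\<^esub> b) = \<zero>\<^bsub>?D\<^esub>"
      and b: "b \<in> F"
    then obtain G where G: "G \<subseteq> B" "finite G" "F = (\<lambda>w. ?pr (word w)) ` G"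
      by (meson finite_subset_image)
    let ?p = "\<Sum>w\<in>G. const (c (?pr (word w))) * word w"
    have "?pr ?p = ?pr 0"
      using F comb_image[OF G(2,1), of c] zero_quotient_algebra[OF P J] by (simp add: G(3) free_algebra_simps)
    then have "?p \<in> J" by (simp add: coset_eq_iff[OF J])
    then have p0: "?p = 0" using comb_keys[OF G(2,1), of "\<lambda>w. c (?pr (word w))"] by (rule indep)
    obtain w where w: "w \<in> G" "b = ?pr (word w)" using b G(3) by blast
    have "Poly_Mapping.lookup ?p w = (\<Sum>v\<in>G. if v = w then c (?pr (word v)) else 0)"
      by (simp add: lookup_sum const_single lookup_single when_def)
    also have "\<dots> = c b" using w G(2) by simp
    finally show "c b = 0" using p0 by simp
  next
    fix v assume "v \<in> carrier ?D"
    then obtain p where p: "Poly_Mapping.keys p \<subseteq> lists Y" "v = ?pr p"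
      by (auto simp: carr free_algebra_simps)
    obtain q where q: "Poly_Mapping.keys q \<subseteq> B" "p - q \<in> J" using span[OF p(1)] by blast
    \<comment> \<open>The coefficient of a coset is that of the unique word of \<open>B\<close>
      representing it.\<close>
    define c where "c = Poly_Mapping.lookup q \<circ> inv_into B (\<lambda>w. ?pr (word w))"
    have "(\<Sum>w\<in>Poly_Mapping.keys q. const (c (?pr (word w))) * word w) =
        (\<Sum>w\<in>Poly_Mapping.keys q. const (Poly_Mapping.lookup q w) * word w)"
      using q(1) by (intro sum.cong) (auto simp: c_def inv_into_f_f[OF inj] subset_iff)
    then have "(\<Sum>w\<in>Poly_Mapping.keys q. const (c (?pr (word w))) * word w) = q"
      by (simp only: const_single npoly_eq_sum[symmetric])
    then have "v = (\<Oplus>\<^bsub>?D\<^esub>b\<in>(\<lambda>w. ?pr (word w)) ` Poly_Mapping.keys q. c b \<odot>\<^bsub>?D\<^esub> b)"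
      using comb_image[OF finite_keys q(1), of c] p(2) q(2) by (simp add: coset_eq_iff[OF J])
    then show "\<exists>F c. finite F \<and> F \<subseteq> (\<lambda>w. ?pr (word w)) ` B \<and> v = (\<Oplus>\<^bsub>?D\<^esub>b\<in>F. c b \<odot>\<^bsub>?D\<^esub> b)"
      using q(1) by (intro exI[of _ "(\<lambda>w. ?pr (word w)) ` Poly_Mapping.keys q"] exI[of _ c]) auto
  qed
qed

section \<open>The universal property\<close>

lemma npoly_lists_induct [consumes 1, case_names zero single add]:
  fixes p :: "('y, 'k::field) npoly"
  assumes "Poly_Mapping.keys p \<subseteq> lists Y"
    and "P 0" "\<And>w c. w \<in> lists Y \<Longrightarrow> P (Poly_Mapping.single w c)"
    "\<And>p q. Poly_Mapping.keys p \<subseteq> lists Y \<Longrightarrow> Poly_Mapping.keys q \<subseteq> lists Y \<Longrightarrow> P p \<Longrightarrow> P q \<Longrightarrow> P (p + q)"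
  shows "P p"
proof -
  have "Poly_Mapping.keys (\<Sum>w\<in>F. Poly_Mapping.single w (Poly_Mapping.lookup p w)) \<subseteq> lists Y \<and>
      P (\<Sum>w\<in>F. Poly_Mapping.single w (Poly_Mapping.lookup p w))"
    if "finite F" "F \<subseteq> lists Y" for F
    using that
  proof (induction F)
    case (insert w F)
    then have "Poly_Mapping.keys (\<Sum>w\<in>insert w F. Poly_Mapping.single w (Poly_Mapping.lookup p w)) \<subseteq> lists Y"
      by (intro order.trans[OF keys_sum]) auto
    with insert assms(3)[of w "Poly_Mapping.lookup p w"] show ?case
      by (auto intro!: assms(4) split: if_splits)
  qed (simp add: assms)
  then show ?thesis using assms(1) npoly_eq_sum[of p] by (metis finite_keys)
qed

lemma alg_hom_free_algebra_eq:
  fixes R :: "('k::field, 'a) module" and h h' :: "('y, 'k) npoly \<Rightarrow> 'a"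
  assumes R: "assoc_algebra R" and h: "h \<in> alg_hom (free_algebra Y) R" and h': "h' \<in> alg_hom (free_algebra Y) R"
    and letters: "\<And>y. y \<in> Y \<Longrightarrow> h (word [y]) = h' (word [y])"
    and p: "Poly_Mapping.keys p \<subseteq> lists Y"
  shows "h p = h' p"
proof -
  note hom = alg_hom_mult[OF h] alg_hom_mult[OF h'] alg_hom_add[OF h] alg_hom_add[OF h']
    alg_hom_scale[OF h] alg_hom_scale[OF h'] alg_hom_one[OF h] alg_hom_one[OF h']
  note hom = hom[unfolded free_algebra_simps, simplified mem_Collect_eq]
  have word: "h (word w) = h' (word w)" if "w \<in> lists Y" for w
    using that
  proof (induction w)
    case Nil
    then show ?case by (simp add: const_one hom)
  next
    case (Cons y w)
    have "word (y # w) = (word [y] * word w :: ('y, 'k) npoly)" by (simp add: word_mult)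
    moreover have "h (word [y] * word w) = h' (word [y] * word w)"
      using Cons letters by (simp add: hom)
    ultimately show ?case by simp
  qed
  from p show ?thesis
  proof (induction p rule: npoly_lists_induct)
    case zero
    then show ?case
      using alg_hom_zero[OF h assoc_algebra_free_algebra R] alg_hom_zero[OF h' assoc_algebra_free_algebra R]
      by (simp add: free_algebra_simps)
  next
    case (single w c)
    then have "h (const c * word w) = h' (const c * word w)"
      using alg_hom_scale[OF h, of "word w" c] alg_hom_scale[OF h', of "word w" c]
      by (simp add: free_algebra_simps word)
    then show ?case by (simp add: const_single)
  qed (simp add: hom)
qed

section \<open>Evaluation of noncommutative polynomials\<close>

definition word_value :: "('k, 'a) module \<Rightarrow> ('y \<Rightarrow> 'a) \<Rightarrow> 'y list \<Rightarrow> 'a" where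
  "word_value R g w = foldr (\<lambda>y x. g y \<otimes>\<^bsub>R\<^esub> x) w \<one>\<^bsub>R\<^esub>"

definition poly_value :: "('k::field, 'a) module \<Rightarrow> ('y \<Rightarrow> 'a) \<Rightarrow> ('y, 'k) npoly \<Rightarrow> 'a" where
  "poly_value R g p = (\<Oplus>\<^bsub>R\<^esub>w\<in>Poly_Mapping.keys p. Poly_Mapping.lookup p w \<odot>\<^bsub>R\<^esub> word_value R g w)"

locale evaluation = R: ring R
  for R :: "('k::field, 'a) module" (structure) and Y :: "'y set" and g :: "'y \<Rightarrow> 'a" +
  assumes algebra: "assoc_algebra R" and values_closed: "y \<in> Y \<Longrightarrow> g y \<in> carrier R"
begin

lemma word_value_closed: "w \<in> lists Y \<Longrightarrow> word_value R g w \<in> carrier R"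
  by (induction w) (auto simp: word_value_def values_closed)

lemma word_value_append:
  "u \<in> lists Y \<Longrightarrow> v \<in> lists Y \<Longrightarrow> word_value R g (u @ v) = word_value R g u \<otimes> word_value R g v"
proof (induction u)
  case Nil
  then show ?case using word_value_closed[of v] by (simp add: word_value_def)
next
  case (Cons y u)
  then show ?case
    using word_value_closed[of u] word_value_closed[of v]
    by (simp add: word_value_def values_closed R.m_assoc)
qed

lemma poly_value_superset:
  assumes "finite F" "Poly_Mapping.keys p \<subseteq> F" "F \<subseteq> lists Y"
  shows "poly_value R g p = (\<Oplus>w\<in>F. Poly_Mapping.lookup p w \<odot> word_value R g w)"
  unfolding poly_value_def using assms
  by (intro R.add.finprod_mono_neutral_cong_left)
    (auto simp: in_keys_iff scale_zero_left[OF algebra] scale_closed[OF algebra]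
      word_value_closed[OF subsetD[OF assms(3)]])

lemma poly_value_closed: "Poly_Mapping.keys p \<subseteq> lists Y \<Longrightarrow> poly_value R g p \<in> carrier R"
  unfolding poly_value_def
  by (intro R.finsum_closed) (auto simp: word_value_closed scale_closed[OF algebra] subset_iff)

lemma poly_value_0: "poly_value R g 0 = \<zero>"
  by (simp add: poly_value_def)

lemma poly_value_add:
  assumes p: "Poly_Mapping.keys p \<subseteq> lists Y" and q: "Poly_Mapping.keys q \<subseteq> lists Y"
  shows "poly_value R g (p + q) = poly_value R g p \<oplus> poly_value R g q"
proof -
  let ?F = "Poly_Mapping.keys p \<union> Poly_Mapping.keys q"
  note superset = poly_value_superset[of ?F]
  have "poly_value R g (p + q) = (\<Oplus>w\<in>?F. Poly_Mapping.lookup (p + q) w \<odot> word_value R g w)"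
    using assms Poly_Mapping.keys_add[of p q] by (intro superset) auto
  also have "\<dots> = (\<Oplus>w\<in>?F. Poly_Mapping.lookup p w \<odot> word_value R g w \<oplus> Poly_Mapping.lookup q w \<odot> word_value R g w)"
    using assms by (intro R.finsum_cong')
      (auto simp: lookup_add word_value_closed scale_closed[OF algebra] scale_add_left[OF algebra] subset_iff)
  also have "\<dots> = poly_value R g p \<oplus> poly_value R g q"
    using assms by (subst R.finsum_addf)
      (auto simp: superset word_value_closed scale_closed[OF algebra] subset_iff)
  finally show ?thesis .
qed

lemma poly_value_single:
  assumes "w \<in> lists Y" shows "poly_value R g (Poly_Mapping.single w c) = c \<odot> word_value R g w"
  using assms word_value_closed[OF assms]
  by (cases "c = 0") (simp_all add: poly_value_def scale_zero_left[OF algebra] scale_closed[OF algebra])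

lemma poly_value_letter: "y \<in> Y \<Longrightarrow> poly_value R g (word [y]) = g y"
  by (simp add: poly_value_single word_value_def values_closed scale_one[OF algebra])

lemma poly_value_const_mult:
  assumes "Poly_Mapping.keys p \<subseteq> lists Y"
  shows "poly_value R g (const c * p) = c \<odot> poly_value R g p"
  using assms
proof (induction p rule: npoly_lists_induct)
  case zero
  then show ?case by (simp add: poly_value_0 scale_zero_right[OF algebra])
next
  case (single w a)
  then show ?case
    by (simp add: mult_single plus_list_def poly_value_single scale_scale[OF algebra] word_value_closed)
next
  case (add p q)
  moreover have "Poly_Mapping.keys (const c * p) \<subseteq> lists Y" "Poly_Mapping.keys (const c * q) \<subseteq> lists Y"
    using add keys_const_mult by blast+
  ultimately show ?case
    by (simp add: distrib_left poly_value_add poly_value_closed scale_add_right[OF algebra])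
qed

lemma poly_value_mult:
  assumes "Poly_Mapping.keys p \<subseteq> lists Y" "Poly_Mapping.keys q \<subseteq> lists Y"
  shows "poly_value R g (p * q) = poly_value R g p \<otimes> poly_value R g q"
  using assms(1)
proof (induction p rule: npoly_lists_induct)
  case zero
  then show ?case using assms by (simp add: poly_value_0 poly_value_closed)
next
  case (single u a)
  from assms(2) show ?case
  proof (induction q rule: npoly_lists_induct)
    case zero
    then show ?case using single by (simp add: poly_value_0 poly_value_single scale_closed[OF algebra] word_value_closed)
  next
    case (single v b)
    then show ?case using \<open>u \<in> lists Y\<close> word_value_closed
      by (simp add: mult_single plus_list_def poly_value_single word_value_append scale_closed[OF algebra]
          scale_scale[OF algebra, symmetric] scale_mult_left[OF algebra] scale_mult_right[OF algebra] mult.commute)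
  next
    case (add p q)
    have "Poly_Mapping.keys (Poly_Mapping.single u a) \<subseteq> lists Y" using single by simp
    with add show ?case
      by (simp add: distrib_left poly_value_add keys_mult_lists poly_value_closed R.r_distr)
  qed
next
  case (add p p')
  then show ?case using assms(2)
    by (simp add: distrib_right poly_value_add keys_mult_lists poly_value_closed R.l_distr)
qed

lemma poly_value_hom: "poly_value R g \<in> alg_hom (free_algebra Y) R"
proof (rule alg_homI)
  have "poly_value R g (word []) = \<one>"
    by (simp add: poly_value_single word_value_def scale_one[OF algebra])
  then show "poly_value R g \<one>\<^bsub>free_algebra Y\<^esub> = \<one>"
    by (simp add: const_one free_algebra_simps)
qed (auto simp: free_algebra_simps poly_value_closed poly_value_add intro: poly_value_mult poly_value_const_mult)

end

text \<open>The values of the letters \<open>(x, n)\<close> form a \<open>d\<close>-orbit for each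
  \<open>x\<close>; this makes the evaluation commute with the derivations.\<close>

locale differential_evaluation =
  evaluation R "Delta V" g for R :: "('k::field, 'a) module" (structure) and V :: "'x set" and g +
  fixes lam :: 'k and d :: "'a \<Rightarrow> 'a"
  assumes differential: "differential_algebra lam R d"
    and d_letter: "x \<in> V \<Longrightarrow> d (g (x, n)) = g (x, Suc n)"
begin

lemma d_zero: "d \<zero> = \<zero>"
  using differential_algebra.d_smult[OF differential, of \<zero> 0]
    differential_algebra.d_closed[OF differential, of \<zero>]
  by (simp add: scale_zero_left[OF algebra])

text \<open>The recursion of \<open>word_deriv\<close> is the Leibniz rule for a letter times a
  word, and \<open>d\<close> obeys the same rule in \<open>R\<close>.\<close>

lemma poly_value_word_deriv:
  "w \<in> lists (Delta V) \<Longrightarrow> poly_value R g (word_deriv lam w) = d (word_value R g w)"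
proof (induction w)
  case Nil
  then show ?case
    by (simp add: poly_value_0 word_value_def differential_algebra.d_one[OF differential])
next
  case (Cons l w)
  obtain x n where l: "l = (x, n)" "x \<in> V"
    using Cons.prems by (auto simp: Delta_def)
  have letter: "(x, m) \<in> Delta V" for m using l by (simp add: Delta_def)
  have keys: "Poly_Mapping.keys (word w :: ('x \<times> nat, 'k) npoly) \<subseteq> lists (Delta V)"
    "Poly_Mapping.keys (word_deriv lam w) \<subseteq> lists (Delta V)"
    "Poly_Mapping.keys (word [(x, m)] :: ('x \<times> nat, 'k) npoly) \<subseteq> lists (Delta V)" for m
    using Cons.prems keys_word_deriv[of w V lam] letter by simp_all
  note keys' = keys keys_mult_lists[OF keys(3) keys(1)] keys_mult_lists[OF keys(3) keys(2)]
  have val: "poly_value R g (word [(x, m)]) = g (x, m)" "poly_value R g (word w) = word_value R g w" for m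
    using Cons.prems
    by (simp_all only: poly_value_letter[OF letter])
      (simp add: poly_value_single scale_one[OF algebra] word_value_closed)
  have IH: "poly_value R g (word_deriv lam w) = d (word_value R g w)" using Cons by simp
  have keys_sum: "Poly_Mapping.keys (word [(x, Suc n)] * word w + word [(x, n)] * word_deriv lam w) \<subseteq> lists (Delta V)"
    "Poly_Mapping.keys (const lam * (word [(x, Suc n)] * word_deriv lam w)) \<subseteq> lists (Delta V)"
    using keys' by (intro order.trans[OF Poly_Mapping.keys_add] order.trans[OF keys_const_mult] Un_least; simp)+
  have "poly_value R g (word_deriv lam (l # w)) =
      g (x, Suc n) \<otimes> word_value R g w \<oplus> g (x, n) \<otimes> d (word_value R g w)
      \<oplus> lam \<odot> (g (x, Suc n) \<otimes> d (word_value R g w))"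
    by (simp only: l word_deriv.simps poly_value_add[OF keys_sum] poly_value_add[OF keys'(4,5)]
        poly_value_const_mult[OF keys'(5)] poly_value_mult[OF keys(3) keys(1)]
        poly_value_mult[OF keys(3) keys(2)] val IH)
  also have "\<dots> = d (g (x, n) \<otimes> word_value R g w)"
    using l letter Cons.prems
    by (simp add: differential_algebra.d_mult[OF differential] values_closed word_value_closed d_letter)
  finally show ?case by (simp add: l word_value_def)
qed

lemma poly_value_dX:
  assumes "Poly_Mapping.keys p \<subseteq> lists (Delta V)"
  shows "poly_value R g (dX lam p) = d (poly_value R g p)"
  using assms
proof (induction p rule: npoly_lists_induct)
  case zero
  then show ?case by (simp add: poly_value_0 d_zero)
next
  case (single w c)
  have "dX lam (Poly_Mapping.single w c) = const c * word_deriv lam w"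
    by (simp add: dX_def linear_ext_single)
  with single show ?case
    by (simp add: poly_value_single poly_value_const_mult keys_word_deriv poly_value_word_deriv
        differential_algebra.d_smult[OF differential] word_value_closed)
next
  case (add p q)
  then show ?case
    by (simp add: dX_add poly_value_add keys_dX poly_value_closed differential_algebra.d_add[OF differential])
qed

end

lemma emb_hom: "emb \<in> alg_hom (free_algebra \<X>) (free_algebra (Delta \<X>))"
  by (intro alg_homI) (auto simp: free_algebra_simps emb_add intro: emb_mult emb_const_mult dest: subsetD[OF keys_emb])

text \<open>Existence of the universal map is evaluation at \<open>d^n (\<phi> (\<pi> x))\<close>;
  it descends to the quotient because its kernel is a differential ideal. Uniqueness holds because
  differential homomorphisms are determined on letters.\<close>

theorem free_differential_algebra_quotient:
  fixes lam :: "'k::field" and \<X> :: "'x set" and A :: "('k, 'a) module" and \<pi> :: "('x, 'k) npoly \<Rightarrow> 'a"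
    and S :: "('x, 'k) npoly set"
  defines "P \<equiv> free_algebra (Delta \<X>) :: ('k, ('x \<times> nat, 'k) npoly) module"
  defines "J \<equiv> diff_ideal_gen P (dX lam) (emb ` S)"
  assumes A: "assoc_algebra A"
    and \<pi>: "\<pi> \<in> alg_hom (free_algebra \<X>) A"
    and surj: "\<pi> ` carrier (free_algebra \<X>) = carrier A"
    and S: "S \<subseteq> carrier (free_algebra \<X>)"
    and kernel: "a_kernel (free_algebra \<X>) A \<pi> = Idl\<^bsub>free_algebra \<X>\<^esub> S"
  shows "\<exists>i. (\<forall>f \<in> carrier (free_algebra \<X>). i (\<pi> f) = J +>\<^bsub>P\<^esub> emb f) \<and>
              free_differential_algebra TYPE('r) lam A (quotient_algebra P J) (quot_map P J (dX lam)) i"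
proof -
  let ?K = "free_algebra \<X> :: ('k, ('x, 'k) npoly) module"
  let ?D = "quotient_algebra P J"
  let ?dD = "quot_map P J (dX lam)"
  let ?pr = "\<lambda>p. J +>\<^bsub>P\<^esub> p"
  interpret K: ring ?K by (rule ring_free_algebra)
  have K: "assoc_algebra ?K" and P: "assoc_algebra P"
    unfolding P_def by (rule assoc_algebra_free_algebra)+
  have dP: "differential_algebra lam P (dX lam)"
    unfolding P_def by (rule differential_algebra_dX)
  have emb: "emb \<in> alg_hom ?K P" unfolding P_def by (rule emb_hom)
  have embS: "emb ` S \<subseteq> carrier P"
    using S alg_hom_closed[OF emb] by blast
  have J: "ideal J P" and dJ: "dX lam ` J \<subseteq> J" and SJ: "emb ` S \<subseteq> J"
    unfolding J_def using ideal_diff_ideal_gen[OF dP embS] diff_ideal_gen_closed[OF dP embS]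
      diff_ideal_gen_superset[OF dP embS] by auto
  note J' = J[unfolded P_def]
  have D: "assoc_algebra ?D" by (rule assoc_algebra_quotient[OF P J])
  have dD: "differential_algebra lam ?D ?dD" by (rule differential_algebra_quotient[OF dP J dJ])
  note pr = coset_hom[OF P J]
  note carr = carrier_quotient_algebra[OF P J]
  have carrK: "f \<in> carrier ?K \<longleftrightarrow> Poly_Mapping.keys f \<subseteq> lists \<X>" for f
    by (simp add: free_algebra_simps)
  have carrP: "p \<in> carrier P \<longleftrightarrow> Poly_Mapping.keys p \<subseteq> lists (Delta \<X>)" for p
    by (simp add: P_def free_algebra_simps)

  \<comment> \<open>The preimage of \<open>J\<close> under \<open>emb\<close> is an ideal containing
    \<open>S\<close>, hence contains the kernel of \<open>\<pi>\<close>. This makes \<open>i\<close>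
    well defined.\<close>
  have "ideal {f \<in> carrier ?K. emb f \<in> J} ?K"
  proof (rule ideal_free_algebraI)
    fix p q assume "p \<in> {f \<in> carrier ?K. emb f \<in> J}" "q \<in> {f \<in> carrier ?K. emb f \<in> J}"
    then show "p + q \<in> {f \<in> carrier ?K. emb f \<in> J}"
      using K.a_closed[of p q] ideal_add[OF J'] by (simp add: free_algebra_simps emb_add)
  qed (auto simp: carrK ideal_zero[OF J'] emb_mult keys_mult_lists ideal_mult_left[OF J'] ideal_mult_right[OF J'] keys_emb
      dest: subsetD[OF keys_mult_lists])
  then have "Idl\<^bsub>?K\<^esub> S \<subseteq> {f \<in> carrier ?K. emb f \<in> J}"
    using S SJ by (intro K.genideal_minimal) auto
  then have kernelJ: "emb f \<in> J" if "f \<in> carrier ?K" "\<pi> f = \<zero>\<^bsub>A\<^esub>" for f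
    using that unfolding kernel[symmetric] by (auto simp: a_kernel_def')
  have S0: "\<pi> s = \<zero>\<^bsub>A\<^esub>" if "s \<in> S" for s
    using K.genideal_self[OF S] that unfolding kernel[symmetric] by (auto simp: a_kernel_def')
  have wd: "?pr (emb f) = ?pr (emb f')" if f: "f \<in> carrier ?K" "f' \<in> carrier ?K" "\<pi> f = \<pi> f'" for f f'
  proof -
    interpret A: ring A by (rule ring_assoc_algebra[OF A])
    \<comment> \<open>The difference is written with the scalar \<open>- 1\<close>, since
      homomorphisms are known to respect sums and scalars.\<close>
    have f'K: "const (- 1) * f' \<in> carrier ?K"
      using f(2) keys_const_mult[of "- 1" f'] by (auto simp: carrK)
    have "\<pi> (f + const (- 1) * f') = \<pi> f \<oplus>\<^bsub>A\<^esub> (- 1) \<odot>\<^bsub>A\<^esub> \<pi> f'"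
      using alg_hom_add[OF \<pi> f(1) f'K] alg_hom_scale[OF \<pi> f(2)] by (simp add: free_algebra_simps)
    also have "\<dots> = (1 + - 1) \<odot>\<^bsub>A\<^esub> \<pi> f"
      using alg_hom_closed[OF \<pi> f(1)] f(3)
      by (simp only: scale_add_left[OF A] scale_one[OF A])
    also have "\<dots> = \<zero>\<^bsub>A\<^esub>"
      using alg_hom_closed[OF \<pi> f(1)] by (simp add: scale_zero_left[OF A])
    finally have "\<pi> (f - f') = \<zero>\<^bsub>A\<^esub>" by (simp add: single_uminus const_one)
    moreover have "f - f' \<in> carrier ?K"
      using f keys_diff[of f f'] by (auto simp: carrK)
    ultimately have "emb (f - f') \<in> J" by (intro kernelJ)
    then show ?thesis unfolding P_def by (simp add: coset_eq_iff[OF J'] emb_diff)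
  qed

  define i where "i a = ?pr (emb (SOME f. f \<in> carrier ?K \<and> \<pi> f = a))" for a
  have i: "i (\<pi> f) = ?pr (emb f)" if "f \<in> carrier ?K" for f
  proof -
    have "\<exists>f'. f' \<in> carrier ?K \<and> \<pi> f' = \<pi> f" using that by blast
    from someI_ex[OF this] show ?thesis unfolding i_def using that by (intro wd) auto
  qed
  have liftA: "\<exists>f. f \<in> carrier ?K \<and> a = \<pi> f" if "a \<in> carrier A" for a
    using that surj by blast
  have iA: "i \<in> alg_hom A ?D"
  proof (rule alg_homI)
    note pr_emb = alg_hom_compose[OF emb pr]
    note hom = alg_hom_mult[OF pr_emb] alg_hom_add[OF pr_emb] alg_hom_scale[OF pr_emb] alg_hom_closed[OF pr_emb]
      alg_hom_one[OF pr_emb]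
    note \<pi>' = alg_hom_mult[OF \<pi>, symmetric] alg_hom_add[OF \<pi>, symmetric] alg_hom_scale[OF \<pi>, symmetric]
    have cl: "f \<otimes>\<^bsub>?K\<^esub> f' \<in> carrier ?K" "f \<oplus>\<^bsub>?K\<^esub> f' \<in> carrier ?K" "c \<odot>\<^bsub>?K\<^esub> f \<in> carrier ?K"
      if "f \<in> carrier ?K" "f' \<in> carrier ?K" for f f' c
      using that scale_closed[OF K] by simp_all
    fix x y assume x: "x \<in> carrier A"
    obtain f where f: "f \<in> carrier ?K" "x = \<pi> f" using liftA[OF x] by blast
    show "i x \<in> carrier ?D" using f hom by (simp add: i)
    show "i (c \<odot>\<^bsub>A\<^esub> x) = c \<odot>\<^bsub>?D\<^esub> i x" for c
      using f hom cl[OF f(1) f(1)] by (simp add: \<pi>' i)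
    assume y: "y \<in> carrier A"
    obtain f' where f': "f' \<in> carrier ?K" "y = \<pi> f'" using liftA[OF y] by blast
    show "i (x \<otimes>\<^bsub>A\<^esub> y) = i x \<otimes>\<^bsub>?D\<^esub> i y" "i (x \<oplus>\<^bsub>A\<^esub> y) = i x \<oplus>\<^bsub>?D\<^esub> i y"
      using f f' hom cl[OF f(1) f'(1)] by (simp_all add: \<pi>' i)
  next
    show "i \<one>\<^bsub>A\<^esub> = \<one>\<^bsub>?D\<^esub>"
      using i[OF K.one_closed] alg_hom_one[OF \<pi>] alg_hom_one[OF emb] alg_hom_one[OF pr] by simp
  qed

  have universal: "\<exists>!\<psi>. \<psi> \<in> extensional (carrier ?D) \<and> \<psi> \<in> diff_hom ?D ?dD R d \<and> (\<forall>x \<in> carrier A. \<phi> x = \<psi> (i x))"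
    if dR: "differential_algebra lam R d" and \<phi>: "\<phi> \<in> alg_hom A R"
    for R :: "('k, 'r) module" and d \<phi>
  proof -
    have R: "assoc_algebra R" using dR by (rule differential_algebra.axioms)
    have h: "\<phi> \<circ> \<pi> \<in> alg_hom ?K R" by (rule alg_hom_compose[OF \<pi> \<phi>])
    \<comment> \<open>These values are forced: \<open>d^n\<close> must be applied to the image of
      \<open>x\<close>.\<close>
    define g where "g = (\<lambda>(x, n). (d ^^ n) (\<phi> (\<pi> (word [x]))))"
    have g: "g l \<in> carrier R" if l: "l \<in> Delta \<X>" for l
    proof -
      obtain x n where "l = (x, n)" "x \<in> \<X>" using l by (auto simp: Delta_def)
      moreover have "(d ^^ n) (\<phi> (\<pi> (word [x]))) \<in> carrier R" if "x \<in> \<X>" for n x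
        using alg_hom_closed[OF h, of "word [x]"] that
        by (induction n) (simp_all add: carrK differential_algebra.d_closed[OF dR])
      ultimately show ?thesis by (simp add: g_def)
    qed
    interpret ev: differential_evaluation R \<X> g lam d
      by (intro differential_evaluation.intro evaluation.intro evaluation_axioms.intro
          differential_evaluation_axioms.intro ring_assoc_algebra R dR g) (simp_all add: g_def)
    let ?ev = "poly_value R g"
    have ev: "?ev \<in> alg_hom P R" unfolding P_def by (rule ev.poly_value_hom)
    have ev_emb: "?ev (emb f) = \<phi> (\<pi> f)" if "f \<in> carrier ?K" for f
    proof -
      have "(?ev \<circ> emb) f = (\<phi> \<circ> \<pi>) f"
      proof (rule alg_hom_free_algebra_eq[OF R alg_hom_compose[OF emb ev] h])
        fix x assume "x \<in> \<X>"
        then show "(?ev \<circ> emb) (word [x]) = (\<phi> \<circ> \<pi>) (word [x])"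
          by (simp add: emb_single ev.poly_value_letter Delta_def) (simp add: g_def)
      qed (use that in \<open>simp add: carrK\<close>)
      then show ?thesis by simp
    qed
    have ev_dX: "?ev (dX lam p) = d (?ev p)" if "p \<in> carrier P" for p
      using that by (simp add: ev.poly_value_dX carrP)

    have "ideal {p \<in> carrier P. ?ev p = \<zero>\<^bsub>R\<^esub>} P"
      unfolding P_def
    proof (rule ideal_free_algebraI)
      fix p q assume "p \<in> {p \<in> carrier (free_algebra (Delta \<X>)). ?ev p = \<zero>\<^bsub>R\<^esub>}"
        "q \<in> {p \<in> carrier (free_algebra (Delta \<X>)). ?ev p = \<zero>\<^bsub>R\<^esub>}"
      then show "p + q \<in> {p \<in> carrier (free_algebra (Delta \<X>)). ?ev p = \<zero>\<^bsub>R\<^esub>}"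
        using Poly_Mapping.keys_add[of p q] by (auto simp: free_algebra_simps ev.poly_value_add)
    qed (auto simp: free_algebra_simps ev.poly_value_0 ev.poly_value_mult ev.poly_value_closed
        dest: subsetD[OF keys_mult_lists])
    then have "J \<subseteq> {p \<in> carrier P. ?ev p = \<zero>\<^bsub>R\<^esub>}"
      unfolding J_def
    proof (rule diff_ideal_gen_minimal)
      show "dX lam ` {p \<in> carrier P. ?ev p = \<zero>\<^bsub>R\<^esub>} \<subseteq> {p \<in> carrier P. ?ev p = \<zero>\<^bsub>R\<^esub>}"
        using ev_dX differential_algebra.d_closed[OF dP] by (auto simp: ev.d_zero)
      show "emb ` S \<subseteq> {p \<in> carrier P. ?ev p = \<zero>\<^bsub>R\<^esub>}"
        using embS S S0 alg_hom_zero[OF \<phi> A R] by (auto simp: ev_emb subset_iff)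
    qed
    then have evJ: "?ev p = \<zero>\<^bsub>R\<^esub>" if "p \<in> J" for p using that by blast

    \<comment> \<open>Evaluation at an arbitrary representative, restricted so that the map is
      extensional.\<close>
    define \<psi> where "\<psi> = restrict (\<lambda>C. ?ev (SOME p. p \<in> C)) (carrier ?D)"
    have \<psi>: "\<psi> (?pr p) = ?ev p" if p: "p \<in> carrier P" for p
    proof -
      have "?ev q = ?ev p" if "q \<in> ?pr p" for q
      proof -
        obtain j where "j \<in> J" "q = j + p"
          using \<open>q \<in> ?pr p\<close> by (auto simp: a_r_coset_def' P_def free_algebra_simps)
        then show ?thesis
          using p ideal_keys[OF J'] evJ by (simp add: ev.poly_value_add ev.poly_value_closed carrP)
      qed
      moreover have "p \<in> ?pr p"
        using ideal_zero[OF J'] by (force simp: a_r_coset_def' P_def free_algebra_simps)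
      then have "(SOME q. q \<in> ?pr p) \<in> ?pr p" by (rule someI)
      ultimately have "?ev (SOME q. q \<in> ?pr p) = ?ev p" by blast
      moreover have "?pr p \<in> carrier ?D" using p by (simp add: carr)
      ultimately show ?thesis by (simp add: \<psi>_def)
    qed
    have "\<psi> \<in> alg_hom ?D R"
    proof (rule alg_homI)
      note hs = alg_hom_mult[OF pr, symmetric] alg_hom_add[OF pr, symmetric] alg_hom_scale[OF pr, symmetric]
      interpret P: ring P by (rule ring_assoc_algebra[OF P])
      fix x y assume x: "x \<in> carrier ?D"
      obtain p where p: "p \<in> carrier P" "x = ?pr p" using x carr by auto
      show "\<psi> x \<in> carrier R" using p alg_hom_closed[OF ev] by (simp add: \<psi>)
      show "\<psi> (c \<odot>\<^bsub>?D\<^esub> x) = c \<odot>\<^bsub>R\<^esub> \<psi> x" for c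
        using p by (simp add: hs \<psi> scale_closed[OF P] alg_hom_scale[OF ev])
      assume y: "y \<in> carrier ?D"
      obtain q where q: "q \<in> carrier P" "y = ?pr q" using y carr by auto
      show "\<psi> (x \<otimes>\<^bsub>?D\<^esub> y) = \<psi> x \<otimes>\<^bsub>R\<^esub> \<psi> y" "\<psi> (x \<oplus>\<^bsub>?D\<^esub> y) = \<psi> x \<oplus>\<^bsub>R\<^esub> \<psi> y"
        using p q by (simp_all add: hs \<psi> alg_hom_mult[OF ev] alg_hom_add[OF ev])
    next
      interpret P: ring P by (rule ring_assoc_algebra[OF P])
      show "\<psi> \<one>\<^bsub>?D\<^esub> = \<one>\<^bsub>R\<^esub>"
        using \<psi>[OF P.one_closed] alg_hom_one[OF pr] alg_hom_one[OF ev] by simp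
    qed
    moreover have "\<psi> (?dD x) = d (\<psi> x)" if x: "x \<in> carrier ?D" for x
    proof -
      obtain p where p: "p \<in> carrier P" "x = ?pr p" using x carr by auto
      then show ?thesis
        using differential_algebra.d_closed[OF dP]
        by (simp add: quot_map_differential[OF dP J dJ] \<psi> ev_dX)
    qed
    ultimately have \<psi>_hom: "\<psi> \<in> diff_hom ?D ?dD R d" by (simp add: diff_hom_def)
    have \<psi>_i: "\<phi> x = \<psi> (i x)" if "x \<in> carrier A" for x
      using liftA[OF that] alg_hom_closed[OF emb] by (auto simp: i \<psi> ev_emb)
    show ?thesis
    proof (rule ex1I[of _ \<psi>])
      show "\<psi> \<in> extensional (carrier ?D) \<and> \<psi> \<in> diff_hom ?D ?dD R d \<and> (\<forall>x \<in> carrier A. \<phi> x = \<psi> (i x))"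
        using \<psi>_hom \<psi>_i by (simp add: \<psi>_def)
    next
      fix \<psi>' assume *: "\<psi>' \<in> extensional (carrier ?D) \<and> \<psi>' \<in> diff_hom ?D ?dD R d \<and> (\<forall>x \<in> carrier A. \<phi> x = \<psi>' (i x))"
      then have \<psi>': "\<psi>' \<in> alg_hom ?D R" and d\<psi>': "\<And>x. x \<in> carrier ?D \<Longrightarrow> \<psi>' (?dD x) = d (\<psi>' x)"
        by (auto simp: diff_hom_def)
      \<comment> \<open>Order 0 is fixed by the condition on \<open>i\<close>, and each further
        order by compatibility with the derivations.\<close>
      have letter: "\<psi>' (?pr (word [(x, n)])) = g (x, n)" if "x \<in> \<X>" for x n
      proof (induction n)
        case 0
        have "word [x] \<in> carrier ?K" using that by (simp add: carrK)
        then have "\<phi> (\<pi> (word [x])) = \<psi>' (?pr (emb (word [x])))"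
          using * alg_hom_closed[OF \<pi>] i by metis
        then show ?case by (simp add: emb_single g_def)
      next
        case (Suc n)
        have w: "word [(x, n)] \<in> carrier P" using that by (simp add: carrP Delta_def)
        then have "\<psi>' (?pr (dX lam (word [(x, n)]))) = d (\<psi>' (?pr (word [(x, n)])))"
          using d\<psi>'[of "?pr (word [(x, n)])"] carr by (simp add: quot_map_differential[OF dP J dJ])
        then show ?case using Suc by (simp add: dX_letter g_def)
      qed
      have eq: "\<psi>' (?pr p) = ?ev p" if "p \<in> carrier P" for p
      proof -
        have "\<psi>' \<circ> ?pr \<in> alg_hom (free_algebra (Delta \<X>)) R" "?ev \<in> alg_hom (free_algebra (Delta \<X>)) R"
          using alg_hom_compose[OF pr \<psi>'] ev by (simp_all only: P_def)
        then have "(\<psi>' \<circ> ?pr) p = ?ev p"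
        proof (rule alg_hom_free_algebra_eq[OF R])
          fix l assume "l \<in> Delta \<X>"
          then show "(\<psi>' \<circ> ?pr) (word [l]) = ?ev (word [l])"
            using letter by (cases l) (auto simp: ev.poly_value_letter Delta_def)
        qed (use that in \<open>simp add: carrP\<close>)
        then show ?thesis by simp
      qed
      have "\<psi> \<in> extensional (carrier ?D)" by (simp add: \<psi>_def)
      then show "\<psi>' = \<psi>"
        using * by (intro extensionalityI[of \<psi>' "carrier ?D" \<psi>]) (auto simp: carr eq \<psi>)
    qed
  qed
  have "free_differential_algebra TYPE('r) lam A ?D ?dD i"
    unfolding free_differential_algebra_def
    by (intro conjI allI impI dD iA) (elim conjE, rule universal)
  with i show ?thesis by blast
qed

theorem proposition3p2:
  fixes lam :: "'k::field_char_0"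
    and \<X> :: "'x::wellorder set"
    and A :: "('k, 'a) module"
    and \<pi> :: "('x, 'k) npoly \<Rightarrow> 'a"
    and I_A S_A :: "('x, 'k) npoly set"
  assumes "assoc_algebra A"
    and "\<pi> \<in> alg_hom (free_algebra \<X>) A"
    and "\<pi> ` carrier (free_algebra \<X>) = carrier A"
    and "a_kernel (free_algebra \<X>) A \<pi> = I_A"
    and "groebner_shirshov_basis letter_less \<X> S_A I_A"
  shows
    "DIrr lam \<X> (emb ` S_A) =
       {w \<in> lists (Delta \<X>).
          \<forall>u \<in> lead letter_less ` S_A. \<forall>n. \<not> sublist (bracket_word lam n u) w} \<and>
     (let P = free_algebra (Delta \<X>);
          J = diff_ideal_gen P (dX lam) (emb ` S_A);
          D = quotient_algebra P J
      in (\<exists>i. (\<forall>f \<in> carrier (free_algebra \<X>). i (\<pi> f) = J +>\<^bsub>P\<^esub> emb f) \<and>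
              free_differential_algebra TYPE('r) lam A D (quot_map P J (dX lam)) i) \<and>
         inj_on (\<lambda>w. J +>\<^bsub>P\<^esub> word w) (DIrr lam \<X> (emb ` S_A)) \<and>
         linear_basis D ((\<lambda>w. J +>\<^bsub>P\<^esub> word w) ` DIrr lam \<X> (emb ` S_A)))"
proof -
  let ?P = "free_algebra (Delta \<X>) :: ('k, ('x \<times> nat, 'k) npoly) module"
  let ?J = "diff_ideal_gen ?P (dX lam) (emb ` S_A)"
  let ?B = "DIrr lam \<X> (emb ` S_A)"
  have S: "S_A \<subseteq> carrier (free_algebra \<X>)" and monic: "\<And>s. s \<in> S_A \<Longrightarrow> monic letter_less s"
    and I_A: "I_A = Idl\<^bsub>free_algebra \<X>\<^esub> S_A"
    and overlap: "\<And>f g u v. \<lbrakk>f \<in> S_A; g \<in> S_A; u \<in> lists \<X>; v \<in> lists \<X>;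
        lead letter_less f @ u = v @ lead letter_less g;
        length (lead letter_less f @ u) < length (lead letter_less f) + length (lead letter_less g)\<rbrakk>
      \<Longrightarrow> trivial_modulo letter_less \<X> S_A (lead letter_less f @ u) (f * word u - word v * g)"
    and inclusion: "\<And>f g u v. \<lbrakk>f \<in> S_A; g \<in> S_A; u \<in> lists \<X>; v \<in> lists \<X>;
        lead letter_less f = u @ lead letter_less g @ v\<rbrakk>
      \<Longrightarrow> trivial_modulo letter_less \<X> S_A (lead letter_less f) (f - word u * g * word v)"
    using assms(5) unfolding groebner_shirshov_basis_def by blast+
  have DIrr: "?B = {w \<in> lists (Delta \<X>).
      \<forall>u \<in> lead letter_less ` S_A. \<forall>n. \<not> sublist (bracket_word lam n u) w}"
    using monic by (rule DIrr_eq)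
  have embS: "emb ` S_A \<subseteq> carrier ?P"
    using S alg_hom_closed[OF emb_hom] by blast
  have J: "ideal ?J ?P"
    by (rule ideal_diff_ideal_gen[OF differential_algebra_dX embS])
  have derivs: "(dX lam ^^ i) s \<in> ?J" if "s \<in> emb ` S_A" for i s
    using that diff_ideal_gen_superset[OF differential_algebra_dX embS, of lam]
      diff_ideal_gen_closed[OF differential_algebra_dX embS]
    by (induction i) auto
  have "p = 0" if p: "p \<in> ?J" "Poly_Mapping.keys p \<subseteq> ?B" for p
  proof (cases "\<exists>s \<in> S_A. lead letter_less s = []")
    case True
    \<comment> \<open>An empty leading word makes every word reducible, so \<open>p\<close> has no
      terms at all.\<close>
    then have "?B = {}" by (force simp: DIrr bracket_word_def)
    then show ?thesis using p(2) by simp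
  next
    case False
    interpret differential_gs_system lam \<X> S_A
    proof
      fix f g u v
      assume "f \<in> S_A" "g \<in> S_A" "u \<in> lists \<X>" "v \<in> lists \<X>"
        and eq: "lead letter_less f @ u = v @ lead letter_less g"
        and "length v < length (lead letter_less f)"
      \<comment> \<open>As the whole word is \<open>v\<close> followed by
        \<open>lead letter_less g\<close>, the two length conditions are equivalent.\<close>
      moreover from this have "length (lead letter_less f @ u) < length (lead letter_less f) + length (lead letter_less g)"
        by (simp only: eq) simp
      ultimately show "trivial_modulo letter_less \<X> S_A (lead letter_less f @ u) (f * word u - word v * g)"
        using overlap by blast
    qed (use S monic inclusion False in \<open>auto simp: free_algebra_simps\<close>)
    show ?thesis using p by (rule diff_ideal_irreducible_zero)
  qed
  moreover have "?B \<subseteq> lists (Delta \<X>)" by (auto simp: DIrr_def)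
  moreover have "\<exists>q. Poly_Mapping.keys q \<subseteq> ?B \<and> p - q \<in> ?J" if "Poly_Mapping.keys p \<subseteq> lists (Delta \<X>)" for p
    using J derivs that by (rule irreducible_spanning)
  ultimately have "inj_on (\<lambda>w. ?J +>\<^bsub>?P\<^esub> word w) ?B \<and>
      linear_basis (quotient_algebra ?P ?J) ((\<lambda>w. ?J +>\<^bsub>?P\<^esub> word w) ` ?B)"
    using linear_basis_quotient[OF J] by blast
  moreover have "\<exists>i. (\<forall>f \<in> carrier (free_algebra \<X>). i (\<pi> f) = ?J +>\<^bsub>?P\<^esub> emb f) \<and>
      free_differential_algebra TYPE('r) lam A (quotient_algebra ?P ?J) (quot_map ?P ?J (dX lam)) i"
    using assms(1-3) S assms(4) unfolding I_A by (rule free_differential_algebra_quotient)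
  ultimately show ?thesis using DIrr unfolding Let_def by blast
qed

end
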